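(* Let $m\in\mathbb{N}$ and let $\Omega$ be a class of unital $C^*$-algebras, each of which is $m$-almost divisible. Let $A\in\mathrm{TAA}\Omega$ be a simple unital stably finite $C^*$-algebra such that for any $n\in\mathbb{N}$ and any unital hereditary $C^*$-subalgebra $D$ of $\mathrm{M}_n(A)$, $D$ belongs to the class $\mathrm{TAA}\Omega$. Then $A$ is weakly $(2,m)$-almost divisible.
   Context: $\mathbb{N}$ denotes the positive integers. **Cuntz comparison.** Let $\mathrm{M}_\infty(A)$ be the algebraic inductive limit of the matrix algebras $\mathrm{M}_n(A)$ under the upper left-hand corner embeddings, and $\mathrm{M}_\infty(A)_+$ its positive elements. For $a,b\in \mathrm{M}_\infty(A)_+$, write $a\precsim b$ if there is a sequence $(v_n)$ in $\mathrm{M}_\infty(A)$ with $\lim_{n\to\infty}\|v_nbv_n^*-a\|=0$, and $a\sim b$ if $a\precsim b$ and $b\precsim a$. Write $\langle a\rangle$ for the class of $a$ under $\sim$; set $\langle a\rangle+\langle b\rangle=\langle a\oplus b\rangle$, and $\langle a\rangle\le\langle b\rangle$ iff $a\precsim b$. For $\varepsilon>0$, $(a-\varepsilon)_+$ denotes the functional calculus of $a$ at $t\mapsto\max(0,t-\varepsilon)$. **Almost divisibility.** Let $m\in\mathbb{N}$. A $C^*$-algebra $A$ is $m$-almost divisible if for each $a\in\mathrm{M}_\infty(A)_+$, $k\in\mathbb{N}$, and $\varepsilon>0$, there exists $b\in\mathrm{M}_\infty(A)_+$ such that $k\langle b\rangle\le\langle a\rangle$ and $\langle(a-\varepsilon)_+\rangle\le(k+1)(m+1)\langle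 b\rangle$. **Weak almost divisibility.** Let $n,m\in\mathbb{N}$. A $C^*$-algebra $A$ is weakly $(n,m)$-almost divisible if for each $a\in\mathrm{M}_\infty(A)_+$, $k\in\mathbb{N}$, and $\varepsilon>0$, there exists $b\in\mathrm{M}_\infty(A)_+$ such that $k\langle b\rangle\le n\langle a\rangle$ and $\langle(a-\varepsilon)_+\rangle\le(k+1)(m+1)\langle b\rangle$. **Notation.** For $x\in A$, a subset $B\subseteq A$ and $\varepsilon>0$, $x\in_\varepsilon B$ means that there is $y\in B$ with $\|x-y\|<\varepsilon$. **The class $\mathrm{TAA}\Omega$.** Let $\Omega$ be a class of unital $C^*$-algebras. A simple unital $C^*$-algebra $A$ belongs to $\mathrm{TAA}\Omega$ if for any $\varepsilon>0$, any finite subset $F\subseteq A$, and any non-zero $a\in A$ with $a\ge 0$, there exist a projection $p\in A$, a $C^*$-subalgebra $B$ of $A$ with $1_B=p$ and $B\in\Omega$, and a projection $q\in B$ such that (1) $qx\in_\varepsilon B$ and $xq\in_\varepsilon B$ for all $x\in F$; (2) $1-q\precsim a$; (3) $\|qaq\|\ge\|a\|-\varepsilon$. Here the unit $1_B=p$ of $B$ need not be the unit $1$ of $A$. *)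

theory Defs
  imports
    "HOL-Analysis.Analysis"
    "HOL-Algebra.Algebraic_Closure_Type"
begin

section \<open>C*-algebras\<close>

text \<open>
  A *-algebra is a record with an explicit carrier, so that matrix algebras and subalgebras of an
  algebra are objects of the same kind. The field \<^const>\<open>one\<close> is meaningful only for unital algebras.
\<close>

record 'a star_alg = "(complex, 'a) module" +
  star :: "'a \<Rightarrow> 'a"
  cnorm :: "'a \<Rightarrow> real"

abbreviation complex_ring :: "complex ring" where
  "complex_ring \<equiv> ring_of_type_algebra"

text \<open>The locale \<^locale>\<open>Metric_space\<close> wants a distance that is nonnegative and symmetric also off the
  carrier; hence the guard.\<close>

definition cdist :: "'a star_alg \<Rightarrow> 'a \<Rightarrow> 'a \<Rightarrow> real" where
  "cdist A x y =
     (if x \<in> carrier A \<and> y \<in> carrier A then cnorm A (x \<ominus>\<^bsub>A\<^esub> y) else 0)"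

locale cstar_algebra = module complex_ring A for A :: "'a star_alg" (structure) +
  assumes mult_closed: "\<lbrakk>x \<in> carrier A; y \<in> carrier A\<rbrakk> \<Longrightarrow> x \<otimes> y \<in> carrier A"
    and mult_assoc: "\<lbrakk>x \<in> carrier A; y \<in> carrier A; z \<in> carrier A\<rbrakk> \<Longrightarrow>
          (x \<otimes> y) \<otimes> z = x \<otimes> (y \<otimes> z)"
    and mult_distrib_right: "\<lbrakk>x \<in> carrier A; y \<in> carrier A; z \<in> carrier A\<rbrakk> \<Longrightarrow>
          (x \<oplus> y) \<otimes> z = x \<otimes> z \<oplus> y \<otimes> z"
    and mult_distrib_left: "\<lbrakk>x \<in> carrier A; y \<in> carrier A; z \<in> carrier A\<rbrakk> \<Longrightarrow>
          z \<otimes> (x \<oplus> y) = z \<otimes> x \<oplus> z \<otimes> y"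
    and smult_mult_left: "\<lbrakk>x \<in> carrier A; y \<in> carrier A\<rbrakk> \<Longrightarrow> (c \<odot> x) \<otimes> y = c \<odot> (x \<otimes> y)"
    and smult_mult_right: "\<lbrakk>x \<in> carrier A; y \<in> carrier A\<rbrakk> \<Longrightarrow> x \<otimes> (c \<odot> y) = c \<odot> (x \<otimes> y)"
    and star_closed: "x \<in> carrier A \<Longrightarrow> star A x \<in> carrier A"
    and star_star: "x \<in> carrier A \<Longrightarrow> star A (star A x) = x"
    and star_add: "\<lbrakk>x \<in> carrier A; y \<in> carrier A\<rbrakk> \<Longrightarrow> star A (x \<oplus> y) = star A x \<oplus> star A y"
    and star_smult: "x \<in> carrier A \<Longrightarrow> star A (c \<odot> x) = cnj c \<odot> star A x"
    and star_mult: "\<lbrakk>x \<in> carrier A; y \<in> carrier A\<rbrakk> \<Longrightarrow> star A (x \<otimes> y) = star A y \<otimes> star A x"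
    and cnorm_nonneg: "x \<in> carrier A \<Longrightarrow> 0 \<le> cnorm A x"
    and cnorm_eq_0_iff: "x \<in> carrier A \<Longrightarrow> cnorm A x = 0 \<longleftrightarrow> x = \<zero>"
    and cnorm_triangle: "\<lbrakk>x \<in> carrier A; y \<in> carrier A\<rbrakk> \<Longrightarrow> cnorm A (x \<oplus> y) \<le> cnorm A x + cnorm A y"
    and cnorm_smult: "x \<in> carrier A \<Longrightarrow> cnorm A (c \<odot> x) = cmod c * cnorm A x"
    and cnorm_mult: "\<lbrakk>x \<in> carrier A; y \<in> carrier A\<rbrakk> \<Longrightarrow> cnorm A (x \<otimes> y) \<le> cnorm A x * cnorm A y"
    and cstar_identity: "x \<in> carrier A \<Longrightarrow> cnorm A (star A x \<otimes> x) = (cnorm A x)\<^sup>2"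
    and complete: "Metric_space.mcomplete (carrier A) (cdist A)"

locale unital_cstar_algebra = cstar_algebra A + monoid A for A :: "'a star_alg" (structure)

definition star_isomorphic :: "'a star_alg \<Rightarrow> 'b star_alg \<Rightarrow> bool" where
  "star_isomorphic A B \<longleftrightarrow> (\<exists>\<phi>. bij_betw \<phi> (carrier A) (carrier B) \<and>
     (\<forall>x\<in>carrier A. \<forall>y\<in>carrier A.
        \<phi> (x \<oplus>\<^bsub>A\<^esub> y) = \<phi> x \<oplus>\<^bsub>B\<^esub> \<phi> y \<and> \<phi> (x \<otimes>\<^bsub>A\<^esub> y) = \<phi> x \<otimes>\<^bsub>B\<^esub> \<phi> y) \<and>
     (\<forall>x\<in>carrier A. \<forall>c. \<phi> (c \<odot>\<^bsub>A\<^esub> x) = c \<odot>\<^bsub>B\<^esub> \<phi> x) \<and>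
     (\<forall>x\<in>carrier A. \<phi> (star A x) = star B (\<phi> x)))"

definition norm_closed :: "'a star_alg \<Rightarrow> 'a set \<Rightarrow> bool" where
  "norm_closed A S \<longleftrightarrow> closedin (Metric_space.mtopology (carrier A) (cdist A)) S"

definition cstar_subalgebra :: "'a set \<Rightarrow> 'a star_alg \<Rightarrow> bool" where
  "cstar_subalgebra B A \<longleftrightarrow> submodule B complex_ring A \<and>
     (\<forall>x\<in>B. \<forall>y\<in>B. x \<otimes>\<^bsub>A\<^esub> y \<in> B) \<and> (\<forall>x\<in>B. star A x \<in> B) \<and> norm_closed A B"

definition is_unit_of :: "'a star_alg \<Rightarrow> 'a set \<Rightarrow> 'a \<Rightarrow> bool" where
  "is_unit_of A B e \<longleftrightarrow> e \<in> B \<and> (\<forall>x\<in>B. e \<otimes>\<^bsub>A\<^esub> x = x \<and> x \<otimes>\<^bsub>A\<^esub> e = x)"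

text \<open>The unit \<open>e\<close> of a subalgebra need not be the unit of the ambient algebra.\<close>

definition unital_subalg :: "'a star_alg \<Rightarrow> 'a set \<Rightarrow> 'a \<Rightarrow> 'a star_alg" where
  "unital_subalg A B e = A\<lparr>carrier := B, one := e\<rparr>"

definition closed_ideal :: "'a set \<Rightarrow> 'a star_alg \<Rightarrow> bool" where
  "closed_ideal I A \<longleftrightarrow> submodule I complex_ring A \<and>
     (\<forall>x\<in>I. \<forall>a\<in>carrier A. a \<otimes>\<^bsub>A\<^esub> x \<in> I \<and> x \<otimes>\<^bsub>A\<^esub> a \<in> I) \<and> norm_closed A I"

text \<open>The zero algebra counts as unital and as simple.\<close>

definition simple_alg :: "'a star_alg \<Rightarrow> bool" where
  "simple_alg A \<longleftrightarrow> (\<forall>I. closed_ideal I A \<longrightarrow> I = {\<zero>\<^bsub>A\<^esub>} \<or> I = carrier A)"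


section \<open>Positive elements, projections, functional calculus\<close>

text \<open>
  The spectrum is taken in the unitization, where \<open>1 - x\<close> is invertible iff \<open>x + y = xy = yx\<close> for
  some \<open>y\<close> in the algebra itself. So it always contains \<open>0\<close>, and for a unital algebra it is the usual
  spectrum together with \<open>0\<close>; neither positivity nor \<open>f(a)\<close> for \<open>f(0) = 0\<close> is affected.
\<close>

definition quasi_invertible :: "'a star_alg \<Rightarrow> 'a \<Rightarrow> bool" where
  "quasi_invertible A x \<longleftrightarrow>
     (\<exists>y\<in>carrier A. x \<oplus>\<^bsub>A\<^esub> y = x \<otimes>\<^bsub>A\<^esub> y \<and> x \<oplus>\<^bsub>A\<^esub> y = y \<otimes>\<^bsub>A\<^esub> x)"

definition spec :: "'a star_alg \<Rightarrow> 'a \<Rightarrow> complex set" where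
  "spec A a = insert 0 {z. z \<noteq> 0 \<and> \<not> quasi_invertible A (inverse z \<odot>\<^bsub>A\<^esub> a)}"

definition positive :: "'a star_alg \<Rightarrow> 'a set" where
  "positive A = {a \<in> carrier A. star A a = a \<and> (\<forall>z\<in>spec A a. z \<in> \<real> \<and> 0 \<le> Re z)}"

definition alg_le :: "'a star_alg \<Rightarrow> 'a \<Rightarrow> 'a \<Rightarrow> bool" where
  "alg_le A a b \<longleftrightarrow> b \<ominus>\<^bsub>A\<^esub> a \<in> positive A"

definition projection :: "'a star_alg \<Rightarrow> 'a \<Rightarrow> bool" where
  "projection A p \<longleftrightarrow> p \<in> carrier A \<and> star A p = p \<and> p \<otimes>\<^bsub>A\<^esub> p = p"

definition mvn_equiv :: "'a star_alg \<Rightarrow> 'a \<Rightarrow> 'a \<Rightarrow> bool" where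
  "mvn_equiv A p q \<longleftrightarrow> (\<exists>v\<in>carrier A. star A v \<otimes>\<^bsub>A\<^esub> v = p \<and> v \<otimes>\<^bsub>A\<^esub> star A v = q)"

definition finite_projection :: "'a star_alg \<Rightarrow> 'a \<Rightarrow> bool" where
  "finite_projection A p \<longleftrightarrow> projection A p \<and>
     (\<forall>q. projection A q \<longrightarrow> mvn_equiv A p q \<longrightarrow> alg_le A q p \<longrightarrow> q = p)"

definition hereditary_subalgebra :: "'a set \<Rightarrow> 'a star_alg \<Rightarrow> bool" where
  "hereditary_subalgebra D A \<longleftrightarrow> cstar_subalgebra D A \<and>
     (\<forall>a\<in>positive A. \<forall>d\<in>D \<inter> positive A. alg_le A a d \<longrightarrow> a \<in> D)"

definition pow_Suc :: "'a star_alg \<Rightarrow> 'a \<Rightarrow> nat \<Rightarrow> 'a" where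
  "pow_Suc A a n = ((\<lambda>x. x \<otimes>\<^bsub>A\<^esub> a) ^^ n) a"

text \<open>The value at \<open>a\<close> of the polynomial \<open>t p(t)\<close>, which makes sense without a unit.\<close>

definition poly_eval :: "'a star_alg \<Rightarrow> real poly \<Rightarrow> 'a \<Rightarrow> 'a" where
  "poly_eval A p a =
     finsum A (\<lambda>i. complex_of_real (Polynomial.coeff p i) \<odot>\<^bsub>A\<^esub> pow_Suc A a i) {..Polynomial.degree p}"

text \<open>
  Continuous functional calculus of a self-adjoint \<open>a\<close>, for real \<open>f\<close> continuous on the spectrum with
  \<open>f(0) = 0\<close>: if real polynomials without constant term tend to \<open>f\<close> uniformly on the spectrum,
  their values at \<open>a\<close> tend to \<open>f(a)\<close>.
\<close>

definition has_cfc :: "'a star_alg \<Rightarrow> (real \<Rightarrow> real) \<Rightarrow> 'a \<Rightarrow> 'a \<Rightarrow> bool" where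
  "has_cfc A f a c \<longleftrightarrow> c \<in> carrier A \<and>
     (\<exists>p :: nat \<Rightarrow> real poly.
        uniform_limit {t. complex_of_real t \<in> spec A a} (\<lambda>n t. t * poly (p n) t) f sequentially \<and>
        (\<lambda>n. cnorm A (poly_eval A (p n) a \<ominus>\<^bsub>A\<^esub> c)) \<longlonglongrightarrow> 0)"

definition cfc :: "'a star_alg \<Rightarrow> (real \<Rightarrow> real) \<Rightarrow> 'a \<Rightarrow> 'a" where
  "cfc A f a = (THE c. has_cfc A f a c)"

definition cutdown :: "'a star_alg \<Rightarrow> 'a \<Rightarrow> real \<Rightarrow> 'a" where
  "cutdown A a \<epsilon> = cfc A (\<lambda>t. max 0 (t - \<epsilon>)) a"


section \<open>Matrix algebras\<close>

text \<open>
  An element of \<open>M_n(A)\<close> is a matrix indexed by all natural numbers whose entries outside the upper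
  left \<open>n \<times> n\<close> block vanish. The corner embeddings become inclusions and \<open>M_\<infinity>(A)\<close> is the union of
  the \<open>M_n(A)\<close>.
\<close>

type_synonym 'a inf_mat = "nat \<Rightarrow> nat \<Rightarrow> 'a"

definition mat_carrier :: "nat \<Rightarrow> 'a star_alg \<Rightarrow> 'a inf_mat set" where
  "mat_carrier n A = {x. (\<forall>i j. x i j \<in> carrier A) \<and> (\<forall>i j. n \<le> i \<or> n \<le> j \<longrightarrow> x i j = \<zero>\<^bsub>A\<^esub>)}"

text \<open>
  The norm of a matrix is its operator norm on finitely supported columns \<open>\<xi>\<close>, where
  \<open>\<parallel>\<xi>\<parallel> = \<parallel>\<Sum>\<^sub>i \<xi>\<^sub>i* \<xi>\<^sub>i\<parallel> powr (1/2)\<close>; this is the action of \<open>M_n(A)\<close> on the Hilbert module \<open>A\<^sup>n\<close>, and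
  gives the C*-norm of \<open>M_n(A)\<close>. Sums range over supports because \<^const>\<open>finsum\<close> needs finite sets.
\<close>

definition columns :: "'a star_alg \<Rightarrow> (nat \<Rightarrow> 'a) set" where
  "columns A = {\<xi>. (\<forall>i. \<xi> i \<in> carrier A) \<and> finite {i. \<xi> i \<noteq> \<zero>\<^bsub>A\<^esub>}}"

definition col_norm :: "'a star_alg \<Rightarrow> (nat \<Rightarrow> 'a) \<Rightarrow> real" where
  "col_norm A \<xi> = sqrt (cnorm A (finsum A (\<lambda>i. star A (\<xi> i) \<otimes>\<^bsub>A\<^esub> \<xi> i) {i. \<xi> i \<noteq> \<zero>\<^bsub>A\<^esub>}))"

definition mat_vec :: "'a star_alg \<Rightarrow> 'a inf_mat \<Rightarrow> (nat \<Rightarrow> 'a) \<Rightarrow> nat \<Rightarrow> 'a" where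
  "mat_vec A x \<xi> = (\<lambda>i. finsum A (\<lambda>k. x i k \<otimes>\<^bsub>A\<^esub> \<xi> k) {k. \<xi> k \<noteq> \<zero>\<^bsub>A\<^esub>})"

definition mat_norm :: "'a star_alg \<Rightarrow> 'a inf_mat \<Rightarrow> real" where
  "mat_norm A x = (SUP \<xi> \<in> {\<xi> \<in> columns A. col_norm A \<xi> \<le> 1}. col_norm A (mat_vec A x \<xi>))"

definition M_inf :: "'a star_alg \<Rightarrow> 'a inf_mat star_alg" where
  "M_inf A =
     \<lparr>carrier = (\<Union>n. mat_carrier n A),
      monoid.mult = (\<lambda>x y i j. mat_vec A x (\<lambda>k. y k j) i),
      one = undefined,
      ring.zero = (\<lambda>i j. \<zero>\<^bsub>A\<^esub>),
      add = (\<lambda>x y i j. x i j \<oplus>\<^bsub>A\<^esub> y i j),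
      smult = (\<lambda>c x i j. c \<odot>\<^bsub>A\<^esub> x i j),
      star = (\<lambda>x i j. star A (x j i)),
      cnorm = mat_norm A\<rparr>"

definition M_n :: "nat \<Rightarrow> 'a star_alg \<Rightarrow> 'a inf_mat star_alg" where
  "M_n n A = (M_inf A)\<lparr>carrier := mat_carrier n A,
     one := (\<lambda>i j. if i = j \<and> i < n then \<one>\<^bsub>A\<^esub> else \<zero>\<^bsub>A\<^esub>)\<rparr>"

definition corner :: "'a star_alg \<Rightarrow> 'a \<Rightarrow> 'a inf_mat" where
  "corner A a = (\<lambda>i j. if i = 0 \<and> j = 0 then a else \<zero>\<^bsub>A\<^esub>)"

text \<open>The block matrix \<open>diag(a, b)\<close> for \<open>a \<in> M_n(A)\<close>.\<close>

definition block_diag :: "'a star_alg \<Rightarrow> nat \<Rightarrow> 'a inf_mat \<Rightarrow> 'a inf_mat \<Rightarrow> 'a inf_mat" where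
  "block_diag A n a b = (\<lambda>i j. if i < n \<and> j < n then a i j
     else if n \<le> i \<and> n \<le> j then b (i - n) (j - n) else \<zero>\<^bsub>A\<^esub>)"

definition stably_finite :: "'a star_alg \<Rightarrow> bool" where
  "stably_finite A \<longleftrightarrow> (\<forall>n\<ge>1. finite_projection (M_n n A) \<one>\<^bsub>M_n n A\<^esub>)"


section \<open>Cuntz comparison and divisibility\<close>

abbreviation M_inf_pos :: "'a star_alg \<Rightarrow> 'a inf_mat set" where
  "M_inf_pos A \<equiv> positive (M_inf A)"

definition cuntz_le :: "'a star_alg \<Rightarrow> 'a inf_mat \<Rightarrow> 'a inf_mat \<Rightarrow> bool" where
  "cuntz_le A a b \<longleftrightarrow> (\<exists>v :: nat \<Rightarrow> 'a inf_mat. (\<forall>n. v n \<in> carrier (M_inf A)) \<and>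
     (\<lambda>n. cnorm (M_inf A)
        ((v n \<otimes>\<^bsub>M_inf A\<^esub> b \<otimes>\<^bsub>M_inf A\<^esub> star (M_inf A) (v n)) \<ominus>\<^bsub>M_inf A\<^esub> a)) \<longlonglongrightarrow> 0)"

definition cuntz_equiv :: "'a star_alg \<Rightarrow> 'a inf_mat \<Rightarrow> 'a inf_mat \<Rightarrow> bool" where
  "cuntz_equiv A a b \<longleftrightarrow> cuntz_le A a b \<and> cuntz_le A b a"

definition cuntz_class :: "'a star_alg \<Rightarrow> 'a inf_mat \<Rightarrow> 'a inf_mat set" where
  "cuntz_class A a = {b \<in> M_inf_pos A. cuntz_equiv A b a}"

definition class_le :: "'a star_alg \<Rightarrow> 'a inf_mat set \<Rightarrow> 'a inf_mat set \<Rightarrow> bool" where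
  "class_le A U V \<longleftrightarrow> (\<exists>a\<in>U. \<exists>b\<in>V. cuntz_le A a b)"

text \<open>Neither the representatives nor the block size \<open>n\<close> matter for the class of the direct sum.\<close>

definition class_add :: "'a star_alg \<Rightarrow> 'a inf_mat set \<Rightarrow> 'a inf_mat set \<Rightarrow> 'a inf_mat set" where
  "class_add A U V =
     (\<Union>a\<in>U. \<Union>b\<in>V. \<Union>n\<in>{n. a \<in> mat_carrier n A}. cuntz_class A (block_diag A n a b))"

definition class_times :: "'a star_alg \<Rightarrow> nat \<Rightarrow> 'a inf_mat set \<Rightarrow> 'a inf_mat set" where
  "class_times A k U = ((\<lambda>V. class_add A V U) ^^ k) (cuntz_class A \<zero>\<^bsub>M_inf A\<^esub>)"

definition almost_divisible :: "nat \<Rightarrow> 'a star_alg \<Rightarrow> bool" where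
  "almost_divisible m A \<longleftrightarrow>
     (\<forall>a\<in>M_inf_pos A. \<forall>k::nat. \<forall>\<epsilon>::real. 1 \<le> k \<longrightarrow> 0 < \<epsilon> \<longrightarrow>
        (\<exists>b\<in>M_inf_pos A.
           class_le A (class_times A k (cuntz_class A b)) (cuntz_class A a) \<and>
           class_le A (cuntz_class A (cutdown (M_inf A) a \<epsilon>))
             (class_times A ((k + 1) * (m + 1)) (cuntz_class A b))))"

definition weakly_almost_divisible :: "nat \<Rightarrow> nat \<Rightarrow> 'a star_alg \<Rightarrow> bool" where
  "weakly_almost_divisible n m A \<longleftrightarrow>
     (\<forall>a\<in>M_inf_pos A. \<forall>k::nat. \<forall>\<epsilon>::real. 1 \<le> k \<longrightarrow> 0 < \<epsilon> \<longrightarrow>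
        (\<exists>b\<in>M_inf_pos A.
           class_le A (class_times A k (cuntz_class A b)) (class_times A n (cuntz_class A a)) \<and>
           class_le A (cuntz_class A (cutdown (M_inf A) a \<epsilon>))
             (class_times A ((k + 1) * (m + 1)) (cuntz_class A b))))"


section \<open>The class TAA\<close>

text \<open>
  A class of C*-algebras is given by a set \<open>\<Omega>\<close> of algebras over one type, and membership is up to
  *-isomorphism, so that algebras over any type can belong to it.
\<close>

definition in_class :: "'u star_alg set \<Rightarrow> 'a star_alg \<Rightarrow> bool" where
  "in_class \<Omega> A \<longleftrightarrow> (\<exists>C\<in>\<Omega>. star_isomorphic A C)"

definition approx_in :: "'a star_alg \<Rightarrow> real \<Rightarrow> 'a \<Rightarrow> 'a set \<Rightarrow> bool" where
  "approx_in A \<epsilon> x B \<longleftrightarrow> (\<exists>y\<in>B. cnorm A (x \<ominus>\<^bsub>A\<^esub> y) < \<epsilon>)"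

definition TAA :: "'u star_alg set \<Rightarrow> 'a star_alg set" where
  "TAA \<Omega> = {A. unital_cstar_algebra A \<and> simple_alg A \<and>
     (\<forall>\<epsilon>>0. \<forall>F. finite F \<longrightarrow> F \<subseteq> carrier A \<longrightarrow> (\<forall>a\<in>positive A. a \<noteq> \<zero>\<^bsub>A\<^esub> \<longrightarrow>
        (\<exists>p B q. projection A p \<and> cstar_subalgebra B A \<and> is_unit_of A B p \<and>
           in_class \<Omega> (unital_subalg A B p) \<and> projection A q \<and> q \<in> B \<and>
           (\<forall>x\<in>F. approx_in A \<epsilon> (q \<otimes>\<^bsub>A\<^esub> x) B \<and> approx_in A \<epsilon> (x \<otimes>\<^bsub>A\<^esub> q) B) \<and>
           cuntz_le A (corner A (\<one>\<^bsub>A\<^esub> \<ominus>\<^bsub>A\<^esub> q)) (corner A a) \<and>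
           cnorm A (q \<otimes>\<^bsub>A\<^esub> a \<otimes>\<^bsub>A\<^esub> q) \<ge> cnorm A a - \<epsilon>)))}"

end

theory Submission
  imports Defs
begin

text \<open>
  Write \<open>a = h\<^sup>2\<close> in \<open>M\<^sub>n(A)\<close> and let \<open>Q\<close>, \<open>R\<close> be the diagonal matrices with entries \<open>q\<close> and \<open>1 - q\<close>. As
  \<open>2(QaQ + RaR) - a = (Q - R)a(Q - R)\<close> is positive, \<open>(a - \<epsilon>)\<^sub>+\<close> is Cuntz below the direct sum of
  \<open>R\<close> and any positive \<open>c\<close> close to \<open>QaQ\<close>. If \<open>Qh\<close> is close to a matrix \<open>y\<close> over the divisible algebra
  \<open>B\<close>, divisibility of a cut-down of \<open>y y\<^sup>*\<close> gives such a \<open>c\<close> together with a \<open>b\<close> such that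
  \<open>k\<langle>b\<rangle> \<le> \<langle>a\<rangle>\<close> and \<open>\<langle>c\<rangle> \<le> (k + 1)(m + 1)\<langle>b\<rangle>\<close>. It remains to absorb the \<open>n\<close> copies of \<open>1 - q\<close>. A first
  application of the argument with \<open>kn\<close> in place of \<open>k\<close> yields a non-zero positive \<open>s\<close> in \<open>A\<close> with
  \<open>kn\<langle>s\<rangle> \<le> \<langle>a\<rangle>\<close>; a second one, for which \<open>1 - q\<close> is Cuntz below \<open>s\<close>, gives \<open>b\<close>, and
  \<open>\<langle>b\<rangle> + n\<langle>s\<rangle>\<close> is as required. The cost of \<open>n\<langle>s\<rangle>\<close> is the second copy of \<open>\<langle>a\<rangle>\<close>.

  The functional calculus needs that the norm of a self-adjoint \<open>a\<close> is a spectral value of \<open>a\<close> or of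
  \<open>-a\<close>. This is obtained without complex analysis, from the identity
  \<open>(1 + t\<^sup>2)\<^sup>2 = (2t)\<^sup>2 + (1 - t\<^sup>2)\<^sup>2\<close> and the product of the \<open>1 + t\<^bsup>2\<cdot>2^i\<^esup>\<close>.
\<close>

section \<open>C*-algebras without unit and completeness\<close>

text \<open>The remainder decides the shape of the argument. The class TAA compares
  \<open>1 - q\<close> with an element of \<open>A\<close>, whereas \<open>a\<close> is an n by n
  matrix, so \<open>n\<close> copies of \<open>1 - q\<close> are left over. They must lie below
  something whose \<open>k\<close>-fold multiple still fits under
  \<open>\<langle>a\<rangle>\<close>; this is why the first division is by \<open>kn\<close>. A
  division may return zero, under which nothing can be hidden. The norm condition (3), used for a
  non-zero diagonal entry of \<open>a\<close>, keeps \<open>QaQ\<close> away from zero, and with it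
  the divisor. On the other side the remainder costs nothing: the multiplier
  \<open>(k + 1)(m + 1)\<close> is at least one, and a single copy of
  \<open>n\<langle>s\<rangle>\<close> dominates it.

  The analytic obstacle is that Cuntz comparison lives in \<open>M_inf A\<close>, which is neither
  unital nor complete, while functional calculus wants both. Estimates are therefore made in the
  C*-algebras \<open>M_n n A\<close>, and their results are carried over to the union.\<close>

lemma complex_ring_simps [simp]:
  "carrier complex_ring = UNIV" "(\<otimes>\<^bsub>complex_ring\<^esub>) = (*)" "(\<oplus>\<^bsub>complex_ring\<^esub>) = (+)"
  "\<one>\<^bsub>complex_ring\<^esub> = 1" "\<zero>\<^bsub>complex_ring\<^esub> = 0"
  by (simp_all add: ring_of_type_algebra_def)

text \<open>These axioms hold both in a C*-algebra and in \<open>M_inf A\<close>, which has no unit and is not complete.\<close>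

locale pre_cstar =
  fixes A :: "'a star_alg" (structure)
  assumes add_monoid: "abelian_monoid A"
    and sm_closed [simp, intro]: "x \<in> carrier A \<Longrightarrow> c \<odot> x \<in> carrier A"
    and sm_add_left: "x \<in> carrier A \<Longrightarrow> (c + d) \<odot> x = c \<odot> x \<oplus> d \<odot> x"
    and sm_add_right: "x \<in> carrier A \<Longrightarrow> y \<in> carrier A \<Longrightarrow> c \<odot> (x \<oplus> y) = c \<odot> x \<oplus> c \<odot> y"
    and sm_sm [simp]: "x \<in> carrier A \<Longrightarrow> c \<odot> (d \<odot> x) = (c * d) \<odot> x"
    and sm_one [simp]: "x \<in> carrier A \<Longrightarrow> 1 \<odot> x = x"
    and diff_sm: "x \<in> carrier A \<Longrightarrow> y \<in> carrier A \<Longrightarrow> x \<ominus> y = x \<oplus> (-1) \<odot> y"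
    and m_closed [simp, intro]: "x \<in> carrier A \<Longrightarrow> y \<in> carrier A \<Longrightarrow> x \<otimes> y \<in> carrier A"
    and m_assoc: "x \<in> carrier A \<Longrightarrow> y \<in> carrier A \<Longrightarrow> z \<in> carrier A \<Longrightarrow>
          (x \<otimes> y) \<otimes> z = x \<otimes> (y \<otimes> z)"
    and l_distr: "x \<in> carrier A \<Longrightarrow> y \<in> carrier A \<Longrightarrow> z \<in> carrier A \<Longrightarrow>
          (x \<oplus> y) \<otimes> z = x \<otimes> z \<oplus> y \<otimes> z"
    and r_distr: "x \<in> carrier A \<Longrightarrow> y \<in> carrier A \<Longrightarrow> z \<in> carrier A \<Longrightarrow>
          z \<otimes> (x \<oplus> y) = z \<otimes> x \<oplus> z \<otimes> y"
    and sm_mult_left [simp]: "x \<in> carrier A \<Longrightarrow> y \<in> carrier A \<Longrightarrow> (c \<odot> x) \<otimes> y = c \<odot> (x \<otimes> y)"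
    and sm_mult_right [simp]: "x \<in> carrier A \<Longrightarrow> y \<in> carrier A \<Longrightarrow> x \<otimes> (c \<odot> y) = c \<odot> (x \<otimes> y)"
    and star_closed [simp, intro]: "x \<in> carrier A \<Longrightarrow> star A x \<in> carrier A"
    and star_star [simp]: "x \<in> carrier A \<Longrightarrow> star A (star A x) = x"
    and star_add [simp]: "x \<in> carrier A \<Longrightarrow> y \<in> carrier A \<Longrightarrow> star A (x \<oplus> y) = star A x \<oplus> star A y"
    and star_sm [simp]: "x \<in> carrier A \<Longrightarrow> star A (c \<odot> x) = cnj c \<odot> star A x"
    and star_mult [simp]: "x \<in> carrier A \<Longrightarrow> y \<in> carrier A \<Longrightarrow> star A (x \<otimes> y) = star A y \<otimes> star A x"
    and norm_ge_0 [simp]: "x \<in> carrier A \<Longrightarrow> 0 \<le> cnorm A x"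
    and norm_eq_0: "x \<in> carrier A \<Longrightarrow> cnorm A x = 0 \<longleftrightarrow> x = \<zero>"
    and norm_add: "x \<in> carrier A \<Longrightarrow> y \<in> carrier A \<Longrightarrow> cnorm A (x \<oplus> y) \<le> cnorm A x + cnorm A y"
    and norm_sm: "x \<in> carrier A \<Longrightarrow> cnorm A (c \<odot> x) = cmod c * cnorm A x"
    and norm_mult: "x \<in> carrier A \<Longrightarrow> y \<in> carrier A \<Longrightarrow> cnorm A (x \<otimes> y) \<le> cnorm A x * cnorm A y"
    and cstar_id: "x \<in> carrier A \<Longrightarrow> cnorm A (star A x \<otimes> x) = (cnorm A x)\<^sup>2"
begin

section \<open>Linear and norm identities from the axioms\<close>

lemma zero_closed [simp, intro]: "\<zero> \<in> carrier A"
  and a_closed [simp, intro]: "x \<in> carrier A \<Longrightarrow> y \<in> carrier A \<Longrightarrow> x \<oplus> y \<in> carrier A"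
  and l_zero [simp]: "x \<in> carrier A \<Longrightarrow> \<zero> \<oplus> x = x"
  and r_zero [simp]: "x \<in> carrier A \<Longrightarrow> x \<oplus> \<zero> = x"
  and a_assoc: "x \<in> carrier A \<Longrightarrow> y \<in> carrier A \<Longrightarrow> z \<in> carrier A \<Longrightarrow> x \<oplus> y \<oplus> z = x \<oplus> (y \<oplus> z)"
  and a_comm: "x \<in> carrier A \<Longrightarrow> y \<in> carrier A \<Longrightarrow> x \<oplus> y = y \<oplus> x"
  and a_lcomm: "x \<in> carrier A \<Longrightarrow> y \<in> carrier A \<Longrightarrow> z \<in> carrier A \<Longrightarrow> x \<oplus> (y \<oplus> z) = y \<oplus> (x \<oplus> z)"
  using add_monoid
  by (simp_all add: abelian_monoid.a_closed abelian_monoid.zero_closed abelian_monoid.l_zero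
      abelian_monoid.r_zero abelian_monoid.a_assoc abelian_monoid.a_comm abelian_monoid.a_lcomm)

lemmas a_ac = a_assoc a_comm a_lcomm

lemma norm_zero [simp]: "cnorm A \<zero> = 0"
  using norm_eq_0[of \<zero>] by simp

text \<open>The additive structure is only assumed to be a monoid, so nothing can be cancelled yet;
  vanishing is read off from the norm.\<close>

lemma sm_0 [simp]: "x \<in> carrier A \<Longrightarrow> 0 \<odot> x = \<zero>"
  using norm_sm[of x 0] norm_eq_0[of "0 \<odot> x"] by simp

lemma sm_zero [simp]: "c \<odot> \<zero> = \<zero>"
  using norm_sm[of \<zero> c] norm_eq_0[of "c \<odot> \<zero>"] by simp

lemma add_neg [simp]: "x \<in> carrier A \<Longrightarrow> x \<oplus> (-1) \<odot> x = \<zero>"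
  and neg_add [simp]: "x \<in> carrier A \<Longrightarrow> (-1) \<odot> x \<oplus> x = \<zero>"
  using sm_add_left[of x 1 "-1"] sm_add_left[of x "-1" 1] by simp_all

lemma add_neg2 [simp]: "x \<in> carrier A \<Longrightarrow> y \<in> carrier A \<Longrightarrow> x \<oplus> ((-1) \<odot> x \<oplus> y) = y"
  and neg_add2 [simp]: "x \<in> carrier A \<Longrightarrow> y \<in> carrier A \<Longrightarrow> (-1) \<odot> x \<oplus> (x \<oplus> y) = y"
  by (simp_all flip: a_assoc)

text \<open>Sorting a sum by \<open>a_ac\<close> can leave other summands between an element and its
  negative. These rules let the simplifier cancel across one or two of them.\<close>

lemma add_cancels:
  assumes "x \<in> carrier A" "y \<in> carrier A" "z \<in> carrier A"
  shows "x \<oplus> (y \<oplus> (-1) \<odot> x) = y" "x \<oplus> (y \<oplus> ((-1) \<odot> x \<oplus> z)) = y \<oplus> z"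
    "x \<oplus> (y \<oplus> (z \<oplus> (-1) \<odot> x)) = y \<oplus> z"
    "(-1) \<odot> x \<oplus> (y \<oplus> x) = y" "(-1) \<odot> x \<oplus> (y \<oplus> (x \<oplus> z)) = y \<oplus> z"
    "(-1) \<odot> x \<oplus> (y \<oplus> (z \<oplus> x)) = y \<oplus> z"
  using assms by (metis a_assoc a_comm a_closed add_neg2 neg_add2 sm_closed)+

lemma diff_closed [simp, intro]: "x \<in> carrier A \<Longrightarrow> y \<in> carrier A \<Longrightarrow> x \<ominus> y \<in> carrier A"
  by (simp add: diff_sm)

lemma diff_self [simp]: "x \<in> carrier A \<Longrightarrow> x \<ominus> x = \<zero>"
  by (simp add: diff_sm)

lemma add_cancel: "x \<in> carrier A \<Longrightarrow> y \<in> carrier A \<Longrightarrow> z \<in> carrier A \<Longrightarrow> x \<oplus> y = x \<oplus> z \<longleftrightarrow> y = z"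
  by (metis neg_add2)

lemma diff_eq_0: "x \<in> carrier A \<Longrightarrow> y \<in> carrier A \<Longrightarrow> x \<ominus> y = \<zero> \<longleftrightarrow> x = y"
  by (metis diff_sm diff_self a_comm add_cancel sm_closed)

lemma diff_add_cancel: "x \<in> carrier A \<Longrightarrow> y \<in> carrier A \<Longrightarrow> (x \<ominus> y) \<oplus> y = x"
  by (simp add: diff_sm a_assoc)

lemma add_diff_cancel: "x \<in> carrier A \<Longrightarrow> y \<in> carrier A \<Longrightarrow> (x \<oplus> y) \<ominus> y = x"
  by (simp add: diff_sm a_assoc)

lemma sm_diff_right: "x \<in> carrier A \<Longrightarrow> y \<in> carrier A \<Longrightarrow> c \<odot> (x \<ominus> y) = c \<odot> x \<ominus> c \<odot> y"
  by (simp add: diff_sm sm_add_right)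

lemma l_null [simp]: "x \<in> carrier A \<Longrightarrow> \<zero> \<otimes> x = \<zero>"
  and r_null [simp]: "x \<in> carrier A \<Longrightarrow> x \<otimes> \<zero> = \<zero>"
  using sm_mult_left[of \<zero> x 0] sm_mult_right[of x \<zero> 0] by simp_all

lemma l_diff: "x \<in> carrier A \<Longrightarrow> y \<in> carrier A \<Longrightarrow> z \<in> carrier A \<Longrightarrow> (x \<ominus> y) \<otimes> z = x \<otimes> z \<ominus> y \<otimes> z"
  and r_diff: "x \<in> carrier A \<Longrightarrow> y \<in> carrier A \<Longrightarrow> z \<in> carrier A \<Longrightarrow> z \<otimes> (x \<ominus> y) = z \<otimes> x \<ominus> z \<otimes> y"
  by (simp_all add: diff_sm l_distr r_distr)

lemma star_diff [simp]: "x \<in> carrier A \<Longrightarrow> y \<in> carrier A \<Longrightarrow> star A (x \<ominus> y) = star A x \<ominus> star A y"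
  by (simp add: diff_sm)

lemma star_zero [simp]: "star A \<zero> = \<zero>"
  using star_sm[of \<zero> 0] by simp

lemma norm_diff_commute: "x \<in> carrier A \<Longrightarrow> y \<in> carrier A \<Longrightarrow> cnorm A (x \<ominus> y) = cnorm A (y \<ominus> x)"
  using norm_sm[of "x \<ominus> y" "-1"] by (simp add: diff_sm sm_add_right a_comm)

lemma norm_diff_triangle:
  assumes "x \<in> carrier A" "y \<in> carrier A" "z \<in> carrier A"
  shows "cnorm A (x \<ominus> z) \<le> cnorm A (x \<ominus> y) + cnorm A (y \<ominus> z)"
proof -
  have "x \<ominus> z = (x \<ominus> y) \<oplus> (y \<ominus> z)" using assms by (simp add: diff_sm a_assoc)
  then show ?thesis using assms norm_add[of "x \<ominus> y" "y \<ominus> z"] by simp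
qed

lemma norm_diff_le: "x \<in> carrier A \<Longrightarrow> y \<in> carrier A \<Longrightarrow> cnorm A (x \<ominus> y) \<le> cnorm A x + cnorm A y"
  using norm_add[of x "(-1) \<odot> y"] by (simp add: diff_sm norm_sm)

lemma norm_le_diff: "x \<in> carrier A \<Longrightarrow> y \<in> carrier A \<Longrightarrow> cnorm A x \<le> cnorm A y + cnorm A (x \<ominus> y)"
  using norm_add[of y "x \<ominus> y"] by (simp add: diff_sm a_ac)

text \<open>The C*-identity and submultiplicativity bound the square of
  \<open>\<parallel>y\<parallel>\<close> by the product of
  \<open>\<parallel>y\<^sup>*\<parallel>\<close> and \<open>\<parallel>y\<parallel>\<close>; the
  reverse inequality is the same one for the adjoint.\<close>

lemma norm_star [simp]:
  assumes x: "x \<in> carrier A" shows "cnorm A (star A x) = cnorm A x"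
proof -
  have *: "cnorm A y \<le> cnorm A (star A y)" if y: "y \<in> carrier A" for y
  proof (cases "cnorm A y = 0")
    case False
    have "cnorm A y * cnorm A y \<le> cnorm A (star A y) * cnorm A y"
      using cstar_id[OF y] norm_mult[of "star A y" y] y by (simp add: power2_eq_square)
    then show ?thesis using False norm_ge_0[OF y] by (simp add: mult_le_cancel_right)
  qed (use y in simp)
  show ?thesis using *[OF x] *[of "star A x"] x by simp
qed

lemma norm_mult_diff:
  assumes "x \<in> carrier A" "x' \<in> carrier A" "y \<in> carrier A" "y' \<in> carrier A"
  shows "cnorm A (x \<otimes> y \<ominus> x' \<otimes> y') \<le> cnorm A (x \<ominus> x') * cnorm A y + cnorm A x' * cnorm A (y \<ominus> y')"
proof -
  have "x \<otimes> y \<ominus> x' \<otimes> y' = (x \<ominus> x') \<otimes> y \<oplus> x' \<otimes> (y \<ominus> y')"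
    using assms by (simp add: diff_sm l_distr r_distr a_assoc)
  then show ?thesis
    using assms norm_add[of "(x \<ominus> x') \<otimes> y" "x' \<otimes> (y \<ominus> y')"] norm_mult[of "x \<ominus> x'" y]
      norm_mult[of x' "y \<ominus> y'"] by simp
qed

definition selfadj :: "'a set" where "selfadj = {x \<in> carrier A. star A x = x}"

lemma selfadjD [dest]: "x \<in> selfadj \<Longrightarrow> x \<in> carrier A" "x \<in> selfadj \<Longrightarrow> star A x = x"
  by (auto simp: selfadj_def)

lemma norm_sq: "x \<in> selfadj \<Longrightarrow> cnorm A (x \<otimes> x) = (cnorm A x)\<^sup>2"
  using cstar_id[of x] by (auto simp: selfadj_def)

end

text \<open>Completeness is stated for norm Cauchy sequences, the form in which matrix algebras
  inherit it entry by entry.\<close>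

locale unital_cstar = pre_cstar +
  assumes one_closed [simp, intro]: "\<one> \<in> carrier A"
    and l_one [simp]: "x \<in> carrier A \<Longrightarrow> \<one> \<otimes> x = x"
    and r_one [simp]: "x \<in> carrier A \<Longrightarrow> x \<otimes> \<one> = x"
    and complete_seq: "(\<And>n. s n \<in> carrier A) \<Longrightarrow>
      (\<And>e. 0 < e \<Longrightarrow> \<exists>N. \<forall>m\<ge>N. \<forall>n\<ge>N. cnorm A (s m \<ominus> s n) < e) \<Longrightarrow>
      \<exists>l\<in>carrier A. (\<lambda>n. cnorm A (s n \<ominus> l)) \<longlonglongrightarrow> 0"
begin

lemma star_one [simp]: "star A \<one> = \<one>"
  by (metis l_one one_closed r_one star_closed star_mult star_star)

lemma norm_one_le: "cnorm A \<one> \<le> 1"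
proof -
  have "cnorm A \<one> = (cnorm A \<one>)\<^sup>2" using cstar_id[of \<one>] by simp
  then have "cnorm A \<one> = 0 \<or> cnorm A \<one> = 1" by (simp add: power2_eq_square)
  then show ?thesis by auto
qed

end

context unital_cstar_algebra
begin

lemma cnorm_diff:
  "x \<in> carrier A \<Longrightarrow> y \<in> carrier A \<Longrightarrow> x \<ominus> y = x \<oplus> (-1) \<odot> y"
proof -
  assume x: "x \<in> carrier A" and y: "y \<in> carrier A"
  have "\<ominus> y = (-1) \<odot> y"
    using smult_l_distr[of "-1" 1 y] smult_l_null[of y] smult_one[of y] smult_closed[of "-1" y] y
    by (simp add: M.minus_equality)
  then show ?thesis by (simp add: a_minus_def)
qed

lemma is_unital_cstar: "unital_cstar A"
proof -
  interpret pre_cstar A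
  proof
    fix c d x assume x: "x \<in> carrier A"
    show "(c + d) \<odot> x = c \<odot> x \<oplus> d \<odot> x" using smult_l_distr[of c d x] x by simp
    show "c \<odot> (d \<odot> x) = (c * d) \<odot> x" using smult_assoc1[of c d x] x by simp
    show "1 \<odot> x = x" using smult_one[of x] x by simp
    show "c \<odot> x \<in> carrier A" using smult_closed[of c x] x by simp
  next
    fix c x y assume "x \<in> carrier A" "y \<in> carrier A"
    then show "c \<odot> (x \<oplus> y) = c \<odot> x \<oplus> c \<odot> y" using smult_r_distr[of c x y] by simp
  next
    fix x y assume "x \<in> carrier A" "y \<in> carrier A"
    then show "x \<ominus> y = x \<oplus> (-1) \<odot> y" by (rule cnorm_diff)
  qed (simp_all add: mult_closed mult_assoc mult_distrib_right mult_distrib_left smult_mult_left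
      smult_mult_right star_closed star_star star_add star_smult star_mult cnorm_nonneg
      cnorm_eq_0_iff cnorm_triangle cnorm_smult cnorm_mult cstar_identity)
  interpret Metric_space "carrier A" "cdist A"
  proof
    fix x y assume "x \<in> carrier A" "y \<in> carrier A"
    then show "cdist A x y = 0 \<longleftrightarrow> x = y"
      by (simp add: cdist_def norm_eq_0 diff_eq_0)
  qed (auto simp: cdist_def norm_diff_commute norm_diff_triangle)
  show ?thesis
  proof
    fix s :: "nat \<Rightarrow> 'a"
    assume s: "\<And>n. s n \<in> carrier A"
      and c: "\<And>e. 0 < e \<Longrightarrow> \<exists>N. \<forall>m\<ge>N. \<forall>n\<ge>N. cnorm A (s m \<ominus> s n) < e"
    have "MCauchy s"
      using s c by (fastforce simp: MCauchy_def cdist_def)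
    then obtain l where "limitin mtopology s l sequentially"
      using complete by (auto simp: mcomplete_def)
    then have l: "l \<in> carrier A" "\<And>e. 0 < e \<Longrightarrow> \<exists>N. \<forall>n\<ge>N. s n \<in> carrier A \<and> cdist A (s n) l < e"
      by (auto simp: limit_metric_sequentially)
    have "(\<lambda>n. cnorm A (s n \<ominus> l)) \<longlonglongrightarrow> 0"
      using l s by (fastforce simp: cdist_def LIMSEQ_iff)
    with l show "\<exists>l\<in>carrier A. (\<lambda>n. cnorm A (s n \<ominus> l)) \<longlonglongrightarrow> 0" by blast
  qed simp_all
qed

end

section \<open>The spectrum of self-adjoint elements\<close>

text \<open>Self-adjoint values require real coefficients, splitting into linear factors requires
  complex ones; hence the passage between both kinds of polynomials.\<close>

abbreviation cpoly :: "real poly \<Rightarrow> complex poly" where "cpoly \<equiv> map_poly complex_of_real"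

lemma cpoly_hom:
  "cpoly (p + q) = cpoly p + cpoly q" "cpoly (p - q) = cpoly p - cpoly q"
  "cpoly (p * q) = cpoly p * cpoly q" "cpoly (Polynomial.smult c p) = Polynomial.smult (of_real c) (cpoly p)"
  by (simp_all add: poly_eq_iff coeff_map_poly coeff_mult)

lemma poly_cpoly: "poly (cpoly p) (of_real t) = of_real (poly p t)"
  by (induction p) (simp_all add: map_poly_pCons)

section \<open>Polynomials of one element and invertibility\<close>

context unital_cstar
begin

text \<open>Horner's scheme, which fits induction over \<open>pCons\<close>. Unlike in
  \<open>poly_eval\<close>, constant terms are allowed, as there is a unit.\<close>

definition ev :: "'a \<Rightarrow> complex poly \<Rightarrow> 'a" where
  "ev a p = fold_coeffs (\<lambda>c y. c \<odot> \<one> \<oplus> a \<otimes> y) p \<zero>"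

lemma ev_0 [simp]: "ev a 0 = \<zero>"
  by (simp add: ev_def)

lemma ev_pCons [simp]: "a \<in> carrier A \<Longrightarrow> ev a (pCons c p) = c \<odot> \<one> \<oplus> a \<otimes> ev a p"
  by (cases "c = 0 \<and> p = 0") (auto simp: ev_def)

lemma ev_closed [simp, intro]: "a \<in> carrier A \<Longrightarrow> ev a p \<in> carrier A"
  by (induction p) auto

lemma ev_1 [simp]: "a \<in> carrier A \<Longrightarrow> ev a 1 = \<one>"
  by (simp add: one_pCons)

lemma ev_add: "a \<in> carrier A \<Longrightarrow> ev a (p + q) = ev a p \<oplus> ev a q"
  by (induction p q rule: poly_induct2) (auto simp: sm_add_left r_distr a_ac)

lemma ev_smult: "a \<in> carrier A \<Longrightarrow> ev a (Polynomial.smult c p) = c \<odot> ev a p"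
  by (induction p) (auto simp: sm_add_right)

lemma ev_diff: "a \<in> carrier A \<Longrightarrow> ev a (p - q) = ev a p \<ominus> ev a q"
  using ev_add[of a p "- q"] ev_smult[of a "-1" q] by (simp add: diff_sm)

lemma ev_mult: "a \<in> carrier A \<Longrightarrow> ev a (p * q) = ev a p \<otimes> ev a q"
  by (induction p) (auto simp: ev_add ev_smult l_distr m_assoc)

lemma ev_commute: "a \<in> carrier A \<Longrightarrow> ev a p \<otimes> ev a q = ev a q \<otimes> ev a p"
  by (metis ev_mult mult.commute)

lemma ev_commute_gen: "a \<in> carrier A \<Longrightarrow> a \<otimes> ev a q = ev a q \<otimes> a"
  using ev_commute[of a "[:0,1:]" q] by simp

lemma ev_star: "a \<in> selfadj \<Longrightarrow> ev a (cpoly p) \<in> selfadj"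
proof (induction p)
  case (pCons c p)
  then have a: "a \<in> carrier A" and s: "star A a = a" by auto
  have "a \<otimes> ev a (cpoly p) = ev a (cpoly p) \<otimes> a" by (rule ev_commute_gen[OF a])
  then show ?case using a s pCons by (auto simp: selfadj_def map_poly_pCons)
qed (auto simp: selfadj_def)

definition unit :: "'a \<Rightarrow> bool" where
  "unit x \<longleftrightarrow> x \<in> carrier A \<and> (\<exists>y\<in>carrier A. x \<otimes> y = \<one> \<and> y \<otimes> x = \<one>)"

lemma unit_mult: "unit x \<Longrightarrow> unit y \<Longrightarrow> unit (x \<otimes> y)"
proof -
  assume "unit x" "unit y"
  then obtain x' y' where c: "x \<in> carrier A" "y \<in> carrier A" "x' \<in> carrier A" "y' \<in> carrier A"
    and i: "x \<otimes> x' = \<one>" "x' \<otimes> x = \<one>" "y \<otimes> y' = \<one>" "y' \<otimes> y = \<one>"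
    by (auto simp: unit_def)
  have "(x \<otimes> y) \<otimes> (y' \<otimes> x') = x \<otimes> ((y \<otimes> y') \<otimes> x')"
    and "(y' \<otimes> x') \<otimes> (x \<otimes> y) = y' \<otimes> ((x' \<otimes> x) \<otimes> y)" using c by (simp_all add: m_assoc)
  then have "(x \<otimes> y) \<otimes> (y' \<otimes> x') = \<one>" "(y' \<otimes> x') \<otimes> (x \<otimes> y) = \<one>" using c i by simp_all
  with c show ?thesis unfolding unit_def by (intro conjI bexI[of _ "y' \<otimes> x'"]) auto
qed

lemma unit_sm: "c \<noteq> 0 \<Longrightarrow> unit x \<Longrightarrow> unit (c \<odot> x)"
proof -
  assume c: "c \<noteq> 0" and "unit x"
  then obtain y where y: "x \<in> carrier A" "y \<in> carrier A" "x \<otimes> y = \<one>" "y \<otimes> x = \<one>" by (auto simp: unit_def)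
  then show ?thesis using c unfolding unit_def by (intro conjI bexI[of _ "inverse c \<odot> y"]) auto
qed

lemma unit_sm_iff: "c \<noteq> 0 \<Longrightarrow> x \<in> carrier A \<Longrightarrow> unit (c \<odot> x) \<longleftrightarrow> unit x"
  using unit_sm[of c x] unit_sm[of "inverse c" "c \<odot> x"] by auto

lemma unit_one: "unit \<one>"
  by (auto simp: unit_def)

lemma norm_ev_monom:
  assumes a: "a \<in> carrier A" shows "cnorm A (ev a (Polynomial.monom 1 n)) \<le> cnorm A a ^ n"
proof (induction n)
  case (Suc n)
  have "cnorm A (ev a (Polynomial.monom 1 (Suc n))) \<le> cnorm A a * cnorm A (ev a (Polynomial.monom 1 n))"
    using a by (simp add: Polynomial.monom_Suc norm_mult)
  also have "\<dots> \<le> cnorm A a ^ Suc n"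
    using Suc a by (simp add: mult_left_mono)
  finally show ?case .
qed (use a norm_one_le in simp)

text \<open>The geometric series converges by completeness, and its limit is the inverse.\<close>

lemma neumann:
  assumes x: "x \<in> carrier A" and 1: "cnorm A x < 1" shows "unit (\<one> \<ominus> x)"
proof -
  \<comment> \<open>The partial sums are taken as values of polynomials, so that they commute with
    \<open>x\<close> and telescoping is an identity of polynomials.\<close>
  define P where "P n = (\<Sum>i<n. Polynomial.monom (1::complex) i)" for n
  define s where "s n = ev x (P n)" for n
  have sc: "s n \<in> carrier A" for n using x by (simp add: s_def)
  have P: "P (Suc n) = P n + Polynomial.monom 1 n" for n by (simp add: P_def)
  let ?r = "cnorm A x"
  have r0: "0 \<le> ?r" using x by simp
  have d: "cnorm A (s (n + k) \<ominus> s n) \<le> (\<Sum>i<k. ?r ^ (n + i))" for n k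
  proof (induction k)
    case (Suc k)
    have "cnorm A (s (n + Suc k) \<ominus> s n) \<le> cnorm A (s (n + Suc k) \<ominus> s (n + k)) + cnorm A (s (n+k) \<ominus> s n)"
      using sc by (intro norm_diff_triangle)
    moreover have "s (n + Suc k) \<ominus> s (n+k) = ev x (Polynomial.monom 1 (n+k))"
      using x by (simp add: s_def P flip: ev_diff)
    ultimately show ?case using Suc norm_ev_monom[OF x, of "n+k"] by simp
  qed (use sc in simp)
  have geo: "(\<Sum>i<k. ?r ^ (n + i)) \<le> ?r ^ n / (1 - ?r)" for n k
  proof -
    have "(\<Sum>i<k. ?r ^ (n + i)) = ?r ^ n * (\<Sum>i<k. ?r ^ i)" by (simp add: power_add sum_distrib_left)
    also have "(\<Sum>i<k. ?r ^ i) = (1 - ?r ^ k) / (1 - ?r)" using 1 by (simp add: sum_gp_strict)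
    also have "\<dots> \<le> 1 / (1 - ?r)" using 1 r0 by (simp add: divide_right_mono)
    finally show ?thesis using r0 by (simp add: mult_left_mono)
  qed
  have lim0: "(\<lambda>n. ?r ^ n / (1 - ?r)) \<longlonglongrightarrow> 0"
    using LIMSEQ_power_zero[of ?r] 1 r0 by (intro tendsto_divide_zero) simp
  have "\<exists>N. \<forall>m\<ge>N. \<forall>n\<ge>N. cnorm A (s m \<ominus> s n) < e" if e: "0 < e" for e
  proof -
    obtain N where N: "\<And>n. n \<ge> N \<Longrightarrow> \<bar>?r ^ n / (1 - ?r)\<bar> < e"
      using lim0 e by (auto simp: LIMSEQ_iff)
    have N: "?r ^ n / (1 - ?r) < e" if "n \<ge> N" for n using N[OF that] by linarith
    have *: "cnorm A (s m \<ominus> s n) < e" if "n \<ge> N" "m \<ge> n" for m n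
      using d[of n "m - n"] geo[of n "m - n"] N[of n] that by simp
    have "cnorm A (s m \<ominus> s n) < e" if "n \<ge> N" "m \<ge> N" for m n
      using *[of n m] *[of m n] that norm_diff_commute[OF sc[of n] sc[of m]] by (cases "m \<ge> n") auto
    then show ?thesis by blast
  qed
  then obtain l where l: "l \<in> carrier A" "(\<lambda>n. cnorm A (s n \<ominus> l)) \<longlonglongrightarrow> 0"
    using complete_seq[of s] sc by blast
  let ?u = "\<one> \<ominus> x"
  have u: "?u = ev x [:1,-1:]" using x by (simp add: diff_sm a_ac)
  have tel: "[:1,-1:] * P n = 1 - Polynomial.monom 1 n" for n
    by (induction n) (simp_all add: P_def algebra_simps Polynomial.monom_Suc)
  have us: "?u \<otimes> s n = \<one> \<ominus> ev x (Polynomial.monom 1 n)" for n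
  proof -
    have "?u \<otimes> s n = ev x ([:1,-1:] * P n)" unfolding u s_def ev_mult[OF x] ..
    then show ?thesis unfolding tel using x by (simp add: ev_diff)
  qed
  have su: "s n \<otimes> ?u = ?u \<otimes> s n" for n
    unfolding u s_def using x by (rule ev_commute)
  \<comment> \<open>The elements \<open>?u \<otimes> s n\<close> tend to the unit. Both products of
    \<open>?u\<close> with the limit \<open>l\<close> are approximated by them, so one estimate
    settles the left and the right inverse.\<close>
  have eq: "z = \<one>" if z: "z \<in> carrier A" and b: "\<And>n. cnorm A (z \<ominus> ?u \<otimes> s n) \<le> cnorm A ?u * cnorm A (s n \<ominus> l)" for z
  proof -
    have "cnorm A (z \<ominus> \<one>) \<le> cnorm A ?u * cnorm A (s n \<ominus> l) + ?r ^ n" for n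
    proof -
      have "cnorm A (?u \<otimes> s n \<ominus> \<one>) \<le> ?r ^ n"
        using norm_ev_monom[OF x, of n] x norm_diff_commute[of "ev x (Polynomial.monom 1 n)" \<zero>]
        by (simp add: us) (simp add: diff_sm a_ac add_cancels norm_sm)
      then show ?thesis using b[of n] norm_diff_triangle[of z "?u \<otimes> s n" \<one>] z x sc[of n] by simp
    qed
    moreover have "(\<lambda>n. cnorm A ?u * cnorm A (s n \<ominus> l) + ?r ^ n) \<longlonglongrightarrow> cnorm A ?u * 0 + 0"
      using l 1 r0 by (intro tendsto_intros LIMSEQ_power_zero) auto
    ultimately have "cnorm A (z \<ominus> \<one>) \<le> 0"
      by (intro LIMSEQ_le_const[of "\<lambda>n. cnorm A ?u * cnorm A (s n \<ominus> l) + ?r ^ n"]) auto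
    then show ?thesis using z norm_eq_0[of "z \<ominus> \<one>"] norm_ge_0[of "z \<ominus> \<one>"] diff_eq_0[of z \<one>]
      by (metis diff_closed one_closed order_antisym)
  qed
  have "?u \<otimes> l = \<one>"
  proof (rule eq)
    show "cnorm A (?u \<otimes> l \<ominus> ?u \<otimes> s n) \<le> cnorm A ?u * cnorm A (s n \<ominus> l)" for n
      using x l sc[of n] norm_diff_commute[of l "s n"] norm_mult[of ?u "l \<ominus> s n"] by (simp add: r_diff)
  qed (use x l in simp)
  moreover have "l \<otimes> ?u = \<one>"
  proof (rule eq)
    show "cnorm A (l \<otimes> ?u \<ominus> ?u \<otimes> s n) \<le> cnorm A ?u * cnorm A (s n \<ominus> l)" for n
      using x l sc[of n] norm_diff_commute[of l "s n"] norm_mult[of "l \<ominus> s n" ?u]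
      unfolding su[symmetric] by (simp add: l_diff mult.commute)
  qed (use x l in simp)
  ultimately show ?thesis using x l by (auto simp: unit_def)
qed

lemma unit_large:
  assumes x: "x \<in> carrier A" and z: "cnorm A x < cmod z" shows "unit (z \<odot> \<one> \<ominus> x)"
proof -
  have z0: "z \<noteq> 0" using z norm_ge_0[OF x] by auto
  have "unit (\<one> \<ominus> inverse z \<odot> x)"
  proof (rule neumann)
    have "cnorm A (inverse z \<odot> x) = cnorm A x / cmod z"
      using x by (simp add: norm_sm norm_inverse divide_inverse mult.commute)
    then show "cnorm A (inverse z \<odot> x) < 1" using z z0 by (simp add: divide_less_eq)
  qed (use x in simp)
  then have "unit (z \<odot> (\<one> \<ominus> inverse z \<odot> x))" using z0 by (rule unit_sm[rotated])
  then show ?thesis using x z0 by (simp add: sm_diff_right)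
qed

text \<open>For \<open>z = x + \<i>y\<close> commutation gives
  \<open>z\<^sup>* z = x\<^sup>2 + y\<^sup>2\<close>, and \<open>2x = z + z\<^sup>*\<close> gives
  \<open>\<parallel>x\<parallel> \<le> \<parallel>z\<parallel>\<close>. This takes the place of
  monotonicity of the norm as long as no order is available.\<close>

lemma comm_sq:
  assumes x: "x \<in> selfadj" and y: "y \<in> selfadj" and c: "x \<otimes> y = y \<otimes> x"
  shows "(cnorm A x)\<^sup>2 \<le> cnorm A (x \<otimes> x \<oplus> y \<otimes> y)"
proof -
  have xy: "x \<in> carrier A" "y \<in> carrier A" "star A x = x" "star A y = y" using x y by auto
  define z where "z = x \<oplus> \<i> \<odot> y"
  have z: "z \<in> carrier A" using xy by (simp add: z_def)
  have sz: "star A z = x \<oplus> (-\<i>) \<odot> y" using xy by (simp add: z_def)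
  have 2: "2 \<odot> x = x \<oplus> x" using sm_add_left[of x 1 1] xy by simp
  have "\<i> \<odot> y \<oplus> (-\<i>) \<odot> y = \<zero>" using xy sm_add_left[of y "\<i>" "-\<i>"] by simp
  then have "z \<oplus> star A z = 2 \<odot> x"
    unfolding sz z_def 2 using xy by (simp add: a_ac)
  then have "2 * cnorm A x \<le> cnorm A z + cnorm A (star A z)"
    using norm_add[of z "star A z"] z xy by (simp add: norm_sm)
  then have "cnorm A x \<le> cnorm A z" using z by simp
  moreover have "star A z \<otimes> z = x \<otimes> x \<oplus> y \<otimes> y"
  proof -
    have "\<i> \<odot> (y \<otimes> x) \<oplus> (-\<i>) \<odot> (y \<otimes> x) = \<zero>" "(-\<i>) \<odot> (y \<otimes> x) \<oplus> \<i> \<odot> (y \<otimes> x) = \<zero>"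
      using xy sm_add_left[of "y \<otimes> x" "\<i>" "-\<i>"] sm_add_left[of "y \<otimes> x" "-\<i>" "\<i>"] by simp_all
    then have "\<i> \<odot> (y \<otimes> x) \<oplus> ((-\<i>) \<odot> (y \<otimes> x) \<oplus> w) = w"
      "(-\<i>) \<odot> (y \<otimes> x) \<oplus> (\<i> \<odot> (y \<otimes> x) \<oplus> w) = w" if "w \<in> carrier A" for w
      using that xy by (simp_all flip: a_assoc)
    then show ?thesis unfolding sz using xy c by (simp add: z_def l_distr r_distr sm_add_right a_ac)
  qed
  ultimately show ?thesis using xy norm_ge_0[of x] cstar_id[OF z] by (simp add: power_mono)
qed

text \<open>With \<open>j\<close> factors the product \<open>\<Prod>(1 + t\<^bsup>2\<cdot>2^i\<^esup>)\<close> is at least \<open>2\<^sup>j t\<^bsup>2^j - 1\<^esup>\<close> by AM-GM; \<open>comm_sq\<close>, applied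
  to \<open>2x\<close> and \<open>1 - x\<^sup>2\<close>, replaces \<open>2x \<le> 1 + x\<^sup>2\<close>.\<close>

lemma norm_doubling:
  assumes a: "a \<in> selfadj"
  shows "2 ^ j * cnorm A (ev a (cpoly (Polynomial.monom 1 (2 ^ j - 1) * d)))
    \<le> cnorm A (ev a (cpoly ((\<Prod>i<j. 1 + Polynomial.monom 1 (2 * 2 ^ i)) * d)))"
proof (induction j arbitrary: d)
  case (Suc j)
  have ac: "a \<in> carrier A" using a by auto
  let ?P = "\<Prod>i<j. 1 + Polynomial.monom (1::real) (2 * 2 ^ i)"
  let ?M = "Polynomial.monom (1::real) (2 ^ j)"
  \<comment> \<open>Only the last factor \<open>1 + ?M\<^sup>2\<close> is treated; the others stay
    in \<open>e\<close>. The power \<open>?M\<close> that it leaves behind is absorbed by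
    \<open>d\<close>, which is why the induction varies \<open>d\<close>.\<close>
  define e where "e = ?P * d"
  define x where "x = ?M * e + ?M * e"
  define y where "y = (1 - ?M * ?M) * e"
  define z where "z = (1 + ?M * ?M) * e"
  have M2: "Polynomial.monom (1::real) (2 * 2 ^ j) = ?M * ?M" by (simp add: mult_monom mult_2)
  have M1: "Polynomial.monom (1::real) (2 ^ j - 1) * ?M = Polynomial.monom 1 (2 ^ Suc j - 1)"
    by (simp add: mult_monom) (simp add: mult_2)
  have "x * x + y * y = z * z"
    unfolding x_def y_def z_def by (simp add: algebra_simps)
  then have "(cnorm A (ev a (cpoly x)))\<^sup>2 \<le> (cnorm A (ev a (cpoly z)))\<^sup>2"
    using comm_sq[OF ev_star[OF a, of x] ev_star[OF a, of y] ev_commute[OF ac]] norm_sq[OF ev_star[OF a, of z]]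
    by (simp flip: ev_mult[OF ac] ev_add[OF ac] cpoly_hom)
  then have xz: "cnorm A (ev a (cpoly x)) \<le> cnorm A (ev a (cpoly z))"
    using ac by (meson norm_ge_0 ev_closed power2_le_imp_le)
  have e1: "Polynomial.monom 1 (2 ^ Suc j - 1) * d = Polynomial.monom 1 (2 ^ j - 1) * (?M * d)"
    by (simp only: M1 mult.assoc[symmetric])
  have e2: "?P * (?M * d) = ?M * e" by (simp add: e_def algebra_simps)
  have e3: "2 * cnorm A (ev a (cpoly (?M * e))) = cnorm A (ev a (cpoly x))"
    unfolding x_def cpoly_hom(1) ev_add[OF ac]
    using ac norm_sm[of "ev a (cpoly (?M * e))" 2] sm_add_left[of "ev a (cpoly (?M * e))" 1 1]
    by simp
  have e4: "(\<Prod>i<Suc j. 1 + Polynomial.monom 1 (2 * 2 ^ i)) * d = z"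
    by (simp add: z_def e_def M2 algebra_simps)
  have "2 ^ Suc j * cnorm A (ev a (cpoly (Polynomial.monom 1 (2 ^ Suc j - 1) * d)))
    \<le> 2 * cnorm A (ev a (cpoly (?P * (?M * d))))"
    unfolding e1 using Suc[of "?M * d"] by simp
  also have "\<dots> \<le> cnorm A (ev a (cpoly z))" unfolding e2 e3 by (rule xz)
  finally show ?case unfolding e4 .
qed simp

text \<open>Iterating the C*-identity squares the norm, so exactly the exponents
  \<open>2\<^sup>j\<close> are reached.\<close>

lemma norm_pow2:
  assumes a: "a \<in> selfadj" shows "cnorm A (ev a (Polynomial.monom 1 (2 ^ j))) = cnorm A a ^ (2 ^ j)"
proof (induction j)
  case 0 show ?case using a by (auto simp: monom_altdef)
next
  case (Suc j)
  have ac: "a \<in> carrier A" using a by auto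
  have "Polynomial.monom (1::complex) (2 ^ Suc j) = Polynomial.monom 1 (2 ^ j) * Polynomial.monom 1 (2 ^ j)" by (simp add: mult_monom mult_2)
  moreover have "ev a (Polynomial.monom 1 (2 ^ j)) \<in> selfadj"
    using ev_star[OF a, of "Polynomial.monom 1 (2^j)"] by (simp add: map_poly_monom)
  ultimately show ?case using norm_sq Suc ac
    by (simp add: ev_mult power2_eq_square flip: power_add mult_2)
qed

text \<open>If \<open>b\<close> inverts \<open>1 - a\<^sup>2\<close>, the telescoping product is \<open>b(1 - a\<^bsup>2\<cdot>2^j\<^esup>)\<close>, of norm at most \<open>2\<parallel>b\<parallel>\<close>,
  although it has norm at least \<open>2\<^sup>j\<close>.\<close>

lemma not_unit_one_minus_sq:
  assumes a: "a \<in> selfadj" and 1: "cnorm A a = 1" shows "\<not> unit (\<one> \<ominus> a \<otimes> a)"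
proof
  assume "unit (\<one> \<ominus> a \<otimes> a)"
  then obtain b where b: "b \<in> carrier A" "b \<otimes> (\<one> \<ominus> a \<otimes> a) = \<one>" by (auto simp: unit_def)
  have ac: "a \<in> carrier A" using a by auto
  have "2 ^ j \<le> 2 * cnorm A b" for j
  proof -
    let ?P = "\<Prod>i<j. 1 + Polynomial.monom (1::real) (2 * 2 ^ i)"
    have tel: "(1 - Polynomial.monom 1 2) * ?P = 1 - Polynomial.monom 1 (2 * 2 ^ j)"
    proof (induction j)
      case (Suc j)
      have "Polynomial.monom (1::real) (2 * 2 ^ Suc j) = Polynomial.monom 1 (2 * 2 ^ j) * Polynomial.monom 1 (2 * 2 ^ j)"
        by (simp add: mult_monom)
      moreover have "(1 - Polynomial.monom 1 2) * (\<Prod>i<Suc j. 1 + Polynomial.monom 1 (2 * 2 ^ i))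
          = (1 - Polynomial.monom (1::real) (2 * 2 ^ j)) * (1 + Polynomial.monom 1 (2 * 2 ^ j))"
        by (simp only: prod.lessThan_Suc mult.assoc[symmetric] Suc)
      ultimately show ?case by (simp add: algebra_simps)
    qed (simp add: monom_altdef)
    let ?D = "ev a (cpoly ?P)"
    have "\<one> \<ominus> a \<otimes> a = ev a (cpoly (1 - Polynomial.monom 1 2))"
      using ac by (simp add: cpoly_hom map_poly_monom map_poly_pCons ev_diff numeral_2_eq_2 Polynomial.monom_Suc monom_0)
    then have "(\<one> \<ominus> a \<otimes> a) \<otimes> ?D = ev a (cpoly ((1 - Polynomial.monom 1 2) * ?P))"
      by (simp only: cpoly_hom(3) ev_mult[OF ac])
    then have e: "(\<one> \<ominus> a \<otimes> a) \<otimes> ?D = \<one> \<ominus> ev a (Polynomial.monom 1 (2 * 2 ^ j))"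
      unfolding tel cpoly_hom(2) ev_diff[OF ac] using ac by (simp add: map_poly_monom)
    have "?D = b \<otimes> ((\<one> \<ominus> a \<otimes> a) \<otimes> ?D)" using ac b by (simp flip: m_assoc)
    then have "cnorm A ?D \<le> cnorm A b * cnorm A (\<one> \<ominus> ev a (Polynomial.monom 1 (2 * 2 ^ j)))"
      unfolding e using ac b norm_mult[of b "\<one> \<ominus> ev a (Polynomial.monom 1 (2 * 2 ^ j))"] by simp
    also have "\<dots> \<le> cnorm A b * 2"
      using norm_diff_le[of \<one> "ev a (Polynomial.monom 1 (2 * 2 ^ j))"] norm_one_le norm_ev_monom[OF ac, of "2 * 2^j"] 1 ac b
      by (intro mult_left_mono) auto
    finally have D: "cnorm A ?D \<le> 2 * cnorm A b" by simp
    let ?m = "ev a (Polynomial.monom 1 (2 ^ j - 1))"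
    \<comment> \<open>The exponent \<open>2\<^sup>j - 1\<close> is not itself accessible to
      \<open>norm_pow2\<close>. One further factor \<open>a\<close>, of norm one, leads to the
      exponent \<open>2\<^sup>j\<close> and bounds the norm of \<open>?m\<close> from below.\<close>
    have "Polynomial.monom (1::complex) (2^j) = pCons 0 (Polynomial.monom 1 (2 ^ j - 1))"
      by (simp flip: Polynomial.monom_Suc)
    then have "1 \<le> cnorm A ?m" using norm_pow2[OF a, of j] 1 norm_mult[of a ?m] ac by simp
    moreover have "2 ^ j * cnorm A ?m \<le> cnorm A ?D"
      using norm_doubling[OF a, of j 1] by (simp add: map_poly_monom)
    moreover have "2 ^ j * 1 \<le> 2 ^ j * cnorm A ?m" using calculation by (intro mult_left_mono) auto
    ultimately show ?thesis using D by linarith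
  qed
  moreover obtain j where "2 * cnorm A b < 2 ^ j"
    using real_arch_pow[of 2 "2 * cnorm A b"] by auto
  ultimately show False by (meson not_less)
qed

text \<open>The usual spectrum of a unital algebra; \<open>spec\<close> is this set with
  \<open>0\<close> added.\<close>

definition sp :: "'a \<Rightarrow> complex set" where "sp a = {z. \<not> unit (z \<odot> \<one> \<ominus> a)}"

text \<open>After scaling to norm one, \<open>1 - b\<^sup>2 = (1 - b)(1 + b)\<close> would be a
  product of invertible elements if neither sign were spectral.\<close>

lemma norm_in_sp:
  assumes a: "a \<in> selfadj" and 0: "a \<noteq> \<zero>"
  shows "complex_of_real (cnorm A a) \<in> sp a \<or> - complex_of_real (cnorm A a) \<in> sp a"
proof (rule ccontr)
  let ?r = "complex_of_real (cnorm A a)"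
  assume "\<not> ?thesis"
  then have u: "unit (?r \<odot> \<one> \<ominus> a)" "unit ((-?r) \<odot> \<one> \<ominus> a)" by (auto simp: sp_def)
  have ac: "a \<in> carrier A" using a by auto
  have r: "cnorm A a \<noteq> 0" using 0 ac norm_eq_0 by auto
  let ?b = "inverse ?r \<odot> a"
  have b: "?b \<in> selfadj" using a by (auto simp: selfadj_def)
  have "cnorm A ?b = 1" using ac r by (simp add: norm_sm norm_inverse)
  then have n: "\<not> unit (\<one> \<ominus> ?b \<otimes> ?b)" using not_unit_one_minus_sq[OF b] by blast
  have "unit (inverse ?r \<odot> (?r \<odot> \<one> \<ominus> a))" "unit ((- inverse ?r) \<odot> ((-?r) \<odot> \<one> \<ominus> a))"
    using u r by (intro unit_sm; simp)+
  then have "unit (\<one> \<ominus> ?b)" "unit (\<one> \<oplus> ?b)" using ac r by (simp_all add: sm_add_right diff_sm)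
  then have "unit ((\<one> \<ominus> ?b) \<otimes> (\<one> \<oplus> ?b))" by (rule unit_mult)
  moreover have "(\<one> \<ominus> ?b) \<otimes> (\<one> \<oplus> ?b) = \<one> \<ominus> ?b \<otimes> ?b"
  proof -
    have "(\<one> \<ominus> x) \<otimes> (\<one> \<oplus> x) = \<one> \<ominus> x \<otimes> x" if "x \<in> carrier A" for x
      using that by (simp add: diff_sm l_distr r_distr a_assoc)
    then show ?thesis using ac by blast
  qed
  ultimately show False using n by simp
qed

text \<open>The part of the spectral mapping theorem that is used throughout: over the complex
  numbers \<open>p\<close> splits into linear factors, each invertible at \<open>a\<close> by
  assumption.\<close>

lemma unit_ev:
  assumes a: "a \<in> carrier A" and p: "p \<noteq> 0" and r: "\<And>z. poly p z = 0 \<Longrightarrow> z \<notin> sp a"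
  shows "unit (ev a p)"
  using p r
proof (induction "Polynomial.degree p" arbitrary: p)
  case 0
  then obtain c where "p = [:c:]" using degree_eq_zeroE by metis
  then show ?case using 0 a unit_sm[OF _ unit_one, of c] by simp
next
  case (Suc n)
  obtain z where z: "poly p z = 0"
    using fundamental_theorem_of_algebra[of p] Suc(2) constant_degree[of p] by auto
  then obtain q' where "p = [:-z,1:] * q'" unfolding poly_eq_0_iff_dvd by (rule dvdE)
  \<comment> \<open>The sign moves into the cofactor, so that the linear factor evaluates to
    \<open>z - a\<close>, the form in which \<open>sp\<close> is defined.\<close>
  moreover define q where "q = - q'"
  ultimately have q: "p = [:z,-1:] * q" by (simp add: algebra_simps)
  have q0: "q \<noteq> 0" using q Suc(3) by auto
  then have "Polynomial.degree p = Polynomial.degree [:z,-1:] + Polynomial.degree q"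
    unfolding q by (intro degree_mult_eq) auto
  then have "unit (ev a q)" using Suc q q0 by (intro Suc(1)) auto
  moreover have "unit (z \<odot> \<one> \<ominus> a)" using Suc(4)[OF z] by (simp add: sp_def)
  moreover have "ev a [:z,-1:] = z \<odot> \<one> \<ominus> a" using a by (simp add: diff_sm)
  ultimately show ?case unfolding q ev_mult[OF a] using unit_mult by simp
qed

lemma sq_expand:
  assumes s: "s \<in> carrier A"
  shows "(s \<oplus> (-c) \<odot> \<one>) \<otimes> (s \<oplus> c \<odot> \<one>) = s \<otimes> s \<oplus> (-(c * c)) \<odot> \<one>"
proof -
  have "(-c) \<odot> s \<oplus> c \<odot> s = \<zero>" using s sm_add_left[of s "-c" c] by simp
  moreover have "(s \<oplus> (-c) \<odot> \<one>) \<otimes> (s \<oplus> c \<odot> \<one>)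
      = s \<otimes> s \<oplus> (((-c) \<odot> s \<oplus> c \<odot> s) \<oplus> (-(c * c)) \<odot> \<one>)"
    using s by (simp add: l_distr r_distr sm_add_right a_ac)
  ultimately show ?thesis using s by simp
qed

text \<open>Arens' shift argument. Let \<open>y\<close> be the imaginary part of \<open>z\<close>
  and \<open>s = a - Re z\<close>. Then \<open>\<i>(y + t)\<close> is spectral for
  \<open>s + \<i>t\<close>, whose squared norm is at most
  \<open>\<parallel>s\<parallel>\<^sup>2 + t\<^sup>2\<close>; for real \<open>t\<close> of the right
  sign and size the term \<open>2yt\<close> violates this bound unless \<open>y = 0\<close>.\<close>

lemma sp_real:
  assumes a: "a \<in> selfadj" and z: "z \<in> sp a" shows "z \<in> \<real>"
proof (rule ccontr)
  assume "z \<notin> \<real>"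
  then have b: "Im z \<noteq> 0" by (simp add: complex_is_Real_iff)
  have ac: "a \<in> carrier A" and as: "star A a = a" using a by auto
  define s where "s = a \<ominus> complex_of_real (Re z) \<odot> \<one>"
  have s: "s \<in> selfadj" "s \<in> carrier A" using ac as by (auto simp: s_def selfadj_def)
  define y where "y = Im z"
  have key: "(y + t)\<^sup>2 \<le> (cnorm A s)\<^sup>2 + t\<^sup>2" for t :: real
  proof -
    let ?w = "s \<oplus> (\<i> * of_real t) \<odot> \<one>"
    have "of_real (Re z) + \<i> * of_real y = z" by (simp add: y_def complex_eq_iff)
    then have "z \<odot> \<one> = of_real (Re z) \<odot> \<one> \<oplus> (\<i> * of_real y) \<odot> \<one>" by (metis sm_add_left one_closed)
    moreover have "(\<i> * of_real (y + t)) \<odot> \<one> = (\<i> * of_real y) \<odot> \<one> \<oplus> (\<i> * of_real t) \<odot> \<one>"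
      by (simp add: algebra_simps flip: sm_add_left)
    ultimately have "(\<i> * of_real (y + t)) \<odot> \<one> \<ominus> ?w = z \<odot> \<one> \<ominus> a"
    proof -
      assume e: "z \<odot> \<one> = of_real (Re z) \<odot> \<one> \<oplus> (\<i> * of_real y) \<odot> \<one>"
        "(\<i> * of_real (y + t)) \<odot> \<one> = (\<i> * of_real y) \<odot> \<one> \<oplus> (\<i> * of_real t) \<odot> \<one>"
      have "(p \<oplus> q) \<ominus> ((a \<ominus> r) \<oplus> q) = (r \<oplus> p) \<ominus> a" if "p \<in> carrier A" "q \<in> carrier A" "r \<in> carrier A" for p q r
        using that ac by (simp add: diff_sm sm_add_right a_ac add_cancels)
      then show ?thesis unfolding e s_def by simp
    qed
    then have "\<not> unit ((\<i> * of_real (y + t)) \<odot> \<one> \<ominus> ?w)" using z by (simp add: sp_def)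
    then have "cmod (\<i> * of_real (y + t)) \<le> cnorm A ?w" using unit_large[of ?w "\<i> * of_real (y + t)"] s by fastforce
    then have "(y + t)\<^sup>2 \<le> (cnorm A ?w)\<^sup>2"
      by (simp add: cmod_def abs_le_square_iff[symmetric])
    also have "\<dots> = cnorm A (star A ?w \<otimes> ?w)" by (rule cstar_id[symmetric]) (use s in auto)
    also have "star A ?w \<otimes> ?w = s \<otimes> s \<oplus> (of_real (t\<^sup>2)) \<odot> \<one>"
      using s sq_expand[of s "\<i> * of_real t"] by (simp add: selfadj_def power2_eq_square algebra_simps)
    also have "cnorm A (s \<otimes> s \<oplus> (of_real (t\<^sup>2)) \<odot> \<one>) \<le> (cnorm A s)\<^sup>2 + t\<^sup>2 * 1"
    proof -
      have "cnorm A (s \<otimes> s \<oplus> (of_real (t\<^sup>2)) \<odot> \<one>) \<le> cnorm A (s \<otimes> s) + t\<^sup>2 * cnorm A \<one>"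
        using norm_add[of "s \<otimes> s" "(of_real (t\<^sup>2)) \<odot> \<one>"] s norm_sm[of \<one> "of_real (t\<^sup>2)"]
        by (simp add: norm_power)
      also have "cnorm A (s \<otimes> s) \<le> (cnorm A s)\<^sup>2" using norm_mult[of s s] s by (simp add: power2_eq_square)
      also have "t\<^sup>2 * cnorm A \<one> \<le> t\<^sup>2 * 1" using norm_one_le by (intro mult_left_mono) auto
      finally show ?thesis by simp
    qed
    finally show ?thesis by simp
  qed
  define K where "K = (cnorm A s)\<^sup>2"
  \<comment> \<open>For this shift the cross term \<open>2yT\<close> equals \<open>K\<close>, and
    the bound reduces to \<open>y\<^sup>2 \<le> 0\<close>.\<close>
  define T where "T = K / (2 * y)"
  have "y \<noteq> 0" using b y_def by simp
  then have "2 * y * T = K" by (simp add: T_def)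
  moreover have "(y + T)\<^sup>2 = y\<^sup>2 + 2 * y * T + T\<^sup>2" by (simp add: power2_sum)
  moreover have "(y + T)\<^sup>2 \<le> K + T\<^sup>2" unfolding K_def by (rule key)
  ultimately have "y\<^sup>2 \<le> 0" by linarith
  then show False using b y_def by simp
qed

text \<open>By \<open>norm_in_sp\<close> the norm of \<open>p(a)\<close> is up to sign a spectral
  value \<open>l\<close> of \<open>p(a)\<close>, and by \<open>unit_ev\<close> the polynomial
  \<open>l - p\<close> then has a root in the spectrum of \<open>a\<close>.\<close>

lemma norm_ev_le:
  assumes a: "a \<in> selfadj" and M: "\<And>t. complex_of_real t \<in> sp a \<Longrightarrow> \<bar>poly p t\<bar> \<le> M" and M0: "0 \<le> M"
  shows "cnorm A (ev a (cpoly p)) \<le> M"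
proof (cases "ev a (cpoly p) = \<zero>")
  case False
  have ac: "a \<in> carrier A" using a by auto
  let ?x = "ev a (cpoly p)"
  obtain l where l: "l = cnorm A ?x \<or> l = - cnorm A ?x" "complex_of_real l \<in> sp ?x"
    using norm_in_sp[OF ev_star[OF a] False] by (metis of_real_minus)
  have "complex_of_real l \<odot> \<one> \<ominus> ?x = ev a ([:of_real l:] - cpoly p)" using ac by (simp add: ev_diff)
  then have nu: "\<not> unit (ev a ([:of_real l:] - cpoly p))" using l by (simp add: sp_def)
  show ?thesis
  proof (cases "[:of_real l:] - cpoly p = 0")
    case True
    then have p: "cpoly p = [:of_real l:]" by simp
    then have nu: "\<not> unit (ev a [:0:])" using nu by simp
    \<comment> \<open>Here \<open>p\<close> is constant and any spectral value of \<open>a\<close>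
      will do. One exists because zero is not invertible, that is, the algebra is not the zero
      algebra.\<close>
    obtain z where z: "z \<in> sp a"
    proof (cases "a = \<zero>")
      case True
      moreover have "\<not> unit \<zero>" using nu ac by simp
      ultimately have "0 \<in> sp a" by (simp add: sp_def)
      then show ?thesis ..
    next
      case False then show ?thesis using norm_in_sp[OF a] that by blast
    qed
    then obtain t where t: "complex_of_real t \<in> sp a" using sp_real[OF a] by (metis Reals_cases)
    have "complex_of_real (poly p t) = complex_of_real l" using poly_cpoly[of p t] p by simp
    then have "poly p t = l" by (simp only: of_real_eq_iff)
    then show ?thesis using M[OF t] l norm_ge_0[of ?x] ac by auto
  next
    case False
    then obtain z where z: "poly ([:of_real l:] - cpoly p) z = 0" "z \<in> sp a"
      using unit_ev[OF ac] nu by blast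
    then obtain t where t: "z = complex_of_real t" using sp_real[OF a] by (metis Reals_cases)
    then have "complex_of_real l = complex_of_real (poly p t)" using z by (simp add: poly_cpoly)
    then have "poly p t = l" by (simp only: of_real_eq_iff)
    then show ?thesis using M t z l norm_ge_0[of ?x] ac by fastforce
  qed
qed (use M0 in simp)

end

section \<open>Functional calculus and positivity\<close>

lemma poly_approx:
  fixes f :: "real \<Rightarrow> real"
  assumes f: "continuous_on UNIV f" and e: "0 < e"
  obtains p where "\<And>t. \<bar>t\<bar> \<le> R \<Longrightarrow> \<bar>poly p t - f t\<bar> < e"
proof -
  have "continuous_on {-R..R} f" using f continuous_on_subset by blast
  then obtain g where g: "real_polynomial_function g" "\<And>x. x \<in> {-R..R} \<Longrightarrow> \<bar>f x - g x\<bar> < e"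
    using Stone_Weierstrass_real_polynomial_function[of "{-R..R}" f e] e by auto
  obtain a n where a: "g = (\<lambda>x. \<Sum>i\<le>n. a i * x ^ i)" using g real_polynomial_function_iff_sum by blast
  have "poly (\<Sum>i\<le>n. Polynomial.monom (a i) i) t = g t" for t
    by (simp add: a poly_sum poly_monom)
  then show ?thesis using g(2) by (intro that[of "\<Sum>i\<le>n. Polynomial.monom (a i) i"]) (simp add: abs_le_iff abs_minus_commute minus_le_iff)
qed

section \<open>Norm convergence\<close>

context pre_cstar
begin

definition conv :: "(nat \<Rightarrow> 'a) \<Rightarrow> 'a \<Rightarrow> bool" where
  "conv s l \<longleftrightarrow> (\<forall>n. s n \<in> carrier A) \<and> l \<in> carrier A \<and> (\<lambda>n. cnorm A (s n \<ominus> l)) \<longlonglongrightarrow> 0"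

lemma convD: "conv s l \<Longrightarrow> s n \<in> carrier A" "conv s l \<Longrightarrow> l \<in> carrier A"
  "conv s l \<Longrightarrow> (\<lambda>n. cnorm A (s n \<ominus> l)) \<longlonglongrightarrow> 0"
  by (auto simp: conv_def)

lemma convI:
  assumes "\<And>n. s n \<in> carrier A" "l \<in> carrier A" "\<And>n. cnorm A (s n \<ominus> l) \<le> b n" "b \<longlonglongrightarrow> 0"
  shows "conv s l"
proof -
  have "(\<lambda>n. cnorm A (s n \<ominus> l)) \<longlonglongrightarrow> 0"
    using assms by (intro Lim_null_comparison[OF _ assms(4)]) simp
  then show ?thesis using assms by (simp add: conv_def)
qed

lemma conv_const: "x \<in> carrier A \<Longrightarrow> conv (\<lambda>_. x) x"
  by (simp add: conv_def)

lemma conv_norm: assumes "conv s l" shows "(\<lambda>n. cnorm A (s n)) \<longlonglongrightarrow> cnorm A l"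
proof (rule LIM_zero_cancel, rule tendsto_rabs_zero_cancel)
  have "\<bar>cnorm A (s n) - cnorm A l\<bar> \<le> cnorm A (s n \<ominus> l)" for n
    using convD(1,2)[OF assms] norm_le_diff[of "s n" l] norm_le_diff[of l "s n"] norm_diff_commute[of l "s n"]
    by (simp add: abs_le_iff)
  then show "(\<lambda>n. \<bar>cnorm A (s n) - cnorm A l\<bar>) \<longlonglongrightarrow> 0"
    by (intro Lim_null_comparison[OF _ convD(3)[OF assms]]) simp
qed

lemma conv_add: assumes "conv s l" "conv t k" shows "conv (\<lambda>n. s n \<oplus> t n) (l \<oplus> k)"
proof (rule convI)
  note c = convD(1,2)[OF assms(1)] convD(1,2)[OF assms(2)]
  show "cnorm A (s n \<oplus> t n \<ominus> (l \<oplus> k)) \<le> cnorm A (s n \<ominus> l) + cnorm A (t n \<ominus> k)" for n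
  proof -
    have "s n \<oplus> t n \<ominus> (l \<oplus> k) = (s n \<ominus> l) \<oplus> (t n \<ominus> k)" using c by (simp add: diff_sm sm_add_right a_ac)
    then show ?thesis using c norm_add[of "s n \<ominus> l" "t n \<ominus> k"] by simp
  qed
  show "(\<lambda>n. cnorm A (s n \<ominus> l) + cnorm A (t n \<ominus> k)) \<longlonglongrightarrow> 0"
    using tendsto_add[OF convD(3)[OF assms(1)] convD(3)[OF assms(2)]] by simp
qed (use assms convD in auto)

lemma conv_sm: assumes "conv s l" shows "conv (\<lambda>n. c \<odot> s n) (c \<odot> l)"
  using assms tendsto_mult[OF tendsto_const, OF convD(3)[OF assms], of "cmod c"]
  by (auto simp: conv_def norm_sm simp flip: sm_diff_right)

lemma conv_diff: assumes "conv s l" "conv t k" shows "conv (\<lambda>n. s n \<ominus> t n) (l \<ominus> k)"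
  using conv_add[OF assms(1) conv_sm[OF assms(2), of "-1"]] convD(1,2)[OF assms(1)] convD(1,2)[OF assms(2)]
  by (simp add: diff_sm)

lemma conv_mult: assumes "conv s l" "conv t k" shows "conv (\<lambda>n. s n \<otimes> t n) (l \<otimes> k)"
proof (rule convI)
  note c = convD(1,2)[OF assms(1)] convD(1,2)[OF assms(2)]
  show "cnorm A (s n \<otimes> t n \<ominus> l \<otimes> k) \<le> cnorm A (s n \<ominus> l) * cnorm A (t n) + cnorm A l * cnorm A (t n \<ominus> k)" for n
    using c by (intro norm_mult_diff) auto
  show "(\<lambda>n. cnorm A (s n \<ominus> l) * cnorm A (t n) + cnorm A l * cnorm A (t n \<ominus> k)) \<longlonglongrightarrow> 0"
    using tendsto_add[OF tendsto_mult[OF convD(3)[OF assms(1)] conv_norm[OF assms(2)]]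
        tendsto_mult[OF tendsto_const[of "cnorm A l"] convD(3)[OF assms(2)]]] by simp
qed (use assms convD in auto)

lemma conv_star: assumes "conv s l" shows "conv (\<lambda>n. star A (s n)) (star A l)"
  using assms by (auto simp: conv_def simp flip: star_diff)

lemma conv_le: assumes "conv s l" "\<And>e. 0 < e \<Longrightarrow> \<forall>\<^sub>F n in sequentially. cnorm A (s n) \<le> M + e" shows "cnorm A l \<le> M"
proof (rule field_le_epsilon)
  fix e :: real assume "0 < e"
  then show "cnorm A l \<le> M + e" using conv_norm[OF assms(1)] assms(2) tendsto_upperbound by fastforce
qed

lemma conv_unique: assumes "conv s l" "conv s k" shows "l = k"
proof -
  have "conv (\<lambda>n. s n \<ominus> s n) (l \<ominus> k)" by (intro conv_diff assms)
  then have "cnorm A (l \<ominus> k) \<le> 0" using convD(1)[OF assms(1)] by (intro conv_le) auto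
  then show ?thesis using convD(2)[OF assms(1)] convD(2)[OF assms(2)] norm_eq_0[of "l \<ominus> k"] norm_ge_0[of "l \<ominus> k"] diff_eq_0[of l k]
    by fastforce
qed

lemma selfadj_closed:
  "\<zero> \<in> selfadj" "x \<in> selfadj \<Longrightarrow> y \<in> selfadj \<Longrightarrow> x \<oplus> y \<in> selfadj"
  "x \<in> selfadj \<Longrightarrow> y \<in> selfadj \<Longrightarrow> x \<ominus> y \<in> selfadj" "x \<in> selfadj \<Longrightarrow> complex_of_real r \<odot> x \<in> selfadj"
  "y \<in> carrier A \<Longrightarrow> star A y \<otimes> y \<in> selfadj" "y \<in> carrier A \<Longrightarrow> y \<otimes> star A y \<in> selfadj"
  "x \<in> selfadj \<Longrightarrow> x \<otimes> x \<in> selfadj"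
  "x \<in> selfadj \<Longrightarrow> y \<in> carrier A \<Longrightarrow> star A y \<otimes> (x \<otimes> y) \<in> selfadj"
  by (auto simp: selfadj_def m_assoc)

end

section \<open>Continuous functional calculus\<close>

context unital_cstar
begin

text \<open>The identity \<open>(1 - x)(1 - y) = 1 + (xy - (x + y))\<close> turns quasi-inverses
  \<open>y\<close> of \<open>x\<close> into inverses \<open>1 - y\<close> of
  \<open>1 - x\<close>.\<close>

lemma spec_eq: assumes a: "a \<in> carrier A" shows "spec A a = insert 0 (sp a)"
proof -
  have "quasi_invertible A (inverse z \<odot> a) \<longleftrightarrow> unit (z \<odot> \<one> \<ominus> a)" if z: "z \<noteq> 0" for z
  proof -
    let ?x = "inverse z \<odot> a"
    have x: "?x \<in> carrier A" using a by simp
    have e1: "(\<one> \<ominus> ?x) \<otimes> (\<one> \<ominus> y) = \<one> \<longleftrightarrow> ?x \<oplus> y = ?x \<otimes> y"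
      and e2: "(\<one> \<ominus> y) \<otimes> (\<one> \<ominus> ?x) = \<one> \<longleftrightarrow> ?x \<oplus> y = y \<otimes> ?x" if y: "y \<in> carrier A" for y
    proof -
      have "u \<oplus> v = w \<longleftrightarrow> \<one> \<oplus> (w \<ominus> (u \<oplus> v)) = \<one>" if "u \<in> carrier A" "v \<in> carrier A" "w \<in> carrier A" for u v w
        using that add_cancel[of \<one> "w \<ominus> (u \<oplus> v)" \<zero>] diff_eq_0[of w "u \<oplus> v"] by auto
      moreover have "(\<one> \<ominus> u) \<otimes> (\<one> \<ominus> v) = \<one> \<oplus> (u \<otimes> v \<ominus> (u \<oplus> v))" if "u \<in> carrier A" "v \<in> carrier A" for u v
        using that by (simp add: diff_sm l_distr r_distr sm_add_right a_ac)
      ultimately show "(\<one> \<ominus> ?x) \<otimes> (\<one> \<ominus> y) = \<one> \<longleftrightarrow> ?x \<oplus> y = ?x \<otimes> y"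
        "(\<one> \<ominus> y) \<otimes> (\<one> \<ominus> ?x) = \<one> \<longleftrightarrow> ?x \<oplus> y = y \<otimes> ?x" using x y by (metis a_comm m_closed)+
    qed
    have "quasi_invertible A ?x \<longleftrightarrow> unit (\<one> \<ominus> ?x)"
    proof
      assume "unit (\<one> \<ominus> ?x)"
      then obtain u where u: "u \<in> carrier A" "(\<one> \<ominus> ?x) \<otimes> u = \<one>" "u \<otimes> (\<one> \<ominus> ?x) = \<one>" by (auto simp: unit_def)
      define y where "y = \<one> \<ominus> u"
      have "u = \<one> \<ominus> y" using u by (simp add: y_def diff_sm sm_add_right)
      then show "quasi_invertible A ?x"
        unfolding quasi_invertible_def using u e1[of y] e2[of y] by (intro bexI[of _ y]) (auto simp: y_def)
    next
      assume "quasi_invertible A ?x"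
      then obtain y where "y \<in> carrier A" "?x \<oplus> y = ?x \<otimes> y" "?x \<oplus> y = y \<otimes> ?x" by (auto simp: quasi_invertible_def)
      then show "unit (\<one> \<ominus> ?x)"
        unfolding unit_def using x e1[of y] e2[of y] by (intro conjI bexI[of _ "\<one> \<ominus> y"]) auto
    qed
    also have "\<dots> \<longleftrightarrow> unit (z \<odot> (\<one> \<ominus> ?x))" using z a by (simp add: unit_sm_iff)
    also have "z \<odot> (\<one> \<ominus> ?x) = z \<odot> \<one> \<ominus> a" using z a by (simp add: sm_diff_right)
    finally show ?thesis .
  qed
  then show ?thesis by (auto simp: spec_def sp_def)
qed

definition spr :: "'a \<Rightarrow> real set" where "spr a = {t. complex_of_real t \<in> sp a}"

lemma spr_bound: "a \<in> carrier A \<Longrightarrow> t \<in> spr a \<Longrightarrow> \<bar>t\<bar> \<le> cnorm A a"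
  using unit_large[of a "complex_of_real t"] by (fastforce simp: spr_def sp_def)

text \<open>The analogue of \<open>has_cfc\<close> in a unital algebra: constant terms are
  permitted, \<open>f\<close> need not vanish at \<open>0\<close>, and convergence is asked only on
  the true spectrum.\<close>

definition cf_rel :: "'a \<Rightarrow> (real \<Rightarrow> real) \<Rightarrow> 'a \<Rightarrow> bool" where
  "cf_rel a f c \<longleftrightarrow> (\<exists>p. uniform_limit (spr a) (\<lambda>n. poly (p n)) f sequentially \<and> conv (\<lambda>n. ev a (cpoly (p n))) c)"

text \<open>The estimate \<open>norm_ev_le\<close> survives the limit. Treating two functions at
  once yields uniqueness, for \<open>M = 0\<close>, as well as the continuity of the
  calculus.\<close>

lemma cf_rel_norm:
  assumes a: "a \<in> selfadj" and c: "cf_rel a f c" and d: "cf_rel a g d"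
    and M: "\<And>t. t \<in> spr a \<Longrightarrow> \<bar>f t - g t\<bar> \<le> M" and M0: "0 \<le> M"
  shows "cnorm A (c \<ominus> d) \<le> M"
proof -
  have ac: "a \<in> carrier A" using a by auto
  obtain p where p: "uniform_limit (spr a) (\<lambda>n. poly (p n)) f sequentially" "conv (\<lambda>n. ev a (cpoly (p n))) c"
    using c by (auto simp: cf_rel_def)
  obtain q where q: "uniform_limit (spr a) (\<lambda>n. poly (q n)) g sequentially" "conv (\<lambda>n. ev a (cpoly (q n))) d"
    using d by (auto simp: cf_rel_def)
  show ?thesis
  proof (rule conv_le)
    show "conv (\<lambda>n. ev a (cpoly (p n)) \<ominus> ev a (cpoly (q n))) (c \<ominus> d)" by (intro conv_diff p q)
    fix e :: real assume e: "0 < e"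
    have "\<forall>\<^sub>F n in sequentially. \<forall>x\<in>spr a. dist (poly (p n) x) (f x) < e/2"
      "\<forall>\<^sub>F n in sequentially. \<forall>x\<in>spr a. dist (poly (q n) x) (g x) < e/2"
      using uniform_limitD[OF p(1), of "e/2"] uniform_limitD[OF q(1), of "e/2"] e by simp_all
    then show "\<forall>\<^sub>F n in sequentially. cnorm A (ev a (cpoly (p n)) \<ominus> ev a (cpoly (q n))) \<le> M + e"
    proof eventually_elim
      case (elim n)
      have "\<bar>poly (p n - q n) t\<bar> \<le> M + e" if t: "complex_of_real t \<in> sp a" for t
      proof -
        have "t \<in> spr a" using t by (simp add: spr_def)
        then have "\<bar>poly (p n) t - f t\<bar> < e/2" "\<bar>poly (q n) t - g t\<bar> < e/2" "\<bar>f t - g t\<bar> \<le> M"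
          using elim M by (auto simp: dist_real_def)
        then show ?thesis unfolding poly_diff by linarith
      qed
      then have "cnorm A (ev a (cpoly (p n - q n))) \<le> M + e" using M0 e by (intro norm_ev_le[OF a]) auto
      then show ?case using ac by (simp add: cpoly_hom ev_diff)
    qed
  qed
qed

lemma cf_rel_unique:
  assumes "a \<in> selfadj" "cf_rel a f c" "cf_rel a f d" shows "c = d"
proof -
  have "cnorm A (c \<ominus> d) \<le> 0" using assms by (rule cf_rel_norm) auto
  moreover have "c \<in> carrier A" "d \<in> carrier A" using assms by (auto simp: cf_rel_def dest: convD)
  ultimately show ?thesis using norm_eq_0[of "c \<ominus> d"] norm_ge_0[of "c \<ominus> d"] diff_eq_0[of c d] by fastforce
qed

definition cf :: "'a \<Rightarrow> (real \<Rightarrow> real) \<Rightarrow> 'a" where "cf a f = (THE c. cf_rel a f c)"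

lemma cf_eqI: "a \<in> selfadj \<Longrightarrow> cf_rel a f c \<Longrightarrow> cf a f = c"
  unfolding cf_def using cf_rel_unique by blast

text \<open>The prescribed rate on an interval containing the spectrum makes the values a Cauchy
  sequence by \<open>norm_ev_le\<close>; completeness then supplies the limit.\<close>

lemma cf_relI:
  assumes a: "a \<in> selfadj" and p: "\<And>n t. \<bar>t\<bar> \<le> cnorm A a \<Longrightarrow> \<bar>poly (p n) t - f t\<bar> < 1 / real (Suc n)"
  shows "uniform_limit (spr a) (\<lambda>n. poly (p n)) f sequentially"
    "\<exists>c. conv (\<lambda>n. ev a (cpoly (p n))) c"
proof -
  have ac: "a \<in> carrier A" using a by auto
  have sb: "\<bar>t\<bar> \<le> cnorm A a" if "t \<in> spr a" for t using spr_bound[OF ac that] .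
  have N: "\<exists>N. \<forall>n\<ge>N. 1 / real (Suc n) < e" if "0 < e" for e
    using LIMSEQ_inverse_real_of_nat that by (auto simp: LIMSEQ_iff inverse_eq_divide)
  show "uniform_limit (spr a) (\<lambda>n. poly (p n)) f sequentially"
    unfolding uniform_limit_iff eventually_sequentially dist_real_def
  proof (intro allI impI)
    fix e :: real assume "0 < e"
    then obtain N where "\<And>n. n \<ge> N \<Longrightarrow> 1 / real (Suc n) < e" using N by blast
    then show "\<exists>N. \<forall>n\<ge>N. \<forall>t\<in>spr a. \<bar>poly (p n) t - f t\<bar> < e"
      using p sb by (meson less_trans)
  qed
  have d: "cnorm A (ev a (cpoly (p m)) \<ominus> ev a (cpoly (p n))) \<le> 1 / real (Suc m) + 1 / real (Suc n)" for m n
  proof -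
    have "\<bar>poly (p m - p n) t\<bar> \<le> 1 / real (Suc m) + 1 / real (Suc n)" if t: "complex_of_real t \<in> sp a" for t
    proof -
      have "\<bar>poly (p m) t - f t\<bar> < 1 / real (Suc m)" "\<bar>poly (p n) t - f t\<bar> < 1 / real (Suc n)"
        using p sb t by (auto simp: spr_def)
      then show ?thesis unfolding poly_diff by linarith
    qed
    then have "cnorm A (ev a (cpoly (p m - p n))) \<le> 1 / real (Suc m) + 1 / real (Suc n)"
      by (intro norm_ev_le[OF a]) auto
    then show ?thesis using ac by (simp add: cpoly_hom ev_diff)
  qed
  have "\<exists>N. \<forall>m\<ge>N. \<forall>n\<ge>N. cnorm A (ev a (cpoly (p m)) \<ominus> ev a (cpoly (p n))) < e" if e: "0 < e" for e
  proof -
    obtain N where N: "\<And>n. n \<ge> N \<Longrightarrow> 1 / real (Suc n) < e / 2" using N[of "e/2"] e by auto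
    have "cnorm A (ev a (cpoly (p m)) \<ominus> ev a (cpoly (p n))) < e" if "m \<ge> N" "n \<ge> N" for m n
      using d[of m n] N[OF that(1)] N[OF that(2)] by linarith
    then show ?thesis by blast
  qed
  then show "\<exists>c. conv (\<lambda>n. ev a (cpoly (p n))) c"
    using complete_seq[of "\<lambda>n. ev a (cpoly (p n))"] ac by (auto simp: conv_def)
qed

lemma poly_seq:
  assumes f: "continuous_on UNIV f"
  shows "\<exists>p. \<forall>n t. \<bar>t\<bar> \<le> R \<longrightarrow> \<bar>poly (p n) t - f t\<bar> < 1 / real (Suc n)"
proof -
  have "\<exists>p. \<forall>t. \<bar>t\<bar> \<le> R \<longrightarrow> \<bar>poly p t - f t\<bar> < 1 / real (Suc n)" for n
    using poly_approx[OF f, of "1 / real (Suc n)" R] by (metis of_nat_0_less_iff zero_less_Suc zero_less_divide_1_iff)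
  then show ?thesis by (rule choice[OF allI])
qed

lemma cf_rel: assumes a: "a \<in> selfadj" and f: "continuous_on UNIV f" shows "cf_rel a f (cf a f)"
proof -
  obtain p where p: "\<And>n t. \<bar>t\<bar> \<le> cnorm A a \<Longrightarrow> \<bar>poly (p n) t - f t\<bar> < 1 / real (Suc n)" using poly_seq[OF f, of "cnorm A a"] by auto
  obtain c where "conv (\<lambda>n. ev a (cpoly (p n))) c" using cf_relI(2)[of a p f, OF a p] by auto
  then have "cf_rel a f c" unfolding cf_rel_def using cf_relI(1)[of a p f, OF a p] by auto
  then show ?thesis using cf_eqI[OF a, of f c] by simp
qed

lemma cf_closed [simp, intro]: "a \<in> selfadj \<Longrightarrow> continuous_on UNIV f \<Longrightarrow> cf a f \<in> carrier A"
  using cf_rel[of a f] by (auto simp: cf_rel_def dest: convD)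

lemma cf_selfadj: assumes a: "a \<in> selfadj" and f: "continuous_on UNIV f" shows "cf a f \<in> selfadj"
proof -
  obtain p where p: "conv (\<lambda>n. ev a (cpoly (p n))) (cf a f)" using cf_rel[OF a f] by (auto simp: cf_rel_def)
  have "conv (\<lambda>n. ev a (cpoly (p n))) (star A (cf a f))"
    using conv_star[OF p] ev_star[OF a] by (simp add: selfadj_def)
  then have "star A (cf a f) = cf a f" using p conv_unique by blast
  then show ?thesis using a f by (simp add: selfadj_def)
qed

text \<open>This is how identities that hold only for \<open>t \<ge> 0\<close> are applied to
  positive elements, although all functions are continuous on the whole line.\<close>

lemma cf_cong:
  assumes "a \<in> selfadj" "continuous_on UNIV f" "continuous_on UNIV g" "\<And>t. t \<in> spr a \<Longrightarrow> f t = g t"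
  shows "cf a f = cf a g"
proof -
  obtain p where p: "uniform_limit (spr a) (\<lambda>n. poly (p n)) f sequentially" "conv (\<lambda>n. ev a (cpoly (p n))) (cf a f)"
    using cf_rel[OF assms(1,2)] by (auto simp: cf_rel_def)
  have "uniform_limit (spr a) (\<lambda>n. poly (p n)) g sequentially" using p(1) assms(4) by (simp add: uniform_limit_iff)
  then have "cf_rel a g (cf a f)" using p(2) by (auto simp: cf_rel_def)
  then show ?thesis using cf_eqI[OF assms(1), of g] by simp
qed

lemma cf_norm_diff_le:
  assumes "a \<in> selfadj" "continuous_on UNIV f" "continuous_on UNIV g"
    "\<And>t. t \<in> spr a \<Longrightarrow> \<bar>f t - g t\<bar> \<le> M" "0 \<le> M"
  shows "cnorm A (cf a f \<ominus> cf a g) \<le> M"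
  using assms cf_rel_norm[OF assms(1) cf_rel cf_rel] by blast

lemma cf_poly: "a \<in> selfadj \<Longrightarrow> cf a (poly p) = ev a (cpoly p)"
  by (rule cf_eqI) (auto simp: cf_rel_def intro!: exI[of _ "\<lambda>_. p"] conv_const uniform_limit_const)

lemma cf_id: "a \<in> selfadj \<Longrightarrow> cf a (\<lambda>t. t) = a"
proof -
  assume a: "a \<in> selfadj"
  have "poly [:0,1:] = (\<lambda>t::real. t)" by (simp add: fun_eq_iff)
  then show ?thesis using a cf_poly[OF a, of "[:0,1:]"] by (auto simp: map_poly_pCons selfadj_def)
qed

lemma cf_const: "a \<in> selfadj \<Longrightarrow> cf a (\<lambda>t. c) = complex_of_real c \<odot> \<one>"
proof -
  assume a: "a \<in> selfadj"
  have "poly [:c:] = (\<lambda>t::real. c)" by (simp add: fun_eq_iff)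
  then show ?thesis using a cf_poly[OF a, of "[:c:]"] by (auto simp: map_poly_pCons selfadj_def)
qed

lemma cf_norm_le:
  assumes "a \<in> selfadj" "continuous_on UNIV f" "\<And>t. t \<in> spr a \<Longrightarrow> \<bar>f t\<bar> \<le> M" "0 \<le> M"
  shows "cnorm A (cf a f) \<le> M"
  using cf_norm_diff_le[OF assms(1,2), of "\<lambda>_. 0" M] assms cf_const[OF assms(1), of 0] by (simp add: diff_sm)

lemma cf_add:
  assumes a: "a \<in> selfadj" and f: "continuous_on UNIV f" and g: "continuous_on UNIV g"
  shows "cf a (\<lambda>t. f t + g t) = cf a f \<oplus> cf a g"
proof (rule cf_eqI[OF a])
  have ac: "a \<in> carrier A" using a by auto
  obtain p where p: "uniform_limit (spr a) (\<lambda>n. poly (p n)) f sequentially" "conv (\<lambda>n. ev a (cpoly (p n))) (cf a f)"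
    using cf_rel[OF a f] by (auto simp: cf_rel_def)
  obtain q where q: "uniform_limit (spr a) (\<lambda>n. poly (q n)) g sequentially" "conv (\<lambda>n. ev a (cpoly (q n))) (cf a g)"
    using cf_rel[OF a g] by (auto simp: cf_rel_def)
  have e: "poly (p n + q n) = (\<lambda>t. poly (p n) t + poly (q n) t)" for n by (simp add: fun_eq_iff)
  show "cf_rel a (\<lambda>t. f t + g t) (cf a f \<oplus> cf a g)"
    unfolding cf_rel_def using uniform_limit_add[OF p(1) q(1)] conv_add[OF p(2) q(2)] ac
    by (intro exI[of _ "\<lambda>n. p n + q n"]) (simp add: cpoly_hom ev_add e)
qed

lemma cf_mult:
  assumes a: "a \<in> selfadj" and f: "continuous_on UNIV f" and g: "continuous_on UNIV g"
  shows "cf a (\<lambda>t. f t * g t) = cf a f \<otimes> cf a g"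
proof (rule cf_eqI[OF a])
  have ac: "a \<in> carrier A" using a by auto
  obtain p where p: "uniform_limit (spr a) (\<lambda>n. poly (p n)) f sequentially" "conv (\<lambda>n. ev a (cpoly (p n))) (cf a f)"
    using cf_rel[OF a f] by (auto simp: cf_rel_def)
  obtain q where q: "uniform_limit (spr a) (\<lambda>n. poly (q n)) g sequentially" "conv (\<lambda>n. ev a (cpoly (q n))) (cf a g)"
    using cf_rel[OF a g] by (auto simp: cf_rel_def)
  have sub: "spr a \<subseteq> {-cnorm A a..cnorm A a}" using spr_bound[OF ac] by (auto simp: abs_le_iff minus_le_iff)
  \<comment> \<open>Uniform limits may be multiplied only when the limit functions are bounded; the
    spectrum lies in a compact interval.\<close>
  have b: "bounded (h ` spr a)" if "continuous_on UNIV h" for h :: "real \<Rightarrow> real"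
  proof -
    have "compact (h ` {-cnorm A a..cnorm A a})" using that by (meson compact_Icc compact_continuous_image continuous_on_subset subset_UNIV)
    then show ?thesis using sub by (meson bounded_subset compact_imp_bounded image_mono)
  qed
  have e: "poly (p n * q n) = (\<lambda>t. poly (p n) t * poly (q n) t)" for n by (simp add: fun_eq_iff)
  show "cf_rel a (\<lambda>t. f t * g t) (cf a f \<otimes> cf a g)"
    unfolding cf_rel_def using uniform_lim_mult[OF p(1) q(1) b[OF f] b[OF g]] conv_mult[OF p(2) q(2)] ac
    by (intro exI[of _ "\<lambda>n. p n * q n"]) (simp add: cpoly_hom ev_mult e)
qed

lemma cf_scale:
  assumes "a \<in> selfadj" "continuous_on UNIV f" shows "cf a (\<lambda>t. c * f t) = complex_of_real c \<odot> cf a f"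
  using cf_mult[of a "\<lambda>_. c" f] cf_const[of a c] assms by simp

lemma cf_diff:
  assumes "a \<in> selfadj" "continuous_on UNIV f" "continuous_on UNIV g"
  shows "cf a (\<lambda>t. f t - g t) = cf a f \<ominus> cf a g"
  using cf_add[of a f "\<lambda>t. (-1) * g t"] cf_scale[of a g "-1"] assms
  by (simp add: diff_sm continuous_on_minus)

section \<open>The cone of positive elements\<close>

lemma sp_square:
  assumes h: "h \<in> selfadj" and z: "z \<in> sp (h \<otimes> h)" shows "z \<in> \<real> \<and> 0 \<le> Re z"
proof -
  have hc: "h \<in> carrier A" using h by auto
  \<comment> \<open>As a polynomial in \<open>h\<close>, \<open>z - h\<^sup>2\<close> fails to be
    invertible only if some root \<open>w\<close> of \<open>w\<^sup>2 = z\<close> is spectral for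
    \<open>h\<close>, and such \<open>w\<close> is real.\<close>
  have "z \<odot> \<one> \<ominus> h \<otimes> h = ev h [:z,0,-1:]" using hc by (simp add: diff_sm)
  then have "\<not> unit (ev h [:z,0,-1:])" using z by (simp add: sp_def)
  then obtain w where w: "poly [:z,0,-1:] w = 0" "w \<in> sp h" using unit_ev[OF hc, of "[:z,0,-1:]"] by auto
  then obtain t where "w = complex_of_real t" using sp_real[OF h] by (metis Reals_cases)
  then have "z = complex_of_real (t * t)" using w by (simp add: algebra_simps)
  then show ?thesis by simp
qed

lemma spr_nonneg: "a \<in> positive A \<Longrightarrow> t \<in> spr a \<Longrightarrow> 0 \<le> t"
  using spec_eq by (fastforce simp: positive_def spr_def)

lemma square_pos: "h \<in> selfadj \<Longrightarrow> h \<otimes> h \<in> positive A"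
  unfolding positive_def using sp_square[of h] spec_eq[of "h \<otimes> h"] by (auto simp: selfadj_def)

lemma pos_selfadj: "a \<in> positive A \<Longrightarrow> a \<in> selfadj"
  by (auto simp: positive_def selfadj_def)

lemma pos_closed [intro]: "a \<in> positive A \<Longrightarrow> a \<in> carrier A"
  by (auto simp: positive_def)

lemma posI_spr:
  assumes a: "a \<in> selfadj" and "\<And>t. t \<in> spr a \<Longrightarrow> 0 \<le> t" shows "a \<in> positive A"
  using assms sp_real[OF a] spec_eq[of a] by (auto simp: positive_def selfadj_def spr_def elim!: Reals_cases)

text \<open>On the spectrum \<open>f\<close> is the square of a real continuous function, so its
  value is the square of a self-adjoint element.\<close>

lemma cf_pos:
  assumes a: "a \<in> selfadj" and f: "continuous_on UNIV f" and 0: "\<And>t. t \<in> spr a \<Longrightarrow> 0 \<le> f t"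
  shows "cf a f \<in> positive A"
proof -
  have c: "continuous_on UNIV (\<lambda>t. sqrt (max 0 (f t)))" using f by (intro continuous_intros)
  have "cf a f = cf a (\<lambda>t. sqrt (max 0 (f t)) * sqrt (max 0 (f t)))"
    using f 0 by (intro cf_cong a continuous_intros) auto
  then show ?thesis using cf_mult[OF a c c] square_pos[OF cf_selfadj[OF a c]] by simp
qed

lemma pos_sqrt:
  assumes a: "a \<in> positive A" obtains h where "h \<in> selfadj" "h \<in> positive A" "a = h \<otimes> h"
proof -
  have s: "a \<in> selfadj" using a by (rule pos_selfadj)
  have c: "continuous_on UNIV (\<lambda>t. sqrt (max 0 t))" by (intro continuous_intros)
  have "a = cf a (\<lambda>t. sqrt (max 0 t) * sqrt (max 0 t))"
    by (subst cf_id[OF s, symmetric], intro cf_cong s continuous_intros) (use spr_nonneg[OF a] in auto)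
  then show ?thesis using that[of "cf a (\<lambda>t. sqrt (max 0 t))"] cf_mult[OF s c c] cf_selfadj[OF s c] cf_pos[OF s c] by simp
qed

lemma sp_affine:
  assumes a: "a \<in> carrier A" and s: "s \<in> sp a" shows "r - s \<in> sp (r \<odot> \<one> \<ominus> a)"
proof -
  have "(r - s) \<odot> \<one> = r \<odot> \<one> \<ominus> s \<odot> \<one>" using sm_add_left[of \<one> r "-s"] by (simp add: diff_sm)
  moreover have "(u \<ominus> v) \<ominus> (u \<ominus> a) = (-1) \<odot> (v \<ominus> a)" if "u \<in> carrier A" "v \<in> carrier A" for u v
    using that a by (simp add: diff_sm sm_add_right a_ac add_cancels)
  ultimately have "(r - s) \<odot> \<one> \<ominus> (r \<odot> \<one> \<ominus> a) = (-1) \<odot> (s \<odot> \<one> \<ominus> a)" by simp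
  then show ?thesis using s a by (simp add: sp_def unit_sm_iff)
qed

text \<open>If \<open>s\<close> is spectral for \<open>c\<close>, then \<open>t - s\<close> is
  spectral for \<open>t - c\<close> and thus at most \<open>t\<close> in modulus. A norm condition,
  unlike one on spectra, passes to sums: this criterion and \<open>norm_pos_shift\<close> together
  give \<open>pos_add\<close>.\<close>

lemma posI_norm:
  assumes c: "c \<in> selfadj" and n: "cnorm A (complex_of_real t \<odot> \<one> \<ominus> c) \<le> t" shows "c \<in> positive A"
proof (rule posI_spr[OF c])
  fix s assume "s \<in> spr c"
  then have "complex_of_real (t - s) \<in> sp (complex_of_real t \<odot> \<one> \<ominus> c)"
    using sp_affine[of c "complex_of_real s" "complex_of_real t"] c by (auto simp: spr_def)
  then have "\<bar>t - s\<bar> \<le> cnorm A (complex_of_real t \<odot> \<one> \<ominus> c)"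
    using spr_bound[of "complex_of_real t \<odot> \<one> \<ominus> c" "t - s"] c by (auto simp: spr_def)
  then show "0 \<le> s" using n by linarith
qed

lemma norm_pos_shift:
  assumes a: "a \<in> positive A" shows "cnorm A (complex_of_real (cnorm A a) \<odot> \<one> \<ominus> a) \<le> cnorm A a"
proof -
  have s: "a \<in> selfadj" "a \<in> carrier A" using a by (auto dest: pos_selfadj)
  have "complex_of_real (cnorm A a) \<odot> \<one> \<ominus> a = cf a (\<lambda>t. cnorm A a - t)"
    using cf_diff[OF s(1), of "\<lambda>_. cnorm A a" "\<lambda>t. t"] cf_const[OF s(1)] cf_id[OF s(1)] by simp
  then show ?thesis using spr_bound[OF s(2)] spr_nonneg[OF a] s
    by (auto intro!: cf_norm_le continuous_intros)
qed

lemma pos_add: assumes a: "a \<in> positive A" and b: "b \<in> positive A" shows "a \<oplus> b \<in> positive A"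
proof (rule posI_norm)
  have c: "a \<in> carrier A" "b \<in> carrier A" using a b by auto
  let ?r = "complex_of_real (cnorm A a)" and ?s = "complex_of_real (cnorm A b)"
  have "complex_of_real (cnorm A a + cnorm A b) \<odot> \<one> \<ominus> (a \<oplus> b) = (?r \<odot> \<one> \<ominus> a) \<oplus> (?s \<odot> \<one> \<ominus> b)"
    using c by (simp add: sm_add_left diff_sm sm_add_right a_ac)
  then show "cnorm A (complex_of_real (cnorm A a + cnorm A b) \<odot> \<one> \<ominus> (a \<oplus> b)) \<le> cnorm A a + cnorm A b"
    using norm_add[of "?r \<odot> \<one> \<ominus> a" "?s \<odot> \<one> \<ominus> b"] norm_pos_shift[OF a] norm_pos_shift[OF b] c by simp
  show "a \<oplus> b \<in> selfadj" using a b by (intro selfadj_closed pos_selfadj)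
qed

lemma pos_scale: assumes a: "a \<in> positive A" and r: "0 \<le> r" shows "complex_of_real r \<odot> a \<in> positive A"
proof -
  obtain h where h: "h \<in> selfadj" "a = h \<otimes> h" using a by (rule pos_sqrt)
  have "complex_of_real r \<odot> a = (complex_of_real (sqrt r) \<odot> h) \<otimes> (complex_of_real (sqrt r) \<odot> h)"
    using h r by (simp add: selfadj_def flip: of_real_mult)
  then show ?thesis using square_pos[of "complex_of_real (sqrt r) \<odot> h"] h by (simp add: selfadj_closed)
qed

lemma norm_bound_pos:
  assumes s: "a \<in> selfadj" and r: "cnorm A a \<le> r"
  shows "complex_of_real r \<odot> \<one> \<ominus> a \<in> positive A" "complex_of_real r \<odot> \<one> \<oplus> a \<in> positive A"
proof -
  have c: "a \<in> carrier A" using s by auto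
  have b: "- r \<le> t \<and> t \<le> r" if "t \<in> spr a" for t using spr_bound[OF c that] r by linarith
  have "complex_of_real r \<odot> \<one> \<ominus> a = cf a (\<lambda>t. r - t)"
    using cf_diff[OF s, of "\<lambda>_. r" "\<lambda>t. t"] cf_const[OF s] cf_id[OF s] by simp
  then show "complex_of_real r \<odot> \<one> \<ominus> a \<in> positive A" using b by (auto intro!: cf_pos s continuous_intros)
  have "complex_of_real r \<odot> \<one> \<oplus> a = cf a (\<lambda>t. r + t)"
    using cf_add[OF s, of "\<lambda>_. r" "\<lambda>t. t"] cf_const[OF s] cf_id[OF s] by simp
  moreover have "0 \<le> r + t" if "t \<in> spr a" for t using b[OF that] by linarith
  ultimately show "complex_of_real r \<odot> \<one> \<oplus> a \<in> positive A" by (auto intro!: cf_pos s continuous_intros)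
qed

lemma norm_le_of_pos:
  assumes a: "a \<in> positive A" and r: "complex_of_real r \<odot> \<one> \<ominus> a \<in> positive A" and r0: "0 \<le> r"
  shows "cnorm A a \<le> r"
proof -
  have s: "a \<in> selfadj" "a \<in> carrier A" using a by (auto dest: pos_selfadj)
  have "\<bar>t\<bar> \<le> r" if t: "t \<in> spr a" for t
  proof -
    have "complex_of_real (r - t) \<in> sp (complex_of_real r \<odot> \<one> \<ominus> a)"
      using sp_affine[OF s(2), of "complex_of_real t" "complex_of_real r"] t by (simp add: spr_def)
    then have "0 \<le> r - t" by (intro spr_nonneg[OF r]) (simp add: spr_def)
    then show ?thesis using spr_nonneg[OF a t] by simp
  qed
  then have "cnorm A (cf a (\<lambda>t. t)) \<le> r" using r0 s by (intro cf_norm_le continuous_intros) auto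
  then show ?thesis using cf_id[OF s(1)] by simp
qed

text \<open>The order bound of \<open>b\<close> by the scalar \<open>\<parallel>b\<parallel>\<close>
  is inherited by \<open>a\<close>, and for positive elements order bounds by scalars are norm
  bounds.\<close>

lemma norm_mono:
  assumes a: "a \<in> positive A" and b: "b \<in> carrier A" and ab: "b \<ominus> a \<in> positive A" shows "cnorm A a \<le> cnorm A b"
proof (rule norm_le_of_pos[OF a])
  have c: "a \<in> carrier A" using a by auto
  have "b = (b \<ominus> a) \<oplus> a" using b c by (simp add: diff_add_cancel)
  then have "b \<in> positive A" using pos_add[OF ab a] by metis
  then have "complex_of_real (cnorm A b) \<odot> \<one> \<ominus> b \<in> positive A" by (intro norm_bound_pos pos_selfadj) auto
  from pos_add[OF this ab] show "complex_of_real (cnorm A b) \<odot> \<one> \<ominus> a \<in> positive A"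
    using b c by (simp add: diff_sm a_ac add_cancels)
qed (use b in simp)

lemma pos_antisym: assumes a: "a \<in> positive A" and b: "(-1) \<odot> a \<in> positive A" shows "a = \<zero>"
proof -
  have c: "a \<in> carrier A" using a by auto
  have "cnorm A a \<le> 0" using a b c by (intro norm_le_of_pos) (simp_all add: diff_sm)
  then show ?thesis using norm_eq_0[OF c] norm_ge_0[OF c] by simp
qed

text \<open>If \<open>v\<close> inverts \<open>z - xy\<close>, then \<open>(1 + yvx)/z\<close>
  inverts \<open>z - yx\<close>.\<close>

lemma sp_commute:
  assumes x: "x \<in> carrier A" and y: "y \<in> carrier A" and z: "z \<noteq> 0" and u: "unit (z \<odot> \<one> \<ominus> x \<otimes> y)"
  shows "unit (z \<odot> \<one> \<ominus> y \<otimes> x)"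
proof -
  obtain v where v: "v \<in> carrier A" "(z \<odot> \<one> \<ominus> x \<otimes> y) \<otimes> v = \<one>" "v \<otimes> (z \<odot> \<one> \<ominus> x \<otimes> y) = \<one>"
    using u by (auto simp: unit_def)
  note c = x y v(1)
  have v1: "z \<odot> v = \<one> \<oplus> x \<otimes> (y \<otimes> v)" and v2: "z \<odot> v = \<one> \<oplus> v \<otimes> (x \<otimes> y)"
    using v(2,3) c diff_add_cancel[of "z \<odot> v" "x \<otimes> (y \<otimes> v)"] diff_add_cancel[of "z \<odot> v" "v \<otimes> (x \<otimes> y)"]
    by (simp_all add: l_diff r_diff m_assoc)
  define w where "w = \<one> \<oplus> y \<otimes> (v \<otimes> x)"
  have w: "w \<in> carrier A" using c by (simp add: w_def)
  have "z \<odot> (y \<otimes> (v \<otimes> x)) = y \<otimes> ((z \<odot> v) \<otimes> x)" using c by simp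
  also have "\<dots> = y \<otimes> x \<oplus> y \<otimes> (x \<otimes> (y \<otimes> (v \<otimes> x)))" unfolding v1 using c by (simp add: l_distr r_distr m_assoc)
  finally have e1: "z \<odot> (y \<otimes> (v \<otimes> x)) = y \<otimes> x \<oplus> y \<otimes> (x \<otimes> (y \<otimes> (v \<otimes> x)))" .
  have "z \<odot> (y \<otimes> (v \<otimes> x)) = y \<otimes> ((z \<odot> v) \<otimes> x)" using c by simp
  also have "\<dots> = y \<otimes> x \<oplus> y \<otimes> (v \<otimes> (x \<otimes> (y \<otimes> x)))" unfolding v2 using c by (simp add: l_distr r_distr m_assoc)
  finally have e2: "z \<odot> (y \<otimes> (v \<otimes> x)) = y \<otimes> x \<oplus> y \<otimes> (v \<otimes> (x \<otimes> (y \<otimes> x)))" .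
  have "(z \<odot> \<one> \<ominus> y \<otimes> x) \<otimes> w = z \<odot> \<one>"
    using c e1 by (simp add: w_def l_diff r_distr sm_add_right m_assoc) (simp add: diff_sm sm_add_right a_ac add_cancels)
  moreover have "w \<otimes> (z \<odot> \<one> \<ominus> y \<otimes> x) = z \<odot> \<one>"
    using c e2 by (simp add: w_def r_diff l_distr sm_add_right m_assoc) (simp add: diff_sm sm_add_right a_ac add_cancels)
  ultimately show ?thesis unfolding unit_def using c w z
    by (intro conjI bexI[of _ "inverse z \<odot> w"]) auto
qed

text \<open>Kaplansky's argument. Let \<open>u\<close> be the negative part of
  \<open>c = x\<^sup>* x\<close> and \<open>y = xu\<close>. Then
  \<open>y\<^sup>* y = ucu = -u\<^sup>3\<close> is negative, hence so is \<open>y y\<^sup>*\<close>,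
  although their sum is positive. So \<open>y\<^sup>* y = 0\<close>, the negative part vanishes, and
  \<open>c\<close> is positive.\<close>

lemma star_pos:
  assumes x: "x \<in> carrier A" shows "star A x \<otimes> x \<in> positive A"
proof -
  define c where "c = star A x \<otimes> x"
  have c: "c \<in> selfadj" "c \<in> carrier A" using x selfadj_closed(5) by (auto simp: c_def)
  define k :: "real \<Rightarrow> real" where "k = (\<lambda>t. max 0 (- t))"
  have k: "continuous_on UNIV k" unfolding k_def by (intro continuous_intros)
  define u where "u = cf c k"
  have u: "u \<in> selfadj" "u \<in> carrier A" "star A u = u" using cf_selfadj[OF c(1) k] by (auto simp: u_def)
  define y where "y = x \<otimes> u"
  have y: "y \<in> carrier A" using x u by (simp add: y_def)
  define w where "w = cf c (\<lambda>t. k t * (k t * k t))"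
  have w: "w \<in> positive A" "w \<in> carrier A" unfolding w_def
    by (auto intro!: cf_pos c continuous_intros k simp: k_def)
  have yw: "star A y \<otimes> y = (-1) \<odot> w"
  proof -
    have "star A y \<otimes> y = u \<otimes> (c \<otimes> u)" using x u by (simp add: y_def c_def m_assoc)
    also have "\<dots> = cf c (\<lambda>t. k t * (t * k t))"
      unfolding u_def using cf_mult[OF c(1) k, of "\<lambda>t. t * k t"] cf_mult[OF c(1) _ k, of "\<lambda>t. t"] cf_id[OF c(1)] k
      by (simp add: continuous_on_mult continuous_on_id)
    also have "\<dots> = cf c (\<lambda>t. (-1) * (k t * (k t * k t)))"
      by (intro cf_cong c continuous_intros k) (simp add: k_def max_def)
    also have "\<dots> = (-1) \<odot> w"
      using cf_scale[OF c(1), of "\<lambda>t. k t * (k t * k t)" "-1"] k by (simp add: w_def continuous_on_mult)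
    finally show ?thesis .
  qed
  \<comment> \<open>By \<open>sp_commute\<close> exchanging the two factors does not change the
    non-zero spectrum.\<close>
  have yy: "(-1) \<odot> (y \<otimes> star A y) \<in> positive A"
  proof (rule posI_spr)
    show "(-1) \<odot> (y \<otimes> star A y) \<in> selfadj" using selfadj_closed(4)[OF selfadj_closed(6)[OF y], of "-1"] by simp
    fix t assume t: "t \<in> spr ((-1) \<odot> (y \<otimes> star A y))"
    have "t \<in> spr w" if "t \<noteq> 0"
    proof (rule ccontr)
      assume "t \<notin> spr w"
      moreover have "star A y \<otimes> ((-1) \<odot> y) = w" using y yw w by simp
      ultimately have "unit (complex_of_real t \<odot> \<one> \<ominus> star A y \<otimes> ((-1) \<odot> y))" by (simp add: spr_def sp_def)
      then have "unit (complex_of_real t \<odot> \<one> \<ominus> ((-1) \<odot> y) \<otimes> star A y)" 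
        using that y sp_commute[of "star A y" "(-1) \<odot> y" "complex_of_real t"] by simp
      then show False using t y by (simp add: spr_def sp_def)
    qed
    then show "0 \<le> t" using spr_nonneg[OF w(1)] by (cases "t = 0") auto
  qed
  define b d where "b = y \<otimes> star A y" and "d = star A y \<otimes> y"
  have bd: "b \<in> carrier A" "d \<in> carrier A" using y by (auto simp: b_def d_def)
  \<comment> \<open>\<open>P\<close> and \<open>\<i>Q\<close> are self-adjoint, up to sign twice the
    real and the imaginary part of \<open>y\<close>; the difference of the squares of
    \<open>P\<close> and \<open>Q\<close> is twice the sum \<open>b + d\<close>.\<close>
  define P Q where "P = y \<oplus> star A y" and "Q = y \<ominus> star A y"
  have P: "P \<otimes> P \<in> positive A" using y by (intro square_pos) (auto simp: P_def selfadj_def a_comm)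
  have Q: "(-1) \<odot> (Q \<otimes> Q) \<in> positive A"
  proof -
    have "\<i> \<odot> Q \<in> selfadj" using y by (simp add: Q_def selfadj_def diff_sm sm_add_right a_comm)
    from square_pos[OF this] show ?thesis using y by (simp add: Q_def)
  qed
  have "P \<otimes> P \<oplus> (-1) \<odot> (Q \<otimes> Q) = (b \<oplus> d) \<oplus> (b \<oplus> d)"
  proof -
    define e where "e = y \<otimes> y \<oplus> star A y \<otimes> star A y"
    have e: "e \<in> carrier A" using y by (simp add: e_def)
    have "P \<otimes> P = e \<oplus> (b \<oplus> d)" "Q \<otimes> Q = e \<ominus> (b \<oplus> d)"
      using y by (simp_all add: P_def Q_def e_def b_def d_def diff_sm l_distr r_distr sm_add_right a_ac)
    then show ?thesis using e bd by (simp add: diff_sm sm_add_right a_ac add_cancels)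
  qed
  then have "(b \<oplus> d) \<oplus> (b \<oplus> d) \<in> positive A" using pos_add[OF P Q] by simp
  from pos_add[OF this pos_add[OF yy yy]] have "d \<oplus> d \<in> positive A"
    using bd by (simp add: b_def[symmetric] a_ac add_cancels)
  moreover have "(-1) \<odot> (d \<oplus> d) \<in> positive A"
    using pos_add[OF w(1) w(1)] w by (simp add: d_def yw sm_add_right)
  ultimately have "d \<oplus> d = \<zero>" by (rule pos_antisym)
  then have "2 \<odot> d = \<zero>" using sm_add_left[of d 1 1] bd by simp
  then have "(1/2) \<odot> (2 \<odot> d) = \<zero>" by simp
  then have "d = \<zero>" using bd by (simp del: sm_zero)
  then have w0: "w = \<zero>" using yw w sm_sm[of w "-1" "-1"] by (simp add: d_def)
  \<comment> \<open>What vanishes so far is the cube of \<open>u\<close>. One more factor makes it a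
    fourth power, from which \<open>norm_sq\<close> descends to \<open>u\<close> in two
    steps.\<close>
  have "(u \<otimes> u) \<otimes> (u \<otimes> u) = u \<otimes> w"
  proof -
    have "cf c (\<lambda>t. k t * (k t * k t)) = u \<otimes> (u \<otimes> u)"
      unfolding u_def using cf_mult[OF c(1) k, of "\<lambda>t. k t * k t"] cf_mult[OF c(1) k k] k by (simp add: continuous_on_mult)
    then show ?thesis using u by (simp add: w_def m_assoc)
  qed
  then have "u \<otimes> u = \<zero>" using norm_sq[OF selfadj_closed(7)[OF u(1)]] u w0 norm_eq_0[of "u \<otimes> u"] by simp
  then have u0: "u = \<zero>" using norm_sq[OF u(1)] u norm_eq_0[of u] by simp
  have "cf c (\<lambda>t. t + k t) = c" using cf_add[OF c(1) _ k, of "\<lambda>t. t"] u0 c by (simp add: cf_id u_def)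
  moreover have "cf c (\<lambda>t. t + k t) \<in> positive A"
    by (intro cf_pos c continuous_intros k) (auto simp: k_def)
  ultimately show ?thesis by (simp add: c_def)
qed

lemma star_pos': "x \<in> carrier A \<Longrightarrow> x \<otimes> star A x \<in> positive A"
  using star_pos[of "star A x"] by simp

lemma conj_pos: assumes a: "a \<in> positive A" and x: "x \<in> carrier A" shows "star A x \<otimes> (a \<otimes> x) \<in> positive A"
proof -
  obtain h where h: "h \<in> selfadj" "a = h \<otimes> h" using a by (rule pos_sqrt)
  then have "star A x \<otimes> (a \<otimes> x) = star A (h \<otimes> x) \<otimes> (h \<otimes> x)" using x by (auto simp: selfadj_def m_assoc)
  then show ?thesis using star_pos[of "h \<otimes> x"] x h by (auto simp: selfadj_def)
qed

lemma conj_le: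
  assumes "b \<ominus> a \<in> positive A" "a \<in> carrier A" "b \<in> carrier A" "x \<in> carrier A"
  shows "star A x \<otimes> (b \<otimes> x) \<ominus> star A x \<otimes> (a \<otimes> x) \<in> positive A"
  using conj_pos[OF assms(1,4)] assms by (simp add: l_diff r_diff)

text \<open>Order implies Cuntz comparison. For \<open>x = s\<^sup>2\<close> and
  \<open>v = sW\<close> one gets \<open>v y v\<^sup>* = s E\<^sup>2 s\<close>, where
  \<open>E\<close> is the value at \<open>y\<close> of \<open>t/(t + \<delta>)\<close>. The defect
  \<open>F = 1 - E\<close> satisfies \<open>\<parallel>sF\<parallel>\<^sup>2 =
  \<parallel>FxF\<parallel> \<le> \<parallel>FyF\<parallel> \<le> \<delta>\<close>, so
  \<open>sE\<close> is close to \<open>s\<close>.\<close>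

lemma le_approx:
  assumes x: "x \<in> positive A" and y: "y \<in> positive A" and le: "y \<ominus> x \<in> positive A" and e: "0 < e"
  shows "\<exists>v\<in>carrier A. cnorm A (v \<otimes> y \<otimes> star A v \<ominus> x) < e"
proof -
  obtain s where s: "s \<in> selfadj" "x = s \<otimes> s" using x by (rule pos_sqrt)
  have Y: "y \<in> selfadj" "y \<in> carrier A" using y pos_selfadj by auto
  have sc: "s \<in> carrier A" "star A s = s" using s by auto
  \<comment> \<open>The final error is at most \<open>2\<eta>\<parallel>s\<parallel>\<close>. The
    added one keeps the denominator positive and makes the bound strict.\<close>
  define \<eta> where "\<eta> = e / (2 * cnorm A s + 1)"
  have \<eta>: "0 < \<eta>" using e sc by (simp add: \<eta>_def add_nonneg_pos)
  \<comment> \<open>A square, because \<open>\<delta>\<close> bounds the square of the norm of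
    \<open>sF\<close>.\<close>
  define \<delta> where "\<delta> = \<eta>\<^sup>2"
  have \<delta>: "0 < \<delta>" using \<eta> by (simp add: \<delta>_def)
  have nz: "max 0 t + \<delta> \<noteq> 0" for t :: real using \<delta> by (simp add: max_def)
  \<comment> \<open>On the spectrum of \<open>y\<close> the maximum is \<open>t\<close> and
    \<open>t fW(t)\<^sup>2 = fE(t)\<^sup>2\<close>; elsewhere it keeps the functions
    continuous.\<close>
  define fE fF fW where "fE = (\<lambda>t::real. max 0 t / (max 0 t + \<delta>))" and "fF = (\<lambda>t::real. \<delta> / (max 0 t + \<delta>))"
    and "fW = (\<lambda>t::real. sqrt (max 0 t) / (max 0 t + \<delta>))"
  have cE: "continuous_on UNIV fE" and cF: "continuous_on UNIV fF" and cW: "continuous_on UNIV fW"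
    unfolding fE_def fF_def fW_def using nz by (auto intro!: continuous_intros)
  define E F W where "E = cf y fE" and "F = cf y fF" and "W = cf y fW"
  note EFW = cf_selfadj[OF Y(1) cE, folded E_def] cf_selfadj[OF Y(1) cF, folded F_def] cf_selfadj[OF Y(1) cW, folded W_def]
  have c: "E \<in> carrier A" "F \<in> carrier A" "W \<in> carrier A" "star A E = E" "star A F = F" "star A W = W"
    using EFW by auto
  have WyW: "W \<otimes> (y \<otimes> W) = E \<otimes> E"
  proof -
    have "W \<otimes> (y \<otimes> W) = cf y (\<lambda>t. fW t * (t * fW t))"
      unfolding W_def using cf_mult[OF Y(1) cW, of "\<lambda>t. t * fW t"] cf_mult[OF Y(1) _ cW, of "\<lambda>t. t"] cf_id[OF Y(1)] cW
      by (simp add: continuous_on_mult continuous_on_id)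
    also have "\<dots> = cf y (\<lambda>t. fE t * fE t)"
      using spr_nonneg[OF y] by (intro cf_cong Y continuous_intros cW cE) (auto simp: fW_def fE_def)
    also have "\<dots> = E \<otimes> E" unfolding E_def by (rule cf_mult[OF Y(1) cE cE])
    finally show ?thesis .
  qed
  have FyF: "cnorm A (F \<otimes> (y \<otimes> F)) \<le> \<delta>"
  proof -
    have "F \<otimes> (y \<otimes> F) = cf y (\<lambda>t. fF t * (t * fF t))"
      unfolding F_def using cf_mult[OF Y(1) cF, of "\<lambda>t. t * fF t"] cf_mult[OF Y(1) _ cF, of "\<lambda>t. t"] cf_id[OF Y(1)] cF
      by (simp add: continuous_on_mult continuous_on_id)
    moreover have "cnorm A (cf y (\<lambda>t. fF t * (t * fF t))) \<le> \<delta>"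
    proof (intro cf_norm_le Y continuous_intros cF)
      fix t assume "t \<in> spr y"
      then have t: "0 \<le> t" by (rule spr_nonneg[OF y])
      have "t * \<delta> \<le> (t + \<delta>) * (t + \<delta>)" using t \<delta> by (intro mult_mono) auto
      then have "\<delta> * (t * \<delta>) \<le> \<delta> * ((t + \<delta>) * (t + \<delta>))" using \<delta> by (intro mult_left_mono) auto
      then show "\<bar>fF t * (t * fF t)\<bar> \<le> \<delta>" using t \<delta>
        by (simp add: fF_def abs_mult divide_le_eq mult.assoc mult.left_commute)
    qed (use \<delta> in simp)
    ultimately show ?thesis by simp
  qed
  have EF: "s \<otimes> E \<ominus> s = (-1) \<odot> (s \<otimes> F)"
  proof -
    have "cf y (\<lambda>t. fE t + fF t) = \<one>"
    proof -
      have "fE t + fF t = 1" for t using nz[of t] by (simp add: fE_def fF_def flip: add_divide_distrib)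
      then show ?thesis using cf_const[OF Y(1), of 1] by simp
    qed
    then have "E \<oplus> F = \<one>" using cf_add[OF Y(1) cE cF] by (simp add: E_def F_def)
    then have "s = s \<otimes> E \<oplus> s \<otimes> F" using sc c by (metis r_distr r_one)
    then have "s \<otimes> E \<ominus> s = s \<otimes> E \<ominus> (s \<otimes> E \<oplus> s \<otimes> F)" by simp
    then show ?thesis using sc c by (simp add: diff_sm sm_add_right)
  qed
  have "(cnorm A (s \<otimes> F))\<^sup>2 = cnorm A (F \<otimes> (x \<otimes> F))"
    using sc c by (simp add: s flip: cstar_id) (simp add: m_assoc)
  also have "\<dots> \<le> cnorm A (F \<otimes> (y \<otimes> F))"
    using conj_pos[OF x c(2)] conj_le[OF le _ Y(2) c(2)] c Y x by (intro norm_mono) auto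
  also have "\<dots> \<le> \<eta>\<^sup>2" using FyF by (simp add: \<delta>_def)
  finally have "cnorm A (s \<otimes> F) \<le> \<eta>" by (rule power2_le_imp_le) (use \<eta> in simp)
  then have d1: "cnorm A (s \<otimes> E \<ominus> s) \<le> \<eta>" using EF norm_sm[of "s \<otimes> F" "-1"] sc c by simp
  have "star A (s \<otimes> E \<ominus> s) = E \<otimes> s \<ominus> s" using sc c by simp
  then have d2: "cnorm A (E \<otimes> s \<ominus> s) \<le> \<eta>" using d1 norm_star[of "s \<otimes> E \<ominus> s"] sc c by simp
  have "cnorm A E \<le> 1" unfolding E_def using \<delta>
    by (intro cf_norm_le Y cE) (auto simp: fE_def abs_of_nonneg)
  then have Es: "cnorm A (E \<otimes> s) \<le> cnorm A s"
    using norm_mult[of E s] sc c mult_right_mono[of "cnorm A E" 1 "cnorm A s"] by simp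
  define v where "v = s \<otimes> W"
  have "v \<otimes> y \<otimes> star A v = s \<otimes> ((W \<otimes> (y \<otimes> W)) \<otimes> s)" using sc c Y by (simp add: v_def m_assoc)
  also have "\<dots> = (s \<otimes> E) \<otimes> (E \<otimes> s)" unfolding WyW using sc c by (simp add: m_assoc)
  finally have "cnorm A (v \<otimes> y \<otimes> star A v \<ominus> x) \<le> cnorm A (s \<otimes> E \<ominus> s) * cnorm A (E \<otimes> s) + cnorm A s * cnorm A (E \<otimes> s \<ominus> s)"
    unfolding s(2) using sc c norm_mult_diff[of "s \<otimes> E" s "E \<otimes> s" s] by simp
  also have "\<dots> \<le> \<eta> * cnorm A s + cnorm A s * \<eta>"
    using d1 d2 Es sc c \<eta> by (intro add_mono mult_mono) auto
  also have "\<dots> < e"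
  proof -
    have "\<eta> * (2 * cnorm A s + 1) = e" using sc norm_ge_0[of s] by (simp add: \<eta>_def add_nonneg_eq_0_iff)
    then have "\<eta> * cnorm A s + cnorm A s * \<eta> = e - \<eta>" by (simp add: algebra_simps)
    then show ?thesis using \<eta> by simp
  qed
  finally show ?thesis using sc c by (intro bexI[of _ v]) (auto simp: v_def)
qed

definition cutoff :: "'a \<Rightarrow> real \<Rightarrow> 'a" where "cutoff a \<epsilon> = cf a (\<lambda>t. max 0 (t - \<epsilon>))"

lemma cutoff_props:
  assumes a: "a \<in> positive A" and e: "0 < \<epsilon>"
  shows "cutoff a \<epsilon> \<in> positive A" "cnorm A (cutoff a \<epsilon> \<ominus> a) \<le> \<epsilon>"
proof -
  have s: "a \<in> selfadj" using a by (rule pos_selfadj)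
  show "cutoff a \<epsilon> \<in> positive A" unfolding cutoff_def by (intro cf_pos s continuous_intros) auto
  have "cnorm A (cf a (\<lambda>t. max 0 (t - \<epsilon>)) \<ominus> cf a (\<lambda>t. t)) \<le> \<epsilon>"
    using e spr_nonneg[OF a] by (intro cf_norm_diff_le s continuous_intros) (auto simp: max_def)
  then show "cnorm A (cutoff a \<epsilon> \<ominus> a) \<le> \<epsilon>" using cf_id[OF s] by (simp add: cutoff_def)
qed

text \<open>The cut-down at \<open>\<epsilon>\<close> is \<open>g(a - \<epsilon>')g\<close> for
  every smaller \<open>\<epsilon>'\<close>. In this form an inequality
  \<open>a \<le> d + \<epsilon>'\<close> can be compressed by \<open>g\<close>.\<close>

lemma cutoff_form:
  assumes a: "a \<in> positive A" and e: "0 < \<epsilon>'" "\<epsilon>' < \<epsilon>"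
  shows "\<exists>g\<in>selfadj. cutoff a \<epsilon> = g \<otimes> (a \<otimes> g) \<ominus> complex_of_real \<epsilon>' \<odot> (g \<otimes> g)"
proof -
  have s: "a \<in> selfadj" using a by (rule pos_selfadj)
  \<comment> \<open>The denominator is \<open>t - \<epsilon>'\<close> wherever the numerator is not
    zero; below \<open>\<epsilon>\<close> it is frozen at
    \<open>\<epsilon> - \<epsilon>' > 0\<close>, which keeps \<open>k\<close> continuous.\<close>
  define k where "k = (\<lambda>t. sqrt (max 0 (t - \<epsilon>) / (max t \<epsilon> - \<epsilon>')))"
  have nz: "max t \<epsilon> - \<epsilon>' > 0" for t using e by (simp add: max_def)
  then have nz': "max t \<epsilon> - \<epsilon>' \<noteq> 0" for t by (metis less_irrefl)
  have k: "continuous_on UNIV k" unfolding k_def using nz' by (intro continuous_intros) auto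
  have kk: "k t * k t = max 0 (t - \<epsilon>) / (max t \<epsilon> - \<epsilon>')" for t
    using nz[of t] by (simp add: k_def)
  have "max 0 (t - \<epsilon>) = (k t * k t) * (t - \<epsilon>')" for t
    using e unfolding kk by (cases "t \<le> \<epsilon>") (auto simp: max_def)
  then have "(\<lambda>t. max 0 (t - \<epsilon>)) = (\<lambda>t. k t * (t * k t) - \<epsilon>' * (k t * k t))"
    by (simp add: fun_eq_iff algebra_simps)
  then have "cutoff a \<epsilon> = cf a (\<lambda>t. k t * (t * k t) - \<epsilon>' * (k t * k t))" by (simp add: cutoff_def)
  also have "\<dots> = cf a k \<otimes> (a \<otimes> cf a k) \<ominus> complex_of_real \<epsilon>' \<odot> (cf a k \<otimes> cf a k)"
    using cf_diff[OF s, of "\<lambda>t. k t * (t * k t)" "\<lambda>t. \<epsilon>' * (k t * k t)"] cf_scale[OF s, of "\<lambda>t. k t * k t"]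
      cf_mult[OF s k, of "\<lambda>t. t * k t"] cf_mult[OF s _ k, of "\<lambda>t. t"] cf_id[OF s] cf_mult[OF s k k] k
    by (simp add: continuous_on_mult continuous_on_id continuous_on_const)
  finally show ?thesis using cf_selfadj[OF s k] by blast
qed

text \<open>Compressing \<open>a \<le> d + \<epsilon>\<close> by \<open>g\<close> gives
  \<open>c \<le> gdg\<close>, and \<open>le_approx\<close> turns this into approximants of the form
  \<open>(vg) d (vg)\<^sup>*\<close>. All comparisons of cut-downs below go through this
  lemma.\<close>

lemma cut_le_approx:
  assumes c: "c \<in> positive A" and g: "g \<in> selfadj" and a: "a \<in> selfadj" and d: "d \<in> positive A"
    and cg: "c = g \<otimes> (a \<otimes> g) \<ominus> complex_of_real \<epsilon> \<odot> (g \<otimes> g)"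
    and ad: "(d \<oplus> complex_of_real \<epsilon> \<odot> \<one>) \<ominus> a \<in> positive A" and e: "0 < e"
  shows "\<exists>v\<in>carrier A. cnorm A (v \<otimes> d \<otimes> star A v \<ominus> c) < e"
proof -
  have cl: "g \<in> carrier A" "star A g = g" "a \<in> carrier A" "d \<in> carrier A" using g a d by auto
  have "star A g \<otimes> (((d \<oplus> complex_of_real \<epsilon> \<odot> \<one>) \<ominus> a) \<otimes> g) \<in> positive A" using ad cl by (intro conj_pos) auto
  also have "star A g \<otimes> (((d \<oplus> complex_of_real \<epsilon> \<odot> \<one>) \<ominus> a) \<otimes> g) = g \<otimes> (d \<otimes> g) \<ominus> c"
    using cl by (simp add: cg diff_sm l_distr r_distr sm_add_right a_ac)
  finally have le: "g \<otimes> (d \<otimes> g) \<ominus> c \<in> positive A" .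
  have gdg: "g \<otimes> (d \<otimes> g) \<in> positive A" using conj_pos[OF d cl(1)] cl by simp
  obtain v where v: "v \<in> carrier A" "cnorm A (v \<otimes> (g \<otimes> (d \<otimes> g)) \<otimes> star A v \<ominus> c) < e"
    using le_approx[OF c gdg le e] by blast
  have "(v \<otimes> g) \<otimes> d \<otimes> star A (v \<otimes> g) = v \<otimes> (g \<otimes> (d \<otimes> g)) \<otimes> star A v" using v cl by (simp add: m_assoc)
  then show ?thesis using v cl by (intro bexI[of _ "v \<otimes> g"]) auto
qed

lemma norm_diff_pos:
  assumes a: "a \<in> selfadj" and d: "d \<in> selfadj" and n: "cnorm A (d \<ominus> a) \<le> r"
  shows "(d \<oplus> complex_of_real r \<odot> \<one>) \<ominus> a \<in> positive A"
proof -
  have "complex_of_real r \<odot> \<one> \<oplus> (d \<ominus> a) \<in> positive A" using assms by (intro norm_bound_pos selfadj_closed)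
  then show ?thesis using a d by (auto simp: selfadj_def diff_sm a_ac)
qed

text \<open>The shift by \<open>pCons 0\<close> appears because \<open>poly_eval\<close> evaluates
  \<open>t p(t)\<close>.\<close>

lemma poly_eval_ev:
  assumes a: "a \<in> carrier A" shows "poly_eval A p a = ev a (cpoly (pCons 0 p))"
proof -
  interpret G: abelian_monoid A by (rule add_monoid)
  have pc: "pow_Suc A a i \<in> carrier A" for i
    by (induction i) (use a in \<open>auto simp: pow_Suc_def\<close>)
  have ps: "pow_Suc A a (Suc i) = pow_Suc A a i \<otimes> a" for i by (simp add: pow_Suc_def)
  have fm: "finsum A (\<lambda>i. f i \<otimes> a) {..m} = finsum A f {..m} \<otimes> a" if "\<And>i. f i \<in> carrier A" for f :: "nat \<Rightarrow> 'a" and m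
    by (induction m) (use that a in \<open>simp_all add: l_distr Pi_def\<close>)
  \<comment> \<open>Any bound \<open>n\<close> on the degree is allowed, because the degree itself
    does not behave uniformly under \<open>pCons\<close>.\<close>
  have "finsum A (\<lambda>i. complex_of_real (Polynomial.coeff p i) \<odot> pow_Suc A a i) {..n} = ev a (cpoly (pCons 0 p))"
    if "Polynomial.degree p \<le> n" for n
    using that
  proof (induction p arbitrary: n)
    case 0 show ?case using pc a by (simp add: G.finsum_zero)
  next
    case (pCons c p)
    have e0: "c \<noteq> 0 \<or> p \<noteq> 0" using pCons by simp
    show ?case
    proof (cases n)
      case 0
      then have "p = 0" using pCons by (metis degree_pCons_eq le_zero_eq nat.distinct(1))
      then show ?thesis using 0 a pc[of 0] by (simp add: map_poly_pCons pow_Suc_def Pi_def)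
    next
      case (Suc m)
      have "Polynomial.degree p \<le> m" using pCons.prems Suc by (cases "p = 0") auto
      note IH = pCons.IH[OF this]
      have "finsum A (\<lambda>i. complex_of_real (Polynomial.coeff (pCons c p) i) \<odot> pow_Suc A a i) {..Suc m}
        = finsum A (\<lambda>i. complex_of_real (Polynomial.coeff p i) \<odot> pow_Suc A a (Suc i)) {..m} \<oplus> complex_of_real c \<odot> pow_Suc A a 0"
        using pc by (subst G.finsum_Suc2) (auto simp: Pi_def)
      also have "(\<lambda>i. complex_of_real (Polynomial.coeff p i) \<odot> pow_Suc A a (Suc i))
        = (\<lambda>i. (complex_of_real (Polynomial.coeff p i) \<odot> pow_Suc A a i) \<otimes> a)" using pc a by (simp add: ps fun_eq_iff)
      also have "finsum A \<dots> {..m} = ev a (cpoly (pCons 0 p)) \<otimes> a" using pc by (subst fm) (auto simp: IH)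
      also have "ev a (cpoly (pCons 0 p)) \<otimes> a = a \<otimes> ev a (cpoly (pCons 0 p))" using ev_commute_gen[OF a] by simp
      finally show ?thesis using a unfolding Suc
        by (simp add: map_poly_pCons pow_Suc_def r_distr a_ac)
    qed
  qed
  then show ?thesis unfolding poly_eval_def by blast
qed

end

section \<open>Matrix algebras\<close>

lemma cmod_cnj_mult: "cmod (cnj c * c) = (cmod c)\<^sup>2" "cmod (c * cnj c) = (cmod c)\<^sup>2"
  by (simp_all add: norm_mult power2_eq_square)

section \<open>Finite sums over initial segments\<close>

context unital_cstar
begin

text \<open>A fixed range of summation gives a recursion in \<open>n\<close>, which sums over
  supports lack; \<open>fs_supp\<close> connects the two.\<close>

definition fs :: "nat \<Rightarrow> (nat \<Rightarrow> 'a) \<Rightarrow> 'a" where "fs n f = finsum A f {..<n}"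

lemma fs_0 [simp]: "fs 0 f = \<zero>"
  using add_monoid by (simp add: fs_def abelian_monoid.finsum_empty)

lemma fs_Suc: "(\<And>i. f i \<in> carrier A) \<Longrightarrow> fs (Suc n) f = fs n f \<oplus> f n"
  using abelian_monoid.finsum_insert[OF add_monoid, of "{..<n}" n f] abelian_monoid.finsum_closed[OF add_monoid, of f "{..<n}"]
  by (simp add: fs_def lessThan_Suc Pi_def a_comm)

lemma fs_closed [simp, intro]: "(\<And>i. f i \<in> carrier A) \<Longrightarrow> fs n f \<in> carrier A"
  by (induction n) (simp_all add: fs_Suc)

lemma fs_zero: "(\<And>i. i < n \<Longrightarrow> f i = \<zero>) \<Longrightarrow> (\<And>i. f i \<in> carrier A) \<Longrightarrow> fs n f = \<zero>"
  by (induction n) (simp_all add: fs_Suc)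

lemma fs_add: "(\<And>i. f i \<in> carrier A) \<Longrightarrow> (\<And>i. g i \<in> carrier A) \<Longrightarrow> fs n (\<lambda>i. f i \<oplus> g i) = fs n f \<oplus> fs n g"
  by (induction n) (simp_all add: fs_Suc a_ac)

lemma fs_sm: "(\<And>i. f i \<in> carrier A) \<Longrightarrow> fs n (\<lambda>i. c \<odot> f i) = c \<odot> fs n f"
  by (induction n) (simp_all add: fs_Suc sm_add_right)

lemma fs_mult_left: "(\<And>i. f i \<in> carrier A) \<Longrightarrow> x \<in> carrier A \<Longrightarrow> fs n (\<lambda>i. x \<otimes> f i) = x \<otimes> fs n f"
  by (induction n) (simp_all add: fs_Suc r_distr)

lemma fs_mult_right: "(\<And>i. f i \<in> carrier A) \<Longrightarrow> x \<in> carrier A \<Longrightarrow> fs n (\<lambda>i. f i \<otimes> x) = fs n f \<otimes> x"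
  by (induction n) (simp_all add: fs_Suc l_distr)

lemma fs_star: "(\<And>i. f i \<in> carrier A) \<Longrightarrow> star A (fs n f) = fs n (\<lambda>i. star A (f i))"
  by (induction n) (simp_all add: fs_Suc)

lemma fs_swap: "(\<And>i j. f i j \<in> carrier A) \<Longrightarrow> fs n (\<lambda>i. fs m (f i)) = fs m (\<lambda>j. fs n (\<lambda>i. f i j))"
proof (induction n)
  case 0 show ?case by (simp add: fs_zero)
next
  case (Suc n) then show ?case by (simp add: fs_Suc fs_add)
qed

lemma fs_extend: "n \<le> N \<Longrightarrow> (\<And>i. n \<le> i \<Longrightarrow> f i = \<zero>) \<Longrightarrow> (\<And>i. f i \<in> carrier A) \<Longrightarrow> fs N f = fs n f"
  by (induction N) (auto simp: fs_Suc le_Suc_eq)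

lemma fs_single:
  assumes "k < n" "\<And>i. i \<noteq> k \<Longrightarrow> f i = \<zero>" "\<And>i. f i \<in> carrier A" shows "fs n f = f k"
  using assms(1)
proof (induction n)
  case (Suc n)
  show ?case
  proof (cases "k = n")
    case True then show ?thesis using fs_zero[of n f] assms by (simp add: fs_Suc)
  next
    case False then show ?thesis using Suc assms by (simp add: fs_Suc)
  qed
qed simp

lemma fs_norm: "(\<And>i. f i \<in> carrier A) \<Longrightarrow> cnorm A (fs n f) \<le> (\<Sum>i<n. cnorm A (f i))"
proof (induction n)
  case (Suc n) then show ?case using norm_add[of "fs n f" "f n"] by (simp add: fs_Suc)
qed simp

lemma fs_supp:
  assumes "S \<subseteq> {..<n}" "\<And>i. i \<notin> S \<Longrightarrow> f i = \<zero>" "\<And>i. f i \<in> carrier A" shows "finsum A f S = fs n f"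
proof -
  interpret G: abelian_monoid A by (rule add_monoid)
  show ?thesis unfolding fs_def
    by (rule G.add.finprod_mono_neutral_cong_left) (use assms in \<open>auto simp: Pi_def\<close>)
qed

lemma fs_pos: "(\<And>i. f i \<in> positive A) \<Longrightarrow> fs n f \<in> positive A"
proof (induction n)
  case 0
  then show ?case using square_pos[OF selfadj_closed(1)] by simp
next
  case (Suc n)
  then show ?case using pos_closed by (simp add: fs_Suc pos_add)
qed

lemma zero_pos: "\<zero> \<in> positive A"
  using square_pos[OF selfadj_closed(1)] by simp

lemma fs_pos_term: assumes f: "\<And>i. f i \<in> positive A" and k: "k < n" shows "fs n f \<ominus> f k \<in> positive A"
  using k
proof (induction n)
  case (Suc n)
  have c: "f i \<in> carrier A" for i using f pos_closed by blast
  show ?case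
  proof (cases "k = n")
    case True then show ?thesis using c fs_pos[OF f] by (simp add: fs_Suc add_diff_cancel)
  next
    case False
    then have "(fs n f \<ominus> f k) \<oplus> f n \<in> positive A" using Suc f by (intro pos_add) auto
    then show ?thesis using c by (simp add: fs_Suc diff_sm a_ac)
  qed
qed simp

section \<open>The Hilbert module of columns\<close>

definition col :: "nat \<Rightarrow> (nat \<Rightarrow> 'a) set" where
  "col n = {\<xi>. \<forall>i. \<xi> i \<in> carrier A \<and> (n \<le> i \<longrightarrow> \<xi> i = \<zero>)}"

lemma colD: "\<xi> \<in> col n \<Longrightarrow> \<xi> i \<in> carrier A" "\<xi> \<in> col n \<Longrightarrow> n \<le> i \<Longrightarrow> \<xi> i = \<zero>"
  by (auto simp: col_def)

lemmas col_carrier [simp] = colD(1)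

lemma col_columns: "\<xi> \<in> col n \<Longrightarrow> \<xi> \<in> columns A"
proof -
  assume x: "\<xi> \<in> col n"
  then have "{i. \<xi> i \<noteq> \<zero>} \<subseteq> {..<n}" by (auto simp: not_less[symmetric] dest: colD(2))
  then show ?thesis using x finite_subset by (auto simp: columns_def)
qed

lemma columns_col: "\<xi> \<in> columns A \<Longrightarrow> \<forall>\<^sub>F n in sequentially. \<xi> \<in> col n"
proof -
  assume x: "\<xi> \<in> columns A"
  then obtain N where "\<And>i. \<xi> i \<noteq> \<zero> \<Longrightarrow> i < N"
    using finite_nat_set_iff_bounded[of "{i. \<xi> i \<noteq> \<zero>}"] by (auto simp: columns_def)
  then have z: "\<xi> i = \<zero>" if "N \<le> i" for i using that by (meson leD)
  have "\<xi> \<in> col n" if n: "N \<le> n" for n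
  proof -
    have "\<xi> i \<in> carrier A" for i using x by (simp add: columns_def)
    moreover have "\<xi> i = \<zero>" if "n \<le> i" for i by (rule z) (rule order.trans[OF n that])
    ultimately show ?thesis unfolding col_def by blast
  qed
  then show ?thesis unfolding eventually_sequentially by blast
qed

text \<open>The \<open>A\<close>-valued inner product of the Hilbert module of columns, conjugate
  linear in the first argument.\<close>

definition cinner :: "nat \<Rightarrow> (nat \<Rightarrow> 'a) \<Rightarrow> (nat \<Rightarrow> 'a) \<Rightarrow> 'a" where
  "cinner n \<xi> \<eta> = fs n (\<lambda>i. star A (\<xi> i) \<otimes> \<eta> i)"

lemma cinner_closed [simp, intro]: "\<xi> \<in> col m \<Longrightarrow> \<eta> \<in> col m' \<Longrightarrow> cinner n \<xi> \<eta> \<in> carrier A"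
  by (simp add: cinner_def)

lemma col_norm_cinner: assumes "\<xi> \<in> col n" shows "col_norm A \<xi> = sqrt (cnorm A (cinner n \<xi> \<xi>))"
proof -
  have "{i. \<xi> i \<noteq> \<zero>} \<subseteq> {..<n}" using assms by (auto simp: not_less[symmetric] dest: colD(2))
  then have "finsum A (\<lambda>i. star A (\<xi> i) \<otimes> \<xi> i) {i. \<xi> i \<noteq> \<zero>} = cinner n \<xi> \<xi>"
    unfolding cinner_def using assms by (intro fs_supp) auto
  then show ?thesis by (simp add: col_norm_def)
qed

lemma cinner_pos: "\<xi> \<in> col m \<Longrightarrow> cinner n \<xi> \<xi> \<in> positive A"
  unfolding cinner_def by (intro fs_pos star_pos) simp

lemma col_norm_ge_0: "\<xi> \<in> col n \<Longrightarrow> 0 \<le> col_norm A \<xi>"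
  using col_norm_cinner[of \<xi> n] by simp

lemma col_norm_sq: "\<xi> \<in> col n \<Longrightarrow> (col_norm A \<xi>)\<^sup>2 = cnorm A (cinner n \<xi> \<xi>)"
  using col_norm_cinner[of \<xi> n] by simp

text \<open>The summand of index \<open>i\<close> is dominated by the whole sum of positive
  elements, and the norm is monotone.\<close>

lemma entry_le_col_norm: assumes "\<xi> \<in> col n" shows "cnorm A (\<xi> i) \<le> col_norm A \<xi>"
proof (cases "i < n")
  case True
  have "cnorm A (star A (\<xi> i) \<otimes> \<xi> i) \<le> cnorm A (cinner n \<xi> \<xi>)"
    using assms fs_pos_term[of "\<lambda>i. star A (\<xi> i) \<otimes> \<xi> i" i n] True
    by (intro norm_mono) (auto simp: cinner_def star_pos)
  then have "(cnorm A (\<xi> i))\<^sup>2 \<le> (col_norm A \<xi>)\<^sup>2" using assms by (simp add: cstar_id col_norm_sq)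
  then show ?thesis by (rule power2_le_imp_le) (rule col_norm_ge_0[OF assms])
next
  case False then show ?thesis using assms col_norm_ge_0[OF assms] colD(2)[OF assms, of i] by simp
qed

lemma col_norm_le_sum: assumes "\<xi> \<in> col n" shows "col_norm A \<xi> \<le> (\<Sum>i<n. cnorm A (\<xi> i))"
proof -
  have "(col_norm A \<xi>)\<^sup>2 \<le> (\<Sum>i<n. (cnorm A (\<xi> i))\<^sup>2)"
    using fs_norm[of "\<lambda>i. star A (\<xi> i) \<otimes> \<xi> i" n] assms by (simp add: col_norm_sq cinner_def cstar_id)
  then have "sqrt ((col_norm A \<xi>)\<^sup>2) \<le> L2_set (\<lambda>i. cnorm A (\<xi> i)) {..<n}"
    unfolding L2_set_def by (rule real_sqrt_le_mono)
  also have "\<dots> \<le> (\<Sum>i<n. cnorm A (\<xi> i))" using assms by (intro L2_set_le_sum) simp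
  finally show ?thesis using col_norm_ge_0[OF assms] by simp
qed

lemma colI: "(\<And>i. \<xi> i \<in> carrier A) \<Longrightarrow> (\<And>i. n \<le> i \<Longrightarrow> \<xi> i = \<zero>) \<Longrightarrow> \<xi> \<in> col n"
  unfolding col_def by blast

lemma col_closed:
  "\<xi> \<in> col n \<Longrightarrow> \<eta> \<in> col n \<Longrightarrow> (\<lambda>i. \<xi> i \<oplus> \<eta> i) \<in> col n"
  "\<xi> \<in> col n \<Longrightarrow> (\<lambda>i. c \<odot> \<xi> i) \<in> col n"
  "\<xi> \<in> col n \<Longrightarrow> x \<in> carrier A \<Longrightarrow> (\<lambda>i. \<xi> i \<otimes> x) \<in> col n"
  by (rule colI; simp add: colD(2)[of _ n])+

lemma cinner_add_left: "\<xi> \<in> col n \<Longrightarrow> \<eta> \<in> col n \<Longrightarrow> \<zeta> \<in> col n \<Longrightarrow> cinner n (\<lambda>i. \<xi> i \<oplus> \<eta> i) \<zeta> = cinner n \<xi> \<zeta> \<oplus> cinner n \<eta> \<zeta>"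
  and cinner_add_right: "\<xi> \<in> col n \<Longrightarrow> \<eta> \<in> col n \<Longrightarrow> \<zeta> \<in> col n \<Longrightarrow> cinner n \<zeta> (\<lambda>i. \<xi> i \<oplus> \<eta> i) = cinner n \<zeta> \<xi> \<oplus> cinner n \<zeta> \<eta>"
  and cinner_mult_left: "\<xi> \<in> col n \<Longrightarrow> \<eta> \<in> col n \<Longrightarrow> x \<in> carrier A \<Longrightarrow> cinner n (\<lambda>i. \<xi> i \<otimes> x) \<eta> = star A x \<otimes> cinner n \<xi> \<eta>"
  and cinner_mult_right: "\<xi> \<in> col n \<Longrightarrow> \<eta> \<in> col n \<Longrightarrow> x \<in> carrier A \<Longrightarrow> cinner n \<eta> (\<lambda>i. \<xi> i \<otimes> x) = cinner n \<eta> \<xi> \<otimes> x"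
  and cinner_sm_left: "\<xi> \<in> col n \<Longrightarrow> \<eta> \<in> col n \<Longrightarrow> cinner n (\<lambda>i. c \<odot> \<xi> i) \<eta> = cnj c \<odot> cinner n \<xi> \<eta>"
  and cinner_sm_right: "\<xi> \<in> col n \<Longrightarrow> \<eta> \<in> col n \<Longrightarrow> cinner n \<eta> (\<lambda>i. c \<odot> \<xi> i) = c \<odot> cinner n \<eta> \<xi>"
  and cinner_star: "\<xi> \<in> col n \<Longrightarrow> \<eta> \<in> col n \<Longrightarrow> star A (cinner n \<xi> \<eta>) = cinner n \<eta> \<xi>"
proof -
  show "\<xi> \<in> col n \<Longrightarrow> \<eta> \<in> col n \<Longrightarrow> \<zeta> \<in> col n \<Longrightarrow> cinner n (\<lambda>i. \<xi> i \<oplus> \<eta> i) \<zeta> = cinner n \<xi> \<zeta> \<oplus> cinner n \<eta> \<zeta>"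
    by (simp add: cinner_def l_distr fs_add)
  show "\<xi> \<in> col n \<Longrightarrow> \<eta> \<in> col n \<Longrightarrow> \<zeta> \<in> col n \<Longrightarrow> cinner n \<zeta> (\<lambda>i. \<xi> i \<oplus> \<eta> i) = cinner n \<zeta> \<xi> \<oplus> cinner n \<zeta> \<eta>"
    by (simp add: cinner_def r_distr fs_add)
  show "\<xi> \<in> col n \<Longrightarrow> \<eta> \<in> col n \<Longrightarrow> x \<in> carrier A \<Longrightarrow> cinner n (\<lambda>i. \<xi> i \<otimes> x) \<eta> = star A x \<otimes> cinner n \<xi> \<eta>"
    by (simp add: cinner_def m_assoc fs_mult_left)
  show "\<xi> \<in> col n \<Longrightarrow> \<eta> \<in> col n \<Longrightarrow> x \<in> carrier A \<Longrightarrow> cinner n \<eta> (\<lambda>i. \<xi> i \<otimes> x) = cinner n \<eta> \<xi> \<otimes> x"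
    by (simp add: cinner_def fs_mult_right flip: m_assoc)
  show "\<xi> \<in> col n \<Longrightarrow> \<eta> \<in> col n \<Longrightarrow> cinner n (\<lambda>i. c \<odot> \<xi> i) \<eta> = cnj c \<odot> cinner n \<xi> \<eta>"
    by (simp add: cinner_def fs_sm)
  show "\<xi> \<in> col n \<Longrightarrow> \<eta> \<in> col n \<Longrightarrow> cinner n \<eta> (\<lambda>i. c \<odot> \<xi> i) = c \<odot> cinner n \<eta> \<xi>"
    by (simp add: cinner_def fs_sm)
  show "\<xi> \<in> col n \<Longrightarrow> \<eta> \<in> col n \<Longrightarrow> star A (cinner n \<xi> \<eta>) = cinner n \<eta> \<xi>"
    by (simp add: cinner_def fs_star)
qed

text \<open>Expand \<open>\<langle>\<zeta>, \<zeta>\<rangle> \<ge> 0\<close> for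
  \<open>\<zeta> = \<xi>w/N - \<eta>\<close> with
  \<open>w = \<langle>\<xi>, \<eta>\<rangle>\<close>. As
  \<open>\<langle>\<xi>, \<xi>\<rangle> \<le> N\<close>, what remains is that
  \<open>w\<^sup>* w/N\<close> lies below \<open>\<langle>\<eta>, \<eta>\<rangle>\<close>. The
  strict inequality for \<open>N\<close> guarantees a non-zero divisor.\<close>

lemma cauchy_schwarz_aux:
  assumes x: "\<xi> \<in> col n" and y: "\<eta> \<in> col n" and N: "cnorm A (cinner n \<xi> \<xi>) < N"
  shows "(cnorm A (cinner n \<xi> \<eta>))\<^sup>2 \<le> N * cnorm A (cinner n \<eta> \<eta>)"
proof -
  define p w q where "p = cinner n \<xi> \<xi>" and "w = cinner n \<xi> \<eta>" and "q = cinner n \<eta> \<eta>"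
  have c: "p \<in> carrier A" "w \<in> carrier A" "q \<in> carrier A" using x y by (auto simp: p_def w_def q_def)
  have N0: "0 < N" using N norm_ge_0[OF c(1)] unfolding p_def by linarith
  define r where "r = complex_of_real (1 / N)"
  have rr: "cnj r = r" by (simp add: r_def)
  define W \<alpha> \<beta> where "W = r \<odot> w" and "\<alpha> = (\<lambda>i. \<xi> i \<otimes> W)" and "\<beta> = (\<lambda>i. (-1) \<odot> \<eta> i)"
  have W: "W \<in> carrier A" "star A W = r \<odot> star A w" using c by (simp_all add: W_def r_def)
  have ab: "\<alpha> \<in> col n" "\<beta> \<in> col n" unfolding \<alpha>_def \<beta>_def using x y W by (intro col_closed; auto)+
  define \<zeta> where "\<zeta> = (\<lambda>i. \<alpha> i \<oplus> \<beta> i)"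
  have z: "\<zeta> \<in> col n" unfolding \<zeta>_def using ab by (intro col_closed)
  define t where "t = star A w \<otimes> w"
  have t: "t \<in> carrier A" using c by (simp add: t_def)
  have sw: "cinner n \<eta> \<xi> = star A w" using cinner_star[OF x y] by (simp add: w_def)
  have "cinner n \<alpha> \<alpha> = star A W \<otimes> (p \<otimes> W)"
    using cinner_mult_left[OF x ab(1) W(1)] cinner_mult_right[OF x x W(1)] by (simp add: \<alpha>_def p_def)
  moreover have "cinner n \<alpha> \<beta> = (-1) \<odot> (star A W \<otimes> w)"
    using cinner_mult_left[OF x ab(2) W(1)] cinner_sm_right[OF y x, of "-1"] c W(1) by (simp add: \<alpha>_def \<beta>_def w_def)
  moreover have "cinner n \<beta> \<alpha> = (-1) \<odot> (star A w \<otimes> W)"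
    using cinner_mult_right[OF x ab(2) W(1)] cinner_sm_left[OF y x, of "-1"] c W(1) by (simp add: \<alpha>_def \<beta>_def sw)
  moreover have "cinner n \<beta> \<beta> = q"
    using cinner_sm_left[OF y ab(2), of "-1"] cinner_sm_right[OF y y, of "-1"] c by (simp add: \<beta>_def q_def)
  moreover have "cinner n \<zeta> \<zeta> = (cinner n \<alpha> \<alpha> \<oplus> cinner n \<alpha> \<beta>) \<oplus> (cinner n \<beta> \<alpha> \<oplus> cinner n \<beta> \<beta>)"
    unfolding \<zeta>_def using cinner_add_left[OF ab z] cinner_add_right[OF ab ab(1)] cinner_add_right[OF ab ab(2)]
    by (simp add: \<zeta>_def)
  ultimately have "cinner n \<zeta> \<zeta> = ((r * r) \<odot> (star A w \<otimes> (p \<otimes> w)) \<oplus> (-r) \<odot> t) \<oplus> ((-r) \<odot> t \<oplus> q)"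
    using c rr by (simp add: W(2) W_def t_def)
  then have P1: "((r * r) \<odot> (star A w \<otimes> (p \<otimes> w)) \<oplus> (-r) \<odot> t) \<oplus> ((-r) \<odot> t \<oplus> q) \<in> positive A"
    using cinner_pos[OF z, of n] by simp
  \<comment> \<open>The inequality \<open>p \<le> N\<close>, compressed by \<open>w\<close>,
    replaces the quadratic term containing \<open>p\<close> by a multiple of
    \<open>t\<close>.\<close>
  have "p \<in> selfadj" using cinner_pos[OF x, of n] pos_selfadj by (simp add: p_def)
  then have "complex_of_real N \<odot> \<one> \<ominus> p \<in> positive A" by (rule norm_bound_pos) (use N p_def in simp)
  then have "complex_of_real (1 / N * (1 / N)) \<odot> (star A w \<otimes> ((complex_of_real N \<odot> \<one> \<ominus> p) \<otimes> w)) \<in> positive A"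
    by (rule pos_scale[OF conj_pos]) (use c N0 in auto)
  moreover have "complex_of_real (1 / N * (1 / N)) \<odot> (star A w \<otimes> ((complex_of_real N \<odot> \<one> \<ominus> p) \<otimes> w))
      = r \<odot> t \<ominus> (r * r) \<odot> (star A w \<otimes> (p \<otimes> w))"
    using c N0 by (simp add: l_diff r_diff sm_diff_right r_def t_def)
  ultimately have P2: "r \<odot> t \<ominus> (r * r) \<odot> (star A w \<otimes> (p \<otimes> w)) \<in> positive A" by simp
  define u where "u = (r * r) \<odot> (star A w \<otimes> (p \<otimes> w))"
  define s where "s = r \<odot> t"
  have us: "u \<in> carrier A" "s \<in> carrier A" "(-r) \<odot> t = (-1) \<odot> s" using c t by (auto simp: u_def s_def)
  have "(s \<ominus> u) \<oplus> ((u \<oplus> (-1) \<odot> s) \<oplus> ((-1) \<odot> s \<oplus> q)) \<in> positive A"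
    using pos_add[OF P2 P1] us by (simp add: u_def s_def)
  then have "q \<ominus> s \<in> positive A" using us c by (simp add: diff_sm sm_add_right a_ac add_cancels)
  moreover have "s \<in> positive A" unfolding s_def r_def t_def using N0 c by (intro pos_scale star_pos) auto
  ultimately have "cnorm A s \<le> cnorm A q" using c by (intro norm_mono)
  moreover have "cnorm A s = (1 / N) * (cnorm A w)\<^sup>2" using c N0 by (simp add: s_def r_def t_def norm_sm cstar_id norm_divide)
  ultimately show ?thesis using N0 by (simp add: w_def q_def field_simps)
qed

lemma cauchy_schwarz:
  assumes x: "\<xi> \<in> col n" and y: "\<eta> \<in> col n"
  shows "cnorm A (cinner n \<xi> \<eta>) \<le> col_norm A \<xi> * col_norm A \<eta>"
proof -
  let ?p = "cnorm A (cinner n \<xi> \<xi>)" and ?q = "cnorm A (cinner n \<eta> \<eta>)" and ?w = "cnorm A (cinner n \<xi> \<eta>)"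
  have q: "0 \<le> ?q" using y by simp
  have "?w\<^sup>2 \<le> ?p * ?q"
  proof (rule field_le_epsilon)
    fix e :: real assume e: "0 < e"
    \<comment> \<open>The slack in place of \<open>N\<close> is scaled such that its product with
      \<open>?q\<close> stays below \<open>e\<close>.\<close>
    have "?w\<^sup>2 \<le> (?p + e / (?q + 1)) * ?q" using e q by (intro cauchy_schwarz_aux x y) simp
    also have "\<dots> = ?p * ?q + e * (?q / (?q + 1))" by (simp add: algebra_simps)
    also have "e * (?q / (?q + 1)) \<le> e * 1" using e q by (intro mult_left_mono) auto
    finally show "?w\<^sup>2 \<le> ?p * ?q + e" by simp
  qed
  then have "?w\<^sup>2 \<le> (col_norm A \<xi> * col_norm A \<eta>)\<^sup>2" using x y by (simp add: power_mult_distrib col_norm_sq)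
  then show ?thesis by (rule power2_le_imp_le) (use col_norm_ge_0 x y in auto)
qed

lemma col_norm_triangle:
  assumes x: "\<xi> \<in> col n" and y: "\<eta> \<in> col n"
  shows "col_norm A (\<lambda>i. \<xi> i \<oplus> \<eta> i) \<le> col_norm A \<xi> + col_norm A \<eta>"
proof (rule power2_le_imp_le)
  let ?p = "cinner n \<xi> \<xi>" and ?q = "cinner n \<eta> \<eta>" and ?w = "cinner n \<xi> \<eta>" and ?v = "cinner n \<eta> \<xi>"
  have "(col_norm A (\<lambda>i. \<xi> i \<oplus> \<eta> i))\<^sup>2 = cnorm A ((?p \<oplus> ?w) \<oplus> (?v \<oplus> ?q))"
    using cinner_add_left[OF x y col_closed(1)[OF x y]] cinner_add_right[OF x y x] cinner_add_right[OF x y y]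
    by (simp only: col_norm_sq[OF col_closed(1)[OF x y]])
  also have "\<dots> \<le> (cnorm A ?p + cnorm A ?w) + (cnorm A ?v + cnorm A ?q)"
    using norm_add[of "?p \<oplus> ?w" "?v \<oplus> ?q"] norm_add[of ?p ?w] norm_add[of ?v ?q] x y by simp
  also have "\<dots> \<le> (col_norm A \<xi> + col_norm A \<eta>)\<^sup>2"
  proof -
    have "cnorm A ?w \<le> col_norm A \<xi> * col_norm A \<eta>" "cnorm A ?v \<le> col_norm A \<xi> * col_norm A \<eta>"
      using cauchy_schwarz[OF x y] cauchy_schwarz[OF y x] by (simp_all add: mult.commute)
    then show ?thesis unfolding power2_sum col_norm_sq[OF x] col_norm_sq[OF y] by linarith
  qed
  finally show "(col_norm A (\<lambda>i. \<xi> i \<oplus> \<eta> i))\<^sup>2 \<le> (col_norm A \<xi> + col_norm A \<eta>)\<^sup>2" .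
qed (use col_norm_ge_0 x y in auto)

lemma col_norm_sm: assumes x: "\<xi> \<in> col n" shows "col_norm A (\<lambda>i. c \<odot> \<xi> i) = cmod c * col_norm A \<xi>"
proof -
  have cx: "(\<lambda>i. c \<odot> \<xi> i) \<in> col n" using x by (rule col_closed)
  have "cinner n (\<lambda>i. c \<odot> \<xi> i) (\<lambda>i. c \<odot> \<xi> i) = (cnj c * c) \<odot> cinner n \<xi> \<xi>"
    using cinner_sm_left[OF x cx] cinner_sm_right[OF x x] x by simp
  then have "(col_norm A (\<lambda>i. c \<odot> \<xi> i))\<^sup>2 = (cmod c * col_norm A \<xi>)\<^sup>2"
    using x by (simp add: col_norm_sq[OF cx] col_norm_sq[OF x] norm_sm cmod_cnj_mult power_mult_distrib)
  then show ?thesis using col_norm_ge_0[OF cx] col_norm_ge_0[OF x] by (simp add: power2_eq_iff_nonneg)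
qed

lemma col_norm_eq_0: assumes x: "\<xi> \<in> col n" and 0: "col_norm A \<xi> = 0" shows "\<xi> i = \<zero>"
proof -
  have c: "\<xi> i \<in> carrier A" using x by simp
  have "cnorm A (\<xi> i) = 0" using entry_le_col_norm[OF x, of i] norm_ge_0[OF c] unfolding 0 by linarith
  then show ?thesis using norm_eq_0[OF c] by blast
qed

end

lemma M_inf_simps:
  "carrier (M_inf A) = (\<Union>n. mat_carrier n A)"
  "x \<otimes>\<^bsub>M_inf A\<^esub> y = (\<lambda>i j. mat_vec A x (\<lambda>k. y k j) i)"
  "x \<oplus>\<^bsub>M_inf A\<^esub> y = (\<lambda>i j. x i j \<oplus>\<^bsub>A\<^esub> y i j)"
  "\<zero>\<^bsub>M_inf A\<^esub> = (\<lambda>i j. \<zero>\<^bsub>A\<^esub>)"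
  "c \<odot>\<^bsub>M_inf A\<^esub> x = (\<lambda>i j. c \<odot>\<^bsub>A\<^esub> x i j)"
  "star (M_inf A) x = (\<lambda>i j. star A (x j i))"
  "cnorm (M_inf A) = mat_norm A"
  by (simp_all add: M_inf_def)

section \<open>Matrices acting on columns, and their operator norm\<close>

context unital_cstar
begin

lemma mcI: "(\<And>i j. x i j \<in> carrier A) \<Longrightarrow> (\<And>i j. n \<le> i \<or> n \<le> j \<Longrightarrow> x i j = \<zero>) \<Longrightarrow> x \<in> mat_carrier n A"
  unfolding mat_carrier_def by blast

lemma mcD: "x \<in> mat_carrier n A \<Longrightarrow> x i j \<in> carrier A" "x \<in> mat_carrier n A \<Longrightarrow> n \<le> i \<Longrightarrow> x i j = \<zero>"
  "x \<in> mat_carrier n A \<Longrightarrow> n \<le> j \<Longrightarrow> x i j = \<zero>"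
  unfolding mat_carrier_def by blast+

lemmas mc_carrier [simp] = mcD(1)

lemma mc_mono: "x \<in> mat_carrier n A \<Longrightarrow> n \<le> N \<Longrightarrow> x \<in> mat_carrier N A"
  unfolding mat_carrier_def by (auto intro: order.trans)

lemma mc_event: "x \<in> mat_carrier n A \<Longrightarrow> \<forall>\<^sub>F N in sequentially. x \<in> mat_carrier N A"
  unfolding eventually_sequentially using mc_mono by blast

lemma mc_zero: "(\<lambda>i j. \<zero>) \<in> mat_carrier n A"
  by (rule mcI) auto

lemma mc_add: "x \<in> mat_carrier n A \<Longrightarrow> y \<in> mat_carrier n A \<Longrightarrow> (\<lambda>i j. x i j \<oplus> y i j) \<in> mat_carrier n A"
  by (rule mcI) (auto simp: mcD(2,3)[of _ n])

lemma mc_sm: "x \<in> mat_carrier n A \<Longrightarrow> (\<lambda>i j. c \<odot> x i j) \<in> mat_carrier n A"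
  by (rule mcI) (auto simp: mcD(2,3)[of _ n])

lemma mc_star: "x \<in> mat_carrier n A \<Longrightarrow> (\<lambda>i j. star A (x j i)) \<in> mat_carrier n A"
  by (rule mcI) (auto simp: mcD(2,3)[of _ n])

lemma mc_row_col: "x \<in> mat_carrier n A \<Longrightarrow> (\<lambda>k. x k j) \<in> col n"
  by (rule colI) (auto simp: mcD(2)[of _ n])

text \<open>The size of the summation is a parameter: whenever it covers the matrix and the column,
  the result is that of \<open>mat_vec\<close>, so different sizes can be compared.\<close>

definition mv :: "nat \<Rightarrow> 'a inf_mat \<Rightarrow> (nat \<Rightarrow> 'a) \<Rightarrow> nat \<Rightarrow> 'a" where
  "mv n x \<xi> = (\<lambda>i. fs n (\<lambda>k. x i k \<otimes> \<xi> k))"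

definition mm :: "nat \<Rightarrow> 'a inf_mat \<Rightarrow> 'a inf_mat \<Rightarrow> 'a inf_mat" where
  "mm n x y = (\<lambda>i j. fs n (\<lambda>k. x i k \<otimes> y k j))"

lemma mv_col: "x \<in> mat_carrier n A \<Longrightarrow> \<xi> \<in> col m \<Longrightarrow> mv N x \<xi> \<in> col n"
  unfolding mv_def by (rule colI) (auto simp: mcD(2)[of _ n] intro!: fs_zero)

lemma mm_mc: "x \<in> mat_carrier n A \<Longrightarrow> y \<in> mat_carrier n A \<Longrightarrow> mm n x y \<in> mat_carrier n A"
  unfolding mm_def by (rule mcI) (auto simp: mcD(2,3)[of _ n] intro!: fs_zero)

lemma mat_vec_mv:
  assumes x: "x \<in> mat_carrier n A" and k: "\<xi> \<in> col n" shows "mat_vec A x \<xi> = mv n x \<xi>"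
proof
  fix i
  have s: "{k. \<xi> k \<noteq> \<zero>} \<subseteq> {..<n}" using k by (auto simp: not_less[symmetric] dest: colD(2))
  show "mat_vec A x \<xi> i = mv n x \<xi> i"
    unfolding mat_vec_def mv_def by (rule fs_supp[OF s]) (use x k in auto)
qed

lemma mult_mm: "x \<in> mat_carrier n A \<Longrightarrow> y \<in> mat_carrier n A \<Longrightarrow> x \<otimes>\<^bsub>M_inf A\<^esub> y = mm n x y"
  using mat_vec_mv[of x n "\<lambda>k. y k _"] mc_row_col[of y n] by (simp add: mm_def mv_def M_inf_simps)

lemma mm_assoc:
  assumes x: "x \<in> mat_carrier n A" and y: "y \<in> mat_carrier n A" and z: "z \<in> mat_carrier n A"
  shows "mm n (mm n x y) z = mm n x (mm n y z)"
proof (intro ext)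
  fix i j
  have "mm n (mm n x y) z i j = fs n (\<lambda>k. fs n (\<lambda>l. (x i l \<otimes> y l k) \<otimes> z k j))"
    using x y z by (simp add: mm_def fs_mult_right)
  also have "\<dots> = fs n (\<lambda>l. fs n (\<lambda>k. (x i l \<otimes> y l k) \<otimes> z k j))" by (rule fs_swap) (use x y z in auto)
  also have "\<dots> = mm n x (mm n y z) i j"
    using x y z by (simp add: mm_def fs_mult_left m_assoc)
  finally show "mm n (mm n x y) z i j = mm n x (mm n y z) i j" .
qed

lemma mv_mm:
  assumes x: "x \<in> mat_carrier n A" and y: "y \<in> mat_carrier n A" and z: "\<xi> \<in> col n"
  shows "mv n (mm n x y) \<xi> = mv n x (mv n y \<xi>)"
proof
  fix i
  have "mv n (mm n x y) \<xi> i = fs n (\<lambda>k. fs n (\<lambda>l. (x i l \<otimes> y l k) \<otimes> \<xi> k))"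
    using x y z by (simp add: mm_def mv_def fs_mult_right)
  also have "\<dots> = fs n (\<lambda>l. fs n (\<lambda>k. (x i l \<otimes> y l k) \<otimes> \<xi> k))" by (rule fs_swap) (use x y z in auto)
  also have "\<dots> = mv n x (mv n y \<xi>) i"
    using x y z by (simp add: mv_def fs_mult_left m_assoc)
  finally show "mv n (mm n x y) \<xi> i = mv n x (mv n y \<xi>) i" .
qed

lemma cinner_adjoint:
  assumes x: "x \<in> mat_carrier n A" and k: "\<xi> \<in> col n" and e: "\<eta> \<in> col n"
  shows "cinner n (mv n x \<xi>) \<eta> = cinner n \<xi> (mv n (\<lambda>i j. star A (x j i)) \<eta>)"
proof -
  have "cinner n (mv n x \<xi>) \<eta> = fs n (\<lambda>i. fs n (\<lambda>k. (star A (\<xi> k) \<otimes> star A (x i k)) \<otimes> \<eta> i))"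
    using x k e by (simp add: cinner_def mv_def fs_star fs_mult_right)
  also have "\<dots> = fs n (\<lambda>k. fs n (\<lambda>i. (star A (\<xi> k) \<otimes> star A (x i k)) \<otimes> \<eta> i))" by (rule fs_swap) (use x k e in auto)
  also have "\<dots> = cinner n \<xi> (mv n (\<lambda>i j. star A (x j i)) \<eta>)"
    using x k e by (simp add: cinner_def mv_def fs_mult_left m_assoc)
  finally show ?thesis .
qed

text \<open>A crude bound with two uses: the supremum defining \<open>mat_norm\<close> is finite,
  and convergence of entries implies convergence of matrices.\<close>

lemma col_norm_mv_bound:
  assumes x: "x \<in> mat_carrier n A" and k: "\<xi> \<in> col N"
  shows "col_norm A (mv N x \<xi>) \<le> (\<Sum>i<n. \<Sum>k<n. cnorm A (x i k)) * col_norm A \<xi>"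
proof -
  have "col_norm A (mv N x \<xi>) \<le> (\<Sum>i<n. cnorm A (mv N x \<xi> i))" by (rule col_norm_le_sum[OF mv_col[OF x k]])
  also have "\<dots> \<le> (\<Sum>i<n. \<Sum>k<n. cnorm A (x i k) * col_norm A \<xi>)"
  proof (rule sum_mono)
    fix i
    \<comment> \<open>Neither of \<open>n\<close> and \<open>N\<close> need be the larger one, so
      the sum is first extended to the maximum and then cut back to \<open>n\<close>.\<close>
    have "fs N (\<lambda>k. x i k \<otimes> \<xi> k) = fs (max n N) (\<lambda>k. x i k \<otimes> \<xi> k)"
      by (rule fs_extend[symmetric]) (use x k colD(2)[OF k] in auto)
    also have "\<dots> = fs n (\<lambda>k. x i k \<otimes> \<xi> k)"
      by (rule fs_extend) (use x k mcD(3)[OF x] in auto)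
    finally have "cnorm A (mv N x \<xi> i) \<le> (\<Sum>k<n. cnorm A (x i k \<otimes> \<xi> k))"
      using fs_norm[of "\<lambda>k. x i k \<otimes> \<xi> k" n] x k by (simp add: mv_def)
    also have "\<dots> \<le> (\<Sum>k<n. cnorm A (x i k) * col_norm A \<xi>)"
    proof (rule sum_mono)
      fix l
      have "cnorm A (x i l \<otimes> \<xi> l) \<le> cnorm A (x i l) * cnorm A (\<xi> l)" using x k by (simp add: norm_mult)
      also have "\<dots> \<le> cnorm A (x i l) * col_norm A \<xi>" using x entry_le_col_norm[OF k] by (intro mult_left_mono) auto
      finally show "cnorm A (x i l \<otimes> \<xi> l) \<le> cnorm A (x i l) * col_norm A \<xi>" .
    qed
    finally show "cnorm A (mv N x \<xi> i) \<le> (\<Sum>k<n. cnorm A (x i k) * col_norm A \<xi>)" .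
  qed
  finally show ?thesis by (simp add: sum_distrib_right)
qed

definition unit_cols :: "(nat \<Rightarrow> 'a) set" where "unit_cols = {\<xi> \<in> columns A. col_norm A \<xi> \<le> 1}"

lemma zero_col: "(\<lambda>i. \<zero>) \<in> col n" "col_norm A (\<lambda>i. \<zero>) = 0"
proof -
  show z: "(\<lambda>i. \<zero>) \<in> col n" for n by (rule colI) auto
  show "col_norm A (\<lambda>i. \<zero>) = 0" by (subst col_norm_cinner[OF z[of 0]]) (simp add: cinner_def)
qed

lemma mv_cases:
  assumes "x \<in> mat_carrier n A" "\<xi> \<in> columns A"
  obtains N where "n \<le> N" "\<xi> \<in> col N" "x \<in> mat_carrier N A" "mat_vec A x \<xi> = mv N x \<xi>"
proof -
  have "\<forall>\<^sub>F N in sequentially. \<xi> \<in> col N \<and> n \<le> N"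
    by (intro eventually_conj columns_col assms eventually_ge_at_top)
  from eventually_happens'[OF sequentially_bot this] obtain N where N: "\<xi> \<in> col N" "n \<le> N" by blast
  note x = mc_mono[OF assms(1) N(2)]
  show ?thesis by (rule that[OF N(2,1) x mat_vec_mv[OF x N(1)]])
qed

lemma mat_norm_bdd: assumes x: "x \<in> mat_carrier n A"
  shows "bdd_above ((\<lambda>\<xi>. col_norm A (mat_vec A x \<xi>)) ` unit_cols)"
proof (rule bdd_aboveI2)
  fix \<xi> assume "\<xi> \<in> unit_cols"
  then have k: "\<xi> \<in> columns A" "col_norm A \<xi> \<le> 1" by (auto simp: unit_cols_def)
  obtain N where N: "n \<le> N" "\<xi> \<in> col N" "x \<in> mat_carrier N A" "mat_vec A x \<xi> = mv N x \<xi>" using mv_cases[OF x k(1)] .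
  have "(\<Sum>i<n. \<Sum>k<n. cnorm A (x i k)) * col_norm A \<xi> \<le> (\<Sum>i<n. \<Sum>k<n. cnorm A (x i k)) * 1"
    using k x by (intro mult_left_mono sum_nonneg) auto
  then show "col_norm A (mat_vec A x \<xi>) \<le> (\<Sum>i<n. \<Sum>k<n. cnorm A (x i k))"
    using col_norm_mv_bound[OF x N(2)] N(4) by simp
qed

lemma mat_norm_unit: "mat_norm A x = (SUP \<xi>\<in>unit_cols. col_norm A (mat_vec A x \<xi>))"
  by (simp add: mat_norm_def unit_cols_def)

text \<open>Testing columns of all lengths \<open>N \<ge> n\<close> makes the norm independent of
  the size at which the matrix is viewed.\<close>

lemma mat_norm_le:
  assumes x: "x \<in> mat_carrier n A" and M: "\<And>N \<xi>. n \<le> N \<Longrightarrow> \<xi> \<in> col N \<Longrightarrow> col_norm A (mv N x \<xi>) \<le> M * col_norm A \<xi>"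
    and 0: "0 \<le> M"
  shows "mat_norm A x \<le> M"
  unfolding mat_norm_unit
proof (rule cSUP_least)
  show "unit_cols \<noteq> {}" using zero_col(1)[of 0] zero_col(2) col_columns by (fastforce simp: unit_cols_def)
  fix \<xi> assume "\<xi> \<in> unit_cols"
  then have k: "\<xi> \<in> columns A" "col_norm A \<xi> \<le> 1" by (auto simp: unit_cols_def)
  obtain N where N: "n \<le> N" "\<xi> \<in> col N" "x \<in> mat_carrier N A" "mat_vec A x \<xi> = mv N x \<xi>" using mv_cases[OF x k(1)] .
  have "M * col_norm A \<xi> \<le> M * 1" using k 0 by (intro mult_left_mono)
  then show "col_norm A (mat_vec A x \<xi>) \<le> M" using M[OF N(1,2)] N(4) by simp
qed

lemma mat_norm_ge_0: assumes x: "x \<in> mat_carrier n A" shows "0 \<le> mat_norm A x"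
proof -
  have "(\<lambda>i. \<zero>) \<in> unit_cols" using zero_col(1)[of 0] zero_col(2) col_columns[of _ 0] by (simp add: unit_cols_def)
  then have "col_norm A (mat_vec A x (\<lambda>i. \<zero>)) \<le> mat_norm A x"
    unfolding mat_norm_unit by (rule cSUP_upper[OF _ mat_norm_bdd[OF x]])
  moreover have "0 \<le> col_norm A (mat_vec A x (\<lambda>i. \<zero>))"
    using mat_vec_mv[OF x zero_col(1)] col_norm_ge_0[OF mv_col[OF x zero_col(1)]] by simp
  ultimately show ?thesis by linarith
qed

lemma mv_sm: "x \<in> mat_carrier n A \<Longrightarrow> \<xi> \<in> col N \<Longrightarrow> mv N x (\<lambda>i. c \<odot> \<xi> i) = (\<lambda>i. c \<odot> mv N x \<xi> i)"
  by (simp add: mv_def fs_sm)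

lemma mat_norm_app:
  assumes x: "x \<in> mat_carrier n A" and n: "n \<le> N" and k: "\<xi> \<in> col N"
  shows "col_norm A (mv N x \<xi>) \<le> mat_norm A x * col_norm A \<xi>"
proof (cases "col_norm A \<xi> = 0")
  case True
  have "\<xi> = (\<lambda>i. \<zero>)" using col_norm_eq_0[OF k True] by blast
  then have "mv N x \<xi> = (\<lambda>i. \<zero>)" using x by (auto simp: mv_def fs_zero)
  then show ?thesis using True zero_col(2) by simp
next
  case False
  define r where "r = col_norm A \<xi>"
  have r: "0 < r" using False col_norm_ge_0[OF k] by (simp add: r_def)
  let ?k = "\<lambda>i. complex_of_real (1 / r) \<odot> \<xi> i"
  have kc: "?k \<in> col N" using k by (rule col_closed)
  have n1: "col_norm A ?k = 1" using col_norm_sm[OF k, of "complex_of_real (1/r)"] r by (simp add: norm_divide flip: r_def)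
  have xN: "x \<in> mat_carrier N A" using x n by (rule mc_mono)
  have "col_norm A (mat_vec A x ?k) \<le> mat_norm A x"
    unfolding mat_norm_unit using kc n1 col_columns[OF kc]
    by (intro cSUP_upper[OF _ mat_norm_bdd[OF x]]) (simp add: unit_cols_def)
  then have "col_norm A (\<lambda>i. complex_of_real (1 / r) \<odot> mv N x \<xi> i) \<le> mat_norm A x"
    using mat_vec_mv[OF xN kc] mv_sm[OF x k] by simp
  then have "(1 / r) * col_norm A (mv N x \<xi>) \<le> mat_norm A x"
    using col_norm_sm[OF mv_col[OF x k], of "complex_of_real (1/r)"] r by (simp add: norm_divide)
  then show ?thesis using r by (simp add: field_simps flip: r_def)
qed

lemma mat_norm_le_sum: assumes x: "x \<in> mat_carrier n A" shows "mat_norm A x \<le> (\<Sum>i<n. \<Sum>k<n. cnorm A (x i k))"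
  using col_norm_mv_bound[OF x] x by (intro mat_norm_le[OF x]) (auto intro!: sum_nonneg)

lemma entry_le_mat_norm: assumes x: "x \<in> mat_carrier n A" shows "cnorm A (x i j) \<le> mat_norm A x"
proof -
  define N where "N = max n (Suc j)"
  have n: "n \<le> N" "j < N" by (auto simp: N_def)
  \<comment> \<open>The unit column \<open>j\<close> picks out column \<open>j\<close> of
    \<open>x\<close>. Its norm is only known to be at most one, since the algebra may be
    zero.\<close>
  let ?e = "\<lambda>i. if i = j then \<one> else \<zero>"
  have e: "?e \<in> col N" using n by (intro colI) auto
  have "cinner N ?e ?e = star A (?e j) \<otimes> ?e j" unfolding cinner_def by (rule fs_single[OF n(2)]) auto
  then have "col_norm A ?e \<le> 1" using norm_one_le col_norm_cinner[OF e] by simp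
  then have 1: "mat_norm A x * col_norm A ?e \<le> mat_norm A x * 1" using mat_norm_ge_0[OF x] by (rule mult_left_mono)
  have "mv N x ?e i = x i j \<otimes> ?e j" unfolding mv_def by (rule fs_single[OF n(2)]) (use x in auto)
  then have "cnorm A (x i j) \<le> col_norm A (mv N x ?e)"
    using entry_le_col_norm[OF mv_col[OF x e], of N i] x by simp
  also have "\<dots> \<le> mat_norm A x * col_norm A ?e" by (rule mat_norm_app[OF x n(1) e])
  finally show ?thesis using 1 by simp
qed

lemma mat_norm_eq_0: assumes x: "x \<in> mat_carrier n A" shows "mat_norm A x = 0 \<longleftrightarrow> x = (\<lambda>i j. \<zero>)"
proof
  assume 0: "mat_norm A x = 0"
  have "cnorm A (x i j) = 0" for i j
    using entry_le_mat_norm[OF x, of i j] norm_ge_0[OF mcD(1)[OF x], of i j] unfolding 0 by linarith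
  then show "x = (\<lambda>i j. \<zero>)" using norm_eq_0[OF mcD(1)[OF x]] by blast
next
  assume "x = (\<lambda>i j. \<zero>)"
  then show "mat_norm A x = 0" using mat_norm_le_sum[OF mc_zero[of 0]] mat_norm_ge_0[OF mc_zero[of 0]] by simp
qed

lemma mat_norm_add:
  assumes x: "x \<in> mat_carrier n A" and y: "y \<in> mat_carrier n A"
  shows "mat_norm A (\<lambda>i j. x i j \<oplus> y i j) \<le> mat_norm A x + mat_norm A y"
proof (rule mat_norm_le[OF mc_add[OF x y]])
  fix N \<xi> assume n: "n \<le> N" and k: "\<xi> \<in> col N"
  have "mv N (\<lambda>i j. x i j \<oplus> y i j) \<xi> = (\<lambda>i. mv N x \<xi> i \<oplus> mv N y \<xi> i)"
    using x y k by (simp add: mv_def l_distr fs_add)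
  then have "col_norm A (mv N (\<lambda>i j. x i j \<oplus> y i j) \<xi>) \<le> col_norm A (mv N x \<xi>) + col_norm A (mv N y \<xi>)"
    using col_norm_triangle[OF mv_col[OF x k] mv_col[OF y k]] by simp
  then show "col_norm A (mv N (\<lambda>i j. x i j \<oplus> y i j) \<xi>) \<le> (mat_norm A x + mat_norm A y) * col_norm A \<xi>"
    using mat_norm_app[OF x n k] mat_norm_app[OF y n k] by (simp add: algebra_simps)
qed (use mat_norm_ge_0 x y in auto)

lemma mat_norm_sm_le:
  assumes x: "x \<in> mat_carrier n A" shows "mat_norm A (\<lambda>i j. c \<odot> x i j) \<le> cmod c * mat_norm A x"
proof (rule mat_norm_le[OF mc_sm[OF x]])
  fix N \<xi> assume n: "n \<le> N" and k: "\<xi> \<in> col N"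
  have "mv N (\<lambda>i j. c \<odot> x i j) \<xi> = (\<lambda>i. c \<odot> mv N x \<xi> i)"
    using x k by (simp add: mv_def fs_sm)
  then have "col_norm A (mv N (\<lambda>i j. c \<odot> x i j) \<xi>) = cmod c * col_norm A (mv N x \<xi>)"
    using col_norm_sm[OF mv_col[OF x k]] by simp
  also have "\<dots> \<le> cmod c * (mat_norm A x * col_norm A \<xi>)" using mat_norm_app[OF x n k] by (intro mult_left_mono) auto
  finally show "col_norm A (mv N (\<lambda>i j. c \<odot> x i j) \<xi>) \<le> (cmod c * mat_norm A x) * col_norm A \<xi>" by simp
qed (use mat_norm_ge_0 x in auto)

lemma mat_norm_sm:
  assumes x: "x \<in> mat_carrier n A" shows "mat_norm A (\<lambda>i j. c \<odot> x i j) = cmod c * mat_norm A x"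
proof (cases "c = 0")
  case True then show ?thesis using x mat_norm_eq_0[OF mc_zero[of 0]] by simp
next
  case False
  have "mat_norm A (\<lambda>i j. inverse c \<odot> (c \<odot> x i j)) \<le> cmod (inverse c) * mat_norm A (\<lambda>i j. c \<odot> x i j)"
    by (rule mat_norm_sm_le[OF mc_sm[OF x]])
  then have "cmod c * mat_norm A x \<le> cmod c * (inverse (cmod c) * mat_norm A (\<lambda>i j. c \<odot> x i j))"
    using x False by (intro mult_left_mono) (simp_all add: norm_inverse)
  then have "cmod c * mat_norm A x \<le> mat_norm A (\<lambda>i j. c \<odot> x i j)"
    using False by (simp flip: mult.assoc)
  then show ?thesis using mat_norm_sm_le[OF x, of c] by simp
qed

lemma mat_norm_mm:
  assumes x: "x \<in> mat_carrier n A" and y: "y \<in> mat_carrier n A"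
  shows "mat_norm A (mm n x y) \<le> mat_norm A x * mat_norm A y"
proof (rule mat_norm_le[OF mm_mc[OF x y]])
  fix N \<xi> assume n: "n \<le> N" and k: "\<xi> \<in> col N"
  note N = mc_mono[OF x n] mc_mono[OF y n]
  have "mm n x y = mm N x y" using mult_mm[OF x y] mult_mm[OF N] by simp
  then have "mv N (mm n x y) \<xi> = mv N x (mv N y \<xi>)" using mv_mm[OF N k] by simp
  moreover have "col_norm A (mv N x (mv N y \<xi>)) \<le> mat_norm A x * col_norm A (mv N y \<xi>)"
    by (rule mat_norm_app[OF x n mv_col[OF N(2) k]])
  moreover have "mat_norm A x * col_norm A (mv N y \<xi>) \<le> mat_norm A x * (mat_norm A y * col_norm A \<xi>)"
    using mat_norm_app[OF y n k] mat_norm_ge_0[OF x] by (rule mult_left_mono)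
  ultimately show "col_norm A (mv N (mm n x y) \<xi>) \<le> (mat_norm A x * mat_norm A y) * col_norm A \<xi>" by simp
qed (use mat_norm_ge_0 x y in auto)

text \<open>Moving \<open>x\<close> to the other side gives \<open>\<langle>x\<xi>, x\<xi>\<rangle>
  = \<langle>\<xi>, x\<^sup>* x\<xi>\<rangle>\<close>, to which Cauchy-Schwarz applies.\<close>

lemma mat_norm_cstar_le:
  assumes x: "x \<in> mat_carrier n A"
  shows "(mat_norm A x)\<^sup>2 \<le> mat_norm A (mm n (\<lambda>i j. star A (x j i)) x)"
proof -
  let ?s = "\<lambda>i j. star A (x j i)"
  have s: "?s \<in> mat_carrier n A" by (rule mc_star[OF x])
  let ?M = "mat_norm A (mm n ?s x)"
  have M0: "0 \<le> ?M" by (rule mat_norm_ge_0[OF mm_mc[OF s x]])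
  have "mat_norm A x \<le> sqrt ?M"
  proof (rule mat_norm_le[OF x])
    fix N \<xi> assume n: "n \<le> N" and k: "\<xi> \<in> col N"
    note N = mc_mono[OF x n] mc_mono[OF s n]
    note xk = mv_col[OF N(1) k, of N]
    have "mm n ?s x = mm N ?s x" using mult_mm[OF s x] mult_mm[OF N(2,1)] by simp
    then have e: "mv N ?s (mv N x \<xi>) = mv N (mm n ?s x) \<xi>" using mv_mm[OF N(2,1) k] by simp
    note c = mv_col[OF mc_mono[OF mm_mc[OF s x] n] k, of N]
    have "(col_norm A (mv N x \<xi>))\<^sup>2 = cnorm A (cinner N \<xi> (mv N (mm n ?s x) \<xi>))"
      using col_norm_sq[OF xk] cinner_adjoint[OF N(1) k xk] e by simp
    also have "\<dots> \<le> col_norm A \<xi> * col_norm A (mv N (mm n ?s x) \<xi>)" by (rule cauchy_schwarz[OF k c])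
    also have "\<dots> \<le> col_norm A \<xi> * (?M * col_norm A \<xi>)"
      using mat_norm_app[OF mm_mc[OF s x] n k] col_norm_ge_0[OF k] by (rule mult_left_mono)
    also have "\<dots> = (sqrt ?M * col_norm A \<xi>)\<^sup>2" using M0 by (simp add: power_mult_distrib power2_eq_square)
    finally show "col_norm A (mv N x \<xi>) \<le> sqrt ?M * col_norm A \<xi>"
      by (rule power2_le_imp_le) (use col_norm_ge_0[OF k] M0 in simp)
  qed (use M0 in simp)
  then show ?thesis using mat_norm_ge_0[OF x] M0 by (metis power_mono real_sqrt_pow2)
qed

text \<open>The remaining inequality follows from submultiplicativity once the adjoint has no larger
  norm, which \<open>mat_norm_cstar_le\<close> itself implies.\<close>

lemma mat_norm_cstar:
  assumes x: "x \<in> mat_carrier n A"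
  shows "mat_norm A (mm n (\<lambda>i j. star A (x j i)) x) = (mat_norm A x)\<^sup>2"
proof (rule antisym[OF _ mat_norm_cstar_le[OF x]])
  have le: "mat_norm A y \<le> mat_norm A (\<lambda>i j. star A (y j i))" if y: "y \<in> mat_carrier n A" for y
  proof (cases "mat_norm A y = 0")
    case True then show ?thesis using mat_norm_ge_0[OF mc_star[OF y]] by simp
  next
    case False
    have "mat_norm A y * mat_norm A y \<le> mat_norm A (\<lambda>i j. star A (y j i)) * mat_norm A y"
      using mat_norm_cstar_le[OF y] mat_norm_mm[OF mc_star[OF y] y] by (simp add: power2_eq_square)
    then show ?thesis using False mat_norm_ge_0[OF y] by (simp add: mult_le_cancel_right)
  qed
  have "mat_norm A (\<lambda>i j. star A (x j i)) \<le> mat_norm A x"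
    using le[OF mc_star[OF x]] x by simp
  then have "mat_norm A (\<lambda>i j. star A (x j i)) * mat_norm A x \<le> mat_norm A x * mat_norm A x"
    using mat_norm_ge_0[OF x] by (rule mult_right_mono)
  then show "mat_norm A (mm n (\<lambda>i j. star A (x j i)) x) \<le> (mat_norm A x)\<^sup>2"
    using mat_norm_mm[OF mc_star[OF x] x] by (simp add: power2_eq_square)
qed

text \<open>The algebras \<open>M_n n A\<close> and \<open>M_inf A\<close> differ only in carrier
  and unit, so one verification over an arbitrary carrier \<open>S\<close> serves both.\<close>

lemma pre_cstar_sub:
  assumes S: "S \<subseteq> (\<Union>n. mat_carrier n A)" and z: "(\<lambda>i j. \<zero>) \<in> S"
    and ad: "\<And>x y. x \<in> S \<Longrightarrow> y \<in> S \<Longrightarrow> (\<lambda>i j. x i j \<oplus> y i j) \<in> S"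
    and sc: "\<And>c x. x \<in> S \<Longrightarrow> (\<lambda>i j. c \<odot> x i j) \<in> S"
    and mu: "\<And>n x y. x \<in> S \<Longrightarrow> y \<in> S \<Longrightarrow> x \<in> mat_carrier n A \<Longrightarrow> y \<in> mat_carrier n A \<Longrightarrow> mm n x y \<in> S"
    and st: "\<And>x. x \<in> S \<Longrightarrow> (\<lambda>i j. star A (x j i)) \<in> S"
  shows "pre_cstar ((M_inf A)\<lparr>carrier := S, one := u\<rparr>)"
    and "\<And>x y. x \<in> S \<Longrightarrow> y \<in> S \<Longrightarrow> x \<ominus>\<^bsub>(M_inf A)\<lparr>carrier := S, one := u\<rparr>\<^esub> y = (\<lambda>i j. x i j \<ominus> y i j)"
proof -
  let ?G = "(M_inf A)\<lparr>carrier := S, one := u\<rparr>"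
  \<comment> \<open>Each axiom involves at most three matrices. They fit into a common size, where
    the product is a fixed finite sum.\<close>
  have ev: "\<forall>\<^sub>F N in sequentially. x \<in> mat_carrier N A" if "x \<in> S" for x using S that mc_event by blast
  have ex1: "\<exists>N. x \<in> mat_carrier N A" if "x \<in> S" for x using S that by blast
  have ex2: "\<exists>N. x \<in> mat_carrier N A \<and> y \<in> mat_carrier N A" if "x \<in> S" "y \<in> S" for x y
    using eventually_happens'[OF sequentially_bot eventually_conj[OF ev[OF that(1)] ev[OF that(2)]]] .
  have ex3: "\<exists>N. x \<in> mat_carrier N A \<and> y \<in> mat_carrier N A \<and> w \<in> mat_carrier N A" if "x \<in> S" "y \<in> S" "w \<in> S" for x y w
    using eventually_happens'[OF sequentially_bot eventually_conj[OF ev[OF that(1)] eventually_conj[OF ev[OF that(2)] ev[OF that(3)]]]] .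
  have c: "x i j \<in> carrier A" if "x \<in> S" for x i j using ex1[OF that] mcD(1) by blast
  have ag: "abelian_group ?G"
  proof (rule abelian_groupI)
    fix x assume x: "x \<in> carrier ?G"
    have "(\<lambda>i j. (-1) \<odot> x i j) \<oplus>\<^bsub>?G\<^esub> x = \<zero>\<^bsub>?G\<^esub>" using x c by (simp add: M_inf_simps)
    then show "\<exists>y\<in>carrier ?G. y \<oplus>\<^bsub>?G\<^esub> x = \<zero>\<^bsub>?G\<^esub>" using sc[of x "-1"] x by auto
  qed (use z ad c in \<open>auto simp: M_inf_simps a_ac\<close>)
  have inv: "\<ominus>\<^bsub>?G\<^esub> y = (\<lambda>i j. (-1) \<odot> y i j)" if y: "y \<in> S" for y
    using abelian_group.minus_equality[OF ag, of "\<lambda>i j. (-1) \<odot> y i j" y] sc[OF y] y c by (simp add: M_inf_simps)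
  have df: "x \<ominus>\<^bsub>?G\<^esub> y = (\<lambda>i j. x i j \<ominus> y i j)" if "x \<in> S" "y \<in> S" for x y
    using that c by (simp add: a_minus_def inv M_inf_simps) (simp add: diff_sm flip: a_minus_def)
  show "\<And>x y. x \<in> S \<Longrightarrow> y \<in> S \<Longrightarrow> x \<ominus>\<^bsub>?G\<^esub> y = (\<lambda>i j. x i j \<ominus> y i j)" by (rule df)
  show "pre_cstar ?G"
  proof (rule pre_cstar.intro)
    show "abelian_monoid ?G" using ag by (rule abelian_group.axioms)
  next
    fix x y assume "x \<in> carrier ?G" "y \<in> carrier ?G"
    then have S': "x \<in> S" "y \<in> S" by simp_all
    obtain N where N: "x \<in> mat_carrier N A" "y \<in> mat_carrier N A" using ex2[OF S'] by blast
    show "x \<otimes>\<^bsub>?G\<^esub> y \<in> carrier ?G" using mu[OF S' N] mult_mm[OF N] by simp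
    show "star ?G (x \<oplus>\<^bsub>?G\<^esub> y) = star ?G x \<oplus>\<^bsub>?G\<^esub> star ?G y" using c S' by (simp add: M_inf_simps)
    show "x \<ominus>\<^bsub>?G\<^esub> y = x \<oplus>\<^bsub>?G\<^esub> (-1) \<odot>\<^bsub>?G\<^esub> y" using df S' c by (simp add: M_inf_simps diff_sm)
    show "cnorm ?G (x \<oplus>\<^bsub>?G\<^esub> y) \<le> cnorm ?G x + cnorm ?G y" using mat_norm_add[OF N] by (simp add: M_inf_simps)
    show "cnorm ?G (x \<otimes>\<^bsub>?G\<^esub> y) \<le> cnorm ?G x * cnorm ?G y" using mat_norm_mm[OF N] mult_mm[OF N] by (simp add: M_inf_simps(7))
    show "star ?G (x \<otimes>\<^bsub>?G\<^esub> y) = star ?G y \<otimes>\<^bsub>?G\<^esub> star ?G x"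
    proof -
      have "(\<lambda>i j. star A (mm N x y j i)) = mm N (\<lambda>i j. star A (y j i)) (\<lambda>i j. star A (x j i))"
        using N by (simp add: mm_def fs_star)
      then show ?thesis using mult_mm[OF N] mult_mm[OF mc_star[OF N(2)] mc_star[OF N(1)]] by (simp add: M_inf_simps(6))
    qed
    fix d
    show "(d \<odot>\<^bsub>?G\<^esub> x) \<otimes>\<^bsub>?G\<^esub> y = d \<odot>\<^bsub>?G\<^esub> (x \<otimes>\<^bsub>?G\<^esub> y)"
    proof -
      have "mm N (\<lambda>i j. d \<odot> x i j) y = (\<lambda>i j. d \<odot> mm N x y i j)" using N by (simp add: mm_def fs_sm)
      then show ?thesis using mult_mm[OF N] mult_mm[OF mc_sm[OF N(1)] N(2)] by (simp add: M_inf_simps(5))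
    qed
    show "x \<otimes>\<^bsub>?G\<^esub> (d \<odot>\<^bsub>?G\<^esub> y) = d \<odot>\<^bsub>?G\<^esub> (x \<otimes>\<^bsub>?G\<^esub> y)"
    proof -
      have "mm N x (\<lambda>i j. d \<odot> y i j) = (\<lambda>i j. d \<odot> mm N x y i j)" using N by (simp add: mm_def fs_sm)
      then show ?thesis using mult_mm[OF N] mult_mm[OF N(1) mc_sm[OF N(2)]] by (simp add: M_inf_simps(5))
    qed
    show "d \<odot>\<^bsub>?G\<^esub> (x \<oplus>\<^bsub>?G\<^esub> y) = d \<odot>\<^bsub>?G\<^esub> x \<oplus>\<^bsub>?G\<^esub> d \<odot>\<^bsub>?G\<^esub> y" using c S' by (simp add: M_inf_simps sm_add_right)
  next
    fix x y w assume "x \<in> carrier ?G" "y \<in> carrier ?G" "w \<in> carrier ?G"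
    then have S': "x \<in> S" "y \<in> S" "w \<in> S" by simp_all
    obtain N where N: "x \<in> mat_carrier N A" "y \<in> mat_carrier N A" "w \<in> mat_carrier N A" using ex3[OF S'] by blast
    show "(x \<otimes>\<^bsub>?G\<^esub> y) \<otimes>\<^bsub>?G\<^esub> w = x \<otimes>\<^bsub>?G\<^esub> (y \<otimes>\<^bsub>?G\<^esub> w)"
      using mm_assoc[OF N] mult_mm[OF N(1,2)] mult_mm[OF N(2,3)] mult_mm[OF mm_mc[OF N(1,2)] N(3)] mult_mm[OF N(1) mm_mc[OF N(2,3)]]
      by simp
    show "(x \<oplus>\<^bsub>?G\<^esub> y) \<otimes>\<^bsub>?G\<^esub> w = x \<otimes>\<^bsub>?G\<^esub> w \<oplus>\<^bsub>?G\<^esub> y \<otimes>\<^bsub>?G\<^esub> w"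
    proof -
      have "mm N (\<lambda>i j. x i j \<oplus> y i j) w = (\<lambda>i j. mm N x w i j \<oplus> mm N y w i j)" using N by (simp add: mm_def l_distr fs_add)
      then show ?thesis using mult_mm[OF N(1,3)] mult_mm[OF N(2,3)] mult_mm[OF mc_add[OF N(1,2)] N(3)] by (simp add: M_inf_simps(3))
    qed
    show "w \<otimes>\<^bsub>?G\<^esub> (x \<oplus>\<^bsub>?G\<^esub> y) = w \<otimes>\<^bsub>?G\<^esub> x \<oplus>\<^bsub>?G\<^esub> w \<otimes>\<^bsub>?G\<^esub> y"
    proof -
      have "mm N w (\<lambda>i j. x i j \<oplus> y i j) = (\<lambda>i j. mm N w x i j \<oplus> mm N w y i j)" using N by (simp add: mm_def r_distr fs_add)
      then show ?thesis using mult_mm[OF N(3,1)] mult_mm[OF N(3,2)] mult_mm[OF N(3) mc_add[OF N(1,2)]] by (simp add: M_inf_simps(3))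
    qed
  next
    fix x assume "x \<in> carrier ?G"
    then have S': "x \<in> S" by simp
    obtain N where N: "x \<in> mat_carrier N A" using ex1[OF S'] by blast
    show "1 \<odot>\<^bsub>?G\<^esub> x = x" "star ?G x \<in> carrier ?G" "star ?G (star ?G x) = x"
      using c S' st by (simp_all add: M_inf_simps)
    show "0 \<le> cnorm ?G x" "cnorm ?G x = 0 \<longleftrightarrow> x = \<zero>\<^bsub>?G\<^esub>"
      using mat_norm_ge_0[OF N] mat_norm_eq_0[OF N] by (simp_all add: M_inf_simps)
    show "cnorm ?G (star ?G x \<otimes>\<^bsub>?G\<^esub> x) = (cnorm ?G x)\<^sup>2"
      using mat_norm_cstar[OF N] mult_mm[OF mc_star[OF N] N] by (simp add: M_inf_simps(6,7))
    fix d e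
    show "d \<odot>\<^bsub>?G\<^esub> x \<in> carrier ?G" "(d + e) \<odot>\<^bsub>?G\<^esub> x = d \<odot>\<^bsub>?G\<^esub> x \<oplus>\<^bsub>?G\<^esub> e \<odot>\<^bsub>?G\<^esub> x"
      "d \<odot>\<^bsub>?G\<^esub> (e \<odot>\<^bsub>?G\<^esub> x) = (d * e) \<odot>\<^bsub>?G\<^esub> x" "star ?G (d \<odot>\<^bsub>?G\<^esub> x) = cnj d \<odot>\<^bsub>?G\<^esub> star ?G x"
      using c S' sc by (simp_all add: M_inf_simps sm_add_left)
    show "cnorm ?G (d \<odot>\<^bsub>?G\<^esub> x) = cmod d * cnorm ?G x" using mat_norm_sm[OF N] by (simp add: M_inf_simps)
  qed
qed

section \<open>The algebras of n by n matrices as C*-algebras\<close>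

lemma M_n_sub: "M_n n A = (M_inf A)\<lparr>carrier := mat_carrier n A, one := (\<lambda>i j. if i = j \<and> i < n then \<one> else \<zero>)\<rparr>"
  by (simp add: M_n_def)

lemma M_inf_sub: "M_inf A = (M_inf A)\<lparr>carrier := carrier (M_inf A), one := one (M_inf A)\<rparr>"
  by simp

lemma M_n_sel [simp]:
  "carrier (M_n n A) = mat_carrier n A" "x \<otimes>\<^bsub>M_n n A\<^esub> y = x \<otimes>\<^bsub>M_inf A\<^esub> y" "x \<oplus>\<^bsub>M_n n A\<^esub> y = x \<oplus>\<^bsub>M_inf A\<^esub> y"
  "\<zero>\<^bsub>M_n n A\<^esub> = \<zero>\<^bsub>M_inf A\<^esub>" "c \<odot>\<^bsub>M_n n A\<^esub> x = c \<odot>\<^bsub>M_inf A\<^esub> x" "star (M_n n A) = star (M_inf A)"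
  "cnorm (M_n n A) = cnorm (M_inf A)" "\<one>\<^bsub>M_n n A\<^esub> = (\<lambda>i j. if i = j \<and> i < n then \<one> else \<zero>)"
  by (simp_all add: M_n_def)

lemma M_n_pre_cstar: "pre_cstar (M_n n A)"
  and M_n_diff: "x \<in> mat_carrier n A \<Longrightarrow> y \<in> mat_carrier n A \<Longrightarrow> x \<ominus>\<^bsub>M_n n A\<^esub> y = (\<lambda>i j. x i j \<ominus> y i j)"
proof -
  have 2: "mm k x y \<in> mat_carrier n A" if "x \<in> mat_carrier n A" "y \<in> mat_carrier n A" "x \<in> mat_carrier k A" "y \<in> mat_carrier k A" for x y k n
    using mm_mc[OF that(1,2)] mult_mm[OF that(1,2)] mult_mm[OF that(3,4)] by simp
  have 0: "mat_carrier n A \<subseteq> (\<Union>n. mat_carrier n A)" for n by blast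
  show "pre_cstar (M_n n A)" unfolding M_n_sub by (rule pre_cstar_sub[OF 0 mc_zero mc_add mc_sm 2 mc_star])
  show "x \<in> mat_carrier n A \<Longrightarrow> y \<in> mat_carrier n A \<Longrightarrow> x \<ominus>\<^bsub>M_n n A\<^esub> y = (\<lambda>i j. x i j \<ominus> y i j)"
    unfolding M_n_sub by (rule pre_cstar_sub[OF 0 mc_zero mc_add mc_sm 2 mc_star])
qed

lemma M_inf_carrier: "carrier (M_inf A) = (\<Union>n. mat_carrier n A)"
  by (simp add: M_inf_simps)

lemma common_size:
  assumes "x \<in> carrier (M_inf A)" "y \<in> carrier (M_inf A)"
  obtains N where "x \<in> mat_carrier N A" "y \<in> mat_carrier N A"
proof -
  have "\<forall>\<^sub>F N in sequentially. x \<in> mat_carrier N A \<and> y \<in> mat_carrier N A"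
    using assms mc_event by (intro eventually_conj) (auto simp: M_inf_carrier)
  from eventually_happens'[OF sequentially_bot this] show ?thesis using that by blast
qed

lemma M_inf_pre_cstar: "pre_cstar (M_inf A)"
  and M_inf_diff: "x \<in> carrier (M_inf A) \<Longrightarrow> y \<in> carrier (M_inf A) \<Longrightarrow> x \<ominus>\<^bsub>M_inf A\<^esub> y = (\<lambda>i j. x i j \<ominus> y i j)"
proof -
  have cs: "\<exists>n. x \<in> mat_carrier n A \<and> y \<in> mat_carrier n A" if "x \<in> carrier (M_inf A)" "y \<in> carrier (M_inf A)" for x y
    using common_size[OF that] by blast
  have in_carrier: "x \<in> mat_carrier n A \<Longrightarrow> x \<in> carrier (M_inf A)" for x n by (auto simp: M_inf_carrier)
  have 1: "(\<lambda>i j. \<zero>) \<in> carrier (M_inf A)" using in_carrier mc_zero by blast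
  have 2: "(\<lambda>i j. x i j \<oplus> y i j) \<in> carrier (M_inf A)" if "x \<in> carrier (M_inf A)" "y \<in> carrier (M_inf A)" for x y
    using cs[OF that] mc_add in_carrier by blast
  have 3: "(\<lambda>i j. c \<odot> x i j) \<in> carrier (M_inf A)" if "x \<in> carrier (M_inf A)" for x c
    using cs[OF that that] mc_sm in_carrier by blast
  have 4: "mm n x y \<in> carrier (M_inf A)" if "x \<in> mat_carrier n A" "y \<in> mat_carrier n A" for x y n
    using mm_mc[OF that] in_carrier by blast
  have 5: "(\<lambda>i j. star A (x j i)) \<in> carrier (M_inf A)" if "x \<in> carrier (M_inf A)" for x
    using cs[OF that that] mc_star in_carrier by blast
  have 0: "carrier (M_inf A) \<subseteq> (\<Union>n. mat_carrier n A)" by (simp add: M_inf_carrier)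
  note sub = pre_cstar_sub[OF 0 1 2 3 4 5, where u = "one (M_inf A)", folded M_inf_sub]
  show "pre_cstar (M_inf A)" by (rule sub)
  show "x \<in> carrier (M_inf A) \<Longrightarrow> y \<in> carrier (M_inf A) \<Longrightarrow> x \<ominus>\<^bsub>M_inf A\<^esub> y = (\<lambda>i j. x i j \<ominus> y i j)" by (rule sub)
qed

text \<open>Subtraction refers to inverses within the carrier, so, unlike the other operations, it
  does not agree by definition in the two algebras.\<close>

lemma M_n_diff': "x \<in> mat_carrier n A \<Longrightarrow> y \<in> mat_carrier n A \<Longrightarrow> x \<ominus>\<^bsub>M_n n A\<^esub> y = x \<ominus>\<^bsub>M_inf A\<^esub> y"
  by (subst M_n_diff, assumption, assumption, subst M_inf_diff) (auto simp: M_inf_carrier)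

lemma mc_one: "(\<lambda>i j. if i = j \<and> i < n then \<one> else \<zero>) \<in> mat_carrier n A"
  by (rule mcI) auto

lemma M_n_unital_cstar: "unital_cstar (M_n n A)"
proof -
  interpret N: pre_cstar "M_n n A" by (rule M_n_pre_cstar)
  show ?thesis
  proof
    show "\<one>\<^bsub>M_n n A\<^esub> \<in> carrier (M_n n A)" using mc_one by simp
  next
    fix x assume "x \<in> carrier (M_n n A)"
    then have x: "x \<in> mat_carrier n A" by simp
    let ?I = "\<lambda>i j. if i = j \<and> i < n then \<one> else \<zero>"
    have "mm n ?I x i j = x i j" for i j
    proof (cases "i < n")
      case True
      have "mm n ?I x i j = ?I i i \<otimes> x i j" unfolding mm_def by (rule fs_single[OF True]) (use x in auto)
      then show ?thesis using True x by simp
    qed (use x mcD(2)[OF mm_mc[OF mc_one x]] mcD(2)[OF x] in simp)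
    then show "\<one>\<^bsub>M_n n A\<^esub> \<otimes>\<^bsub>M_n n A\<^esub> x = x" using mult_mm[OF mc_one x] by (simp add: fun_eq_iff)
    have "mm n x ?I i j = x i j" for i j
    proof (cases "j < n")
      case True
      have "mm n x ?I i j = x i j \<otimes> ?I j j" unfolding mm_def by (rule fs_single[OF True]) (use x in auto)
      then show ?thesis using True x by simp
    qed (use x mcD(3)[OF mm_mc[OF x mc_one]] mcD(3)[OF x] in simp)
    then show "x \<otimes>\<^bsub>M_n n A\<^esub> \<one>\<^bsub>M_n n A\<^esub> = x" using mult_mm[OF x mc_one] by (simp add: fun_eq_iff)
  next
    fix s :: "nat \<Rightarrow> 'a inf_mat"
    assume "\<And>k. s k \<in> carrier (M_n n A)"
      and cau: "\<And>e. 0 < e \<Longrightarrow> \<exists>N. \<forall>k\<ge>N. \<forall>l\<ge>N. cnorm (M_n n A) (s k \<ominus>\<^bsub>M_n n A\<^esub> s l) < e"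
    then have s: "s k \<in> mat_carrier n A" for k by simp
    \<comment> \<open>Entries are dominated by the matrix norm, so they converge; conversely the
      matrix norm is dominated by the sum of the norms of the entries.\<close>
    have "\<exists>l\<in>carrier A. (\<lambda>k. cnorm A (s k i j \<ominus> l)) \<longlonglongrightarrow> 0" for i j
    proof (rule complete_seq)
      show "s k i j \<in> carrier A" for k by (rule mcD(1)[OF s])
      fix e :: real assume "0 < e"
      then obtain N where N: "\<forall>k\<ge>N. \<forall>l\<ge>N. cnorm (M_n n A) (s k \<ominus>\<^bsub>M_n n A\<^esub> s l) < e" using cau by blast
      have "cnorm A (s k i j \<ominus> s l i j) \<le> cnorm (M_n n A) (s k \<ominus>\<^bsub>M_n n A\<^esub> s l)" for k l
      proof -
        have "s k \<ominus>\<^bsub>M_n n A\<^esub> s l \<in> mat_carrier n A" using N.diff_closed s by simp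
        from entry_le_mat_norm[OF this, of i j] show ?thesis by (simp add: M_n_diff s M_inf_simps)
      qed
      then show "\<exists>N. \<forall>k\<ge>N. \<forall>l\<ge>N. cnorm A (s k i j \<ominus> s l i j) < e" using N by (meson le_less_trans)
    qed
    then obtain L0 where L0: "\<And>i j. L0 i j \<in> carrier A" "\<And>i j. (\<lambda>k. cnorm A (s k i j \<ominus> L0 i j)) \<longlonglongrightarrow> 0" by metis
    define L where "L = (\<lambda>i j. if i < n \<and> j < n then L0 i j else \<zero>)"
    have L: "L \<in> mat_carrier n A" unfolding L_def using L0 by (intro mcI) auto
    have "cnorm (M_n n A) (s k \<ominus>\<^bsub>M_n n A\<^esub> L) \<le> (\<Sum>i<n. \<Sum>j<n. cnorm A (s k i j \<ominus> L0 i j))" for k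
    proof -
      have "s k \<ominus>\<^bsub>M_n n A\<^esub> L \<in> mat_carrier n A" using N.diff_closed s L by simp
      from mat_norm_le_sum[OF this] show ?thesis by (simp add: M_n_diff s L M_inf_simps) (simp add: L_def)
    qed
    moreover have "(\<lambda>k. \<Sum>i<n. \<Sum>j<n. cnorm A (s k i j \<ominus> L0 i j)) \<longlonglongrightarrow> 0"
      by (intro tendsto_null_sum L0)
    ultimately have "N.conv s L" using s L by (intro N.convI) auto
    then show "\<exists>l\<in>carrier (M_n n A). (\<lambda>k. cnorm (M_n n A) (s k \<ominus>\<^bsub>M_n n A\<^esub> l)) \<longlonglongrightarrow> 0"
      unfolding N.conv_def by blast
  qed
qed

section \<open>Spectrum and cut-downs in the union of the matrix algebras\<close>

sublocale Mi: pre_cstar "M_inf A" by (rule M_inf_pre_cstar)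

lemma mc_Mi [intro]: "x \<in> mat_carrier n A \<Longrightarrow> x \<in> carrier (M_inf A)"
  by (auto simp: M_inf_carrier)

text \<open>A quasi-inverse found in the union already lies in \<open>M_n n A\<close>: where rows of
  \<open>x\<close> vanish, \<open>x + y = xy\<close> forces those of \<open>y\<close> to vanish, and
  \<open>x + y = yx\<close> does the same for columns.\<close>

lemma spec_M_inf: assumes a: "a \<in> mat_carrier n A" shows "spec (M_inf A) a = spec (M_n n A) a"
proof -
  interpret N: unital_cstar "M_n n A" by (rule M_n_unital_cstar)
  have "quasi_invertible (M_inf A) x \<longleftrightarrow> quasi_invertible (M_n n A) x" if x: "x \<in> mat_carrier n A" for x
  proof
    assume "quasi_invertible (M_inf A) x"
    then obtain y where y: "y \<in> carrier (M_inf A)" "x \<oplus>\<^bsub>M_inf A\<^esub> y = x \<otimes>\<^bsub>M_inf A\<^esub> y" "x \<oplus>\<^bsub>M_inf A\<^esub> y = y \<otimes>\<^bsub>M_inf A\<^esub> x"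
      by (auto simp: quasi_invertible_def)
    obtain N where N: "x \<in> mat_carrier N A" "y \<in> mat_carrier N A" using common_size[OF mc_Mi[OF x] y(1)] .
    have e1: "x i j \<oplus> y i j = mm N x y i j" and e2: "x i j \<oplus> y i j = mm N y x i j" for i j
      using y(2,3) mult_mm[OF N] mult_mm[OF N(2,1)] by (simp_all add: M_inf_simps(3) fun_eq_iff)
    have "y \<in> mat_carrier n A"
    proof (rule mcI)
      fix i j show "y i j \<in> carrier A" using N by simp
      assume ij: "n \<le> i \<or> n \<le> j"
      then have x0: "x i j = \<zero>" using mcD(2,3)[OF x] by blast
      show "y i j = \<zero>"
      proof (cases "n \<le> i")
        case True
        have "mm N x y i j = \<zero>" unfolding mm_def by (rule fs_zero) (use N mcD(2)[OF x True] in auto)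
        then show ?thesis using e1[of i j] x0 N by simp
      next
        case False
        then have j: "n \<le> j" using ij by blast
        have "mm N y x i j = \<zero>" unfolding mm_def by (rule fs_zero) (use N mcD(3)[OF x j] in auto)
        then show ?thesis using e2[of i j] x0 N by simp
      qed
    qed
    then show "quasi_invertible (M_n n A) x" using y(2,3) by (auto simp: quasi_invertible_def)
  qed (auto simp: quasi_invertible_def)
  then show ?thesis using N.sm_closed[of a] a by (simp add: spec_def)
qed

lemma positive_M_inf: "a \<in> mat_carrier n A \<Longrightarrow> a \<in> positive (M_inf A) \<longleftrightarrow> a \<in> positive (M_n n A)"
  using spec_M_inf[of a n] by (auto simp: positive_def)

lemma poly_eval_M_inf: assumes a: "a \<in> mat_carrier n A" shows "poly_eval (M_inf A) p a = poly_eval (M_n n A) p a"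
proof -
  interpret N: unital_cstar "M_n n A" by (rule M_n_unital_cstar)
  interpret G: abelian_monoid "M_inf A" by (rule Mi.add_monoid)
  interpret H: abelian_monoid "M_n n A" by (rule N.add_monoid)
  have eq: "pow_Suc (M_n n A) a i = pow_Suc (M_inf A) a i" for i by (simp add: pow_Suc_def)
  have pc: "pow_Suc (M_inf A) a i \<in> mat_carrier n A" for i
  proof (induction i)
    case (Suc i)
    then have "pow_Suc (M_inf A) a i \<otimes>\<^bsub>M_n n A\<^esub> a \<in> mat_carrier n A" using N.m_closed a by simp
    then show ?case by (simp add: pow_Suc_def)
  qed (use a in \<open>simp add: pow_Suc_def\<close>)
  have "finsum (M_inf A) f {..d} = finsum (M_n n A) f {..d}" if f: "\<And>i. f i \<in> mat_carrier n A" for f :: "nat \<Rightarrow> 'a inf_mat" and d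
  proof (induction d)
    case 0 show ?case using f mc_Mi[OF f] by (simp add: Pi_def)
  next
    case (Suc d)
    show ?case
      using G.finsum_Suc[of f d] H.finsum_Suc[of f d] f mc_Mi[OF f] Suc by (simp add: Pi_def)
  qed
  moreover have "complex_of_real c \<odot>\<^bsub>M_inf A\<^esub> pow_Suc (M_inf A) a i \<in> mat_carrier n A" for c i
    using N.sm_closed pc by simp
  ultimately show ?thesis by (simp add: poly_eval_def eq)
qed

text \<open>The construction of \<open>cf\<close> yields one approximating sequence; uniqueness for
  \<open>has_cfc\<close> needs the limit along every such sequence.\<close>

lemma cf_conv:
  assumes a: "a \<in> selfadj" and f: "continuous_on UNIV f"
    and q: "uniform_limit (spr a) (\<lambda>n. poly (q n)) f sequentially"
  shows "conv (\<lambda>n. ev a (cpoly (q n))) (cf a f)"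
  unfolding conv_def
proof (intro conjI allI)
  show "cf a f \<in> carrier A" using a f by (rule cf_closed)
  show "ev a (cpoly (q n)) \<in> carrier A" for n using a by auto
  show "(\<lambda>n. cnorm A (ev a (cpoly (q n)) \<ominus> cf a f)) \<longlonglongrightarrow> 0"
  proof (rule tendstoI)
    fix e :: real assume e: "0 < e"
    have "\<forall>\<^sub>F n in sequentially. \<forall>x\<in>spr a. dist (poly (q n) x) (f x) < e/2"
      using uniform_limitD[OF q, of "e/2"] e by simp
    then show "\<forall>\<^sub>F n in sequentially. dist (cnorm A (ev a (cpoly (q n)) \<ominus> cf a f)) 0 < e"
    proof eventually_elim
      case (elim n)
      have "cnorm A (cf a (poly (q n)) \<ominus> cf a f) \<le> e / 2"
        using elim e by (intro cf_norm_diff_le a f continuous_intros) (auto simp: dist_real_def less_imp_le)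
      then show ?case using e a cf_poly[OF a, of "q n"] f by (auto simp: selfadj_def)
    qed
  qed
qed

text \<open>The function vanishes near \<open>0\<close>, so its quotient by \<open>t\<close> extends
  to the continuous function \<open>k\<close>. Approximating \<open>k\<close> by \<open>p\<close>
  provides the factor \<open>t\<close> demanded by \<open>has_cfc\<close>.\<close>

lemma cutoff_poly:
  fixes \<epsilon> R :: real
  assumes e: "0 < \<epsilon>"
  shows "\<exists>p. uniform_limit {-R..R} (\<lambda>n t. t * poly (p n) t) (\<lambda>t. max 0 (t - \<epsilon>)) sequentially"
proof -
  define k where "k = (\<lambda>t. max 0 (t - \<epsilon>) / max t \<epsilon>)"
  have nz: "max t \<epsilon> \<noteq> 0" for t using e by (simp add: max_def)
  have k: "continuous_on UNIV k" unfolding k_def using nz by (intro continuous_intros) auto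
  have tk: "t * k t = max 0 (t - \<epsilon>)" for t using e by (simp add: k_def max_def)
  obtain p where p: "\<And>n t. \<bar>t\<bar> \<le> R \<Longrightarrow> \<bar>poly (p n) t - k t\<bar> < 1 / real (Suc n)"
    using poly_seq[OF k, of R] by auto
  have "uniform_limit {-R..R} (\<lambda>n t. t * poly (p n) t) (\<lambda>t. max 0 (t - \<epsilon>)) sequentially"
    unfolding uniform_limit_iff
  proof (intro allI impI)
    fix d :: real assume d: "0 < d"
    \<comment> \<open>Multiplication by \<open>t\<close> enlarges the error at most by the bound
      \<open>R\<close> on \<open>t\<close>.\<close>
    have "(\<lambda>n. (\<bar>R\<bar> + 1) * (1 / real (Suc n))) \<longlonglongrightarrow> (\<bar>R\<bar> + 1) * 0"
      using LIMSEQ_inverse_real_of_nat by (intro tendsto_mult tendsto_const) (simp add: inverse_eq_divide)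
    then have "\<forall>\<^sub>F n in sequentially. (\<bar>R\<bar> + 1) * (1 / real (Suc n)) < d"
      using d by (intro order_tendstoD) auto
    then show "\<forall>\<^sub>F n in sequentially. \<forall>t\<in>{-R..R}. dist (t * poly (p n) t) (max 0 (t - \<epsilon>)) < d"
    proof eventually_elim
      case (elim n)
      show ?case
      proof
        fix t assume "t \<in> {-R..R}"
        then have t: "\<bar>t\<bar> \<le> R" by auto
        have "dist (t * poly (p n) t) (max 0 (t - \<epsilon>)) = \<bar>t\<bar> * \<bar>poly (p n) t - k t\<bar>"
          unfolding tk[symmetric] dist_real_def by (simp add: abs_mult flip: right_diff_distrib)
        also have "\<dots> \<le> (\<bar>R\<bar> + 1) * (1 / real (Suc n))"
          using t p[OF t, of n] by (intro mult_mono) auto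
        finally show "dist (t * poly (p n) t) (max 0 (t - \<epsilon>)) < d" using elim by linarith
      qed
    qed
  qed
  then show ?thesis by blast
qed

text \<open>Existence of the value comes from the complete algebra \<open>M_n n A\<close>.
  Uniqueness has to be shown among all limits in \<open>M_inf A\<close>, as required by the definite
  description in \<open>cfc\<close>.\<close>

lemma cutdown_M_inf:
  assumes a: "a \<in> mat_carrier n A" "a \<in> positive (M_inf A)" and e: "0 < \<epsilon>"
  shows "cutdown (M_inf A) a \<epsilon> = unital_cstar.cutoff (M_n n A) a \<epsilon>"
proof -
  interpret N: unital_cstar "M_n n A" by (rule M_n_unital_cstar)
  have ac: "a \<in> carrier (M_n n A)" "a \<in> positive (M_n n A)" using a positive_M_inf by auto
  have s: "a \<in> N.selfadj" using ac(2) by (rule N.pos_selfadj)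
  define f where "f = (\<lambda>t::real. max 0 (t - \<epsilon>))"
  have f: "continuous_on UNIV f" unfolding f_def by (intro continuous_intros)
  have c: "N.cutoff a \<epsilon> = N.cf a f" by (simp add: N.cutoff_def f_def)
  have spec: "{t. complex_of_real t \<in> spec (M_inf A) a} = insert 0 (N.spr a)"
    using spec_M_inf[OF a(1)] N.spec_eq[OF ac(1)] by (auto simp: N.spr_def)
  have conv: "Mi.conv (\<lambda>k. poly_eval (M_inf A) (p k) a) (N.cf a f)"
    if "uniform_limit (insert 0 (N.spr a)) (\<lambda>n t. t * poly (p n) t) f sequentially" for p
  proof -
    have "uniform_limit (N.spr a) (\<lambda>n. poly (pCons 0 (p n))) f sequentially"
    proof -
      have "poly (pCons 0 (p n)) = (\<lambda>t. t * poly (p n) t)" for n by (simp add: fun_eq_iff)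
      then show ?thesis using uniform_limit_on_subset[OF that, of "N.spr a"] by auto
    qed
    then have "N.conv (\<lambda>k. N.ev a (cpoly (pCons 0 (p k)))) (N.cf a f)" by (rule N.cf_conv[OF s f])
    then have "N.conv (\<lambda>k. poly_eval (M_inf A) (p k) a) (N.cf a f)"
      using poly_eval_M_inf[OF a(1)] N.poly_eval_ev[OF ac(1)] by simp
    then show ?thesis
      unfolding N.conv_def Mi.conv_def by (auto simp: M_n_diff')
  qed
  have "has_cfc (M_inf A) f a (N.cf a f)"
  proof -
    \<comment> \<open>The set \<open>spec\<close> contains \<open>0\<close> in any case, so uniform
      convergence has to include that point.\<close>
    have "insert 0 (N.spr a) \<subseteq> {- cnorm (M_n n A) a..cnorm (M_n n A) a}"
      using N.spr_bound[OF ac(1)] N.norm_ge_0[OF ac(1)] by (auto simp: abs_le_iff minus_le_iff)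
    then obtain p where p: "uniform_limit (insert 0 (N.spr a)) (\<lambda>n t. t * poly (p n) t) f sequentially"
      using cutoff_poly[OF e, of "cnorm (M_n n A) a"] uniform_limit_on_subset unfolding f_def by blast
    show ?thesis unfolding has_cfc_def spec using p conv[OF p] by (auto simp: Mi.conv_def)
  qed
  moreover have "d = N.cf a f" if hc: "has_cfc (M_inf A) f a d" for d
  proof -
    obtain p where p: "uniform_limit (insert 0 (N.spr a)) (\<lambda>n t. t * poly (p n) t) f sequentially"
      "(\<lambda>n. cnorm (M_inf A) (poly_eval (M_inf A) (p n) a \<ominus>\<^bsub>M_inf A\<^esub> d)) \<longlonglongrightarrow> 0" "d \<in> carrier (M_inf A)"
      using hc unfolding has_cfc_def spec by auto
    have "Mi.conv (\<lambda>k. poly_eval (M_inf A) (p k) a) d"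
      using p(2,3) conv[OF p(1)] by (simp add: Mi.conv_def)
    then show ?thesis using conv[OF p(1)] Mi.conv_unique by blast
  qed
  ultimately have "cfc (M_inf A) f a = N.cf a f" unfolding cfc_def by (rule the_equality)
  then show ?thesis by (simp add: cutdown_def c f_def)
qed

end

section \<open>Cuntz comparison\<close>

context pre_cstar
begin

text \<open>The epsilon form of \<open>cuntz_le\<close>; the two agree by
  \<open>cuntz_le_czle\<close>.\<close>

definition czle :: "'a \<Rightarrow> 'a \<Rightarrow> bool" where
  "czle a b \<longleftrightarrow> (\<forall>e>0. \<exists>v\<in>carrier A. cnorm A (v \<otimes> b \<otimes> star A v \<ominus> a) < e)"

lemma czle_exact: "v \<in> carrier A \<Longrightarrow> a = v \<otimes> b \<otimes> star A v \<Longrightarrow> b \<in> carrier A \<Longrightarrow> czle a b"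
  unfolding czle_def by (intro allI impI bexI[of _ v]) simp_all

lemma czle_trans:
  assumes ab: "czle a b" and bc: "czle b c" and c: "a \<in> carrier A" "b \<in> carrier A" "c \<in> carrier A"
  shows "czle a c"
  unfolding czle_def
proof (intro allI impI)
  fix e :: real assume e: "0 < e"
  obtain v where v: "v \<in> carrier A" "cnorm A (v \<otimes> b \<otimes> star A v \<ominus> a) < e / 2"
    using ab e unfolding czle_def by (meson half_gt_zero)
  \<comment> \<open>Conjugation by \<open>v\<close> multiplies the error by at most the square of
    its norm. The added one avoids division by zero.\<close>
  define d where "d = e / (2 * ((cnorm A v)\<^sup>2 + 1))"
  have d: "0 < d" using e by (simp add: d_def add_nonneg_pos)
  obtain w where w: "w \<in> carrier A" "cnorm A (w \<otimes> c \<otimes> star A w \<ominus> b) < d"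
    using bc d unfolding czle_def by blast
  let ?x = "w \<otimes> c \<otimes> star A w \<ominus> b"
  have x: "?x \<in> carrier A" using w c by simp
  have "(v \<otimes> w) \<otimes> c \<otimes> star A (v \<otimes> w) \<ominus> a = v \<otimes> ?x \<otimes> star A v \<oplus> (v \<otimes> b \<otimes> star A v \<ominus> a)"
    using v w c by (simp add: m_assoc l_diff r_diff) (simp add: diff_sm a_ac add_cancels)
  then have "cnorm A ((v \<otimes> w) \<otimes> c \<otimes> star A (v \<otimes> w) \<ominus> a)
    \<le> cnorm A (v \<otimes> ?x \<otimes> star A v) + cnorm A (v \<otimes> b \<otimes> star A v \<ominus> a)"
    using norm_add[of "v \<otimes> ?x \<otimes> star A v" "v \<otimes> b \<otimes> star A v \<ominus> a"] v x c by simp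
  also have "cnorm A (v \<otimes> ?x \<otimes> star A v) \<le> (cnorm A v * cnorm A ?x) * cnorm A v"
    using norm_mult[of "v \<otimes> ?x" "star A v"] norm_mult[of v ?x] mult_right_mono[OF norm_mult[of v ?x], of "cnorm A v"] v x by simp
  also have "\<dots> \<le> (cnorm A v)\<^sup>2 * d"
    using mult_left_mono[OF less_imp_le[OF w(2)], of "(cnorm A v)\<^sup>2"] by (simp add: power2_eq_square algebra_simps)
  also have "\<dots> \<le> ((cnorm A v)\<^sup>2 + 1) * d" using d by simp
  also have "\<dots> = e / 2"
  proof -
    have "K * (e / (2 * K)) = e / 2" if "K \<noteq> 0" for K :: real using that by simp
    moreover have "(cnorm A v)\<^sup>2 + 1 \<noteq> 0" by (smt (verit) zero_le_power2)
    ultimately show ?thesis unfolding d_def by blast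
  qed
  finally have "cnorm A ((v \<otimes> w) \<otimes> c \<otimes> star A (v \<otimes> w) \<ominus> a) < e" using v(2) by linarith
  then show "\<exists>v\<in>carrier A. cnorm A (v \<otimes> c \<otimes> star A v \<ominus> a) < e" using v w by blast
qed

text \<open>\<open>P\<close> acts as a unit on \<open>x\<close>, while \<open>S\<close> carries
  \<open>y\<close> to a place annihilated by \<open>P\<close>. All cross terms vanish, so one
  element acts as \<open>c\<close> on the first summand and as \<open>d\<close> on the
  second.\<close>

lemma orth_sum_conj:
  assumes c: "x \<in> carrier A" "y \<in> carrier A" "P \<in> carrier A" "S \<in> carrier A" "c \<in> carrier A" "d \<in> carrier A"
    and P: "star A P = P" "P \<otimes> x = x" "x \<otimes> P = x" "P \<otimes> S = \<zero>"
    and S: "star A S \<otimes> S = E" "E \<in> carrier A" "E \<otimes> y = y" "y \<otimes> E = y"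
  shows "(c \<otimes> P \<oplus> d \<otimes> star A S) \<otimes> (x \<oplus> S \<otimes> y \<otimes> star A S) \<otimes> star A (c \<otimes> P \<oplus> d \<otimes> star A S)
    = c \<otimes> x \<otimes> star A c \<oplus> d \<otimes> y \<otimes> star A d"
proof -
  have SP: "star A S \<otimes> P = \<zero>" using star_mult[of P S] P(1,4) c by simp
  have 1: "star A S \<otimes> x = \<zero>" using m_assoc[of "star A S" P x] SP P(2) c by simp
  have 2: "x \<otimes> S = \<zero>" using m_assoc[of x P S] P c by simp
  have 3: "P \<otimes> (S \<otimes> w) = \<zero>" if "w \<in> carrier A" for w using m_assoc[of P S w] P c that by simp
  have 4: "star A S \<otimes> (S \<otimes> (y \<otimes> w)) = y \<otimes> w" if "w \<in> carrier A" for w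
    using m_assoc[of "star A S" S "y \<otimes> w"] m_assoc[of E y w] S c that by simp
  have 5: "star A S \<otimes> (P \<otimes> w) = \<zero>" if "w \<in> carrier A" for w
    unfolding m_assoc[OF star_closed[OF c(4)] c(3) that, symmetric] SP using that by simp
  have 6: "y \<otimes> (star A S \<otimes> (S \<otimes> w)) = y \<otimes> w" if "w \<in> carrier A" for w
    using m_assoc[of "star A S" S w] m_assoc[of y E w] S c that by simp
  have 7: "x \<otimes> (P \<otimes> w) = x \<otimes> w" "x \<otimes> (S \<otimes> w) = \<zero>" if "w \<in> carrier A" for w
    using m_assoc[of x P w] m_assoc[of x S w] P 2 c that by simp_all
  have 8: "star A S \<otimes> (x \<otimes> w) = \<zero>" "P \<otimes> (x \<otimes> w) = x \<otimes> w" if "w \<in> carrier A" for w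
    using m_assoc[of "star A S" x w] m_assoc[of P x w] P 1 c that by simp_all
  show ?thesis using c P(1)
    by (simp add: l_distr r_distr m_assoc 1 2 3 4 5 6 7 8)
qed

text \<open>Monotonicity of direct sums without reference to block matrices: \<open>v\<close> and
  \<open>w\<close> realize the two comparisons, and \<open>vP + (Tw)S\<^sup>*\<close> realizes both
  at once.\<close>

lemma czle_sum:
  assumes c: "x \<in> carrier A" "y \<in> carrier A" "P \<in> carrier A" "S \<in> carrier A" "a \<in> carrier A" "b \<in> carrier A" "T \<in> carrier A"
    and P: "star A P = P" "P \<otimes> x = x" "x \<otimes> P = x" "P \<otimes> S = \<zero>"
    and S: "star A S \<otimes> S = E" "E \<in> carrier A" "E \<otimes> y = y" "y \<otimes> E = y"
    and ax: "czle a x" and b: "czle b y"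
  shows "czle (a \<oplus> T \<otimes> b \<otimes> star A T) (x \<oplus> S \<otimes> y \<otimes> star A S)"
  unfolding czle_def
proof (intro allI impI)
  fix e :: real assume e: "0 < e"
  obtain v where v: "v \<in> carrier A" "cnorm A (v \<otimes> x \<otimes> star A v \<ominus> a) < e / 2"
    using ax e unfolding czle_def by (meson half_gt_zero)
  define t where "t = e / (2 * ((cnorm A T)\<^sup>2 + 1))"
  have t: "0 < t" using e by (simp add: t_def add_nonneg_pos)
  obtain w where w: "w \<in> carrier A" "cnorm A (w \<otimes> y \<otimes> star A w \<ominus> b) < t"
    using b t unfolding czle_def by blast
  let ?V = "v \<otimes> P \<oplus> (T \<otimes> w) \<otimes> star A S"
  let ?u = "v \<otimes> x \<otimes> star A v" and ?z = "w \<otimes> y \<otimes> star A w"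
  have uz: "?u \<in> carrier A" "?z \<in> carrier A" using v w c by auto
  have eq: "?V \<otimes> (x \<oplus> S \<otimes> y \<otimes> star A S) \<otimes> star A ?V = ?u \<oplus> T \<otimes> ?z \<otimes> star A T"
    using orth_sum_conj[OF c(1-4) v(1) _ P S, of "T \<otimes> w"] c w by (simp add: m_assoc)
  have "(?u \<oplus> T \<otimes> ?z \<otimes> star A T) \<ominus> (a \<oplus> T \<otimes> b \<otimes> star A T) = (?u \<ominus> a) \<oplus> T \<otimes> (?z \<ominus> b) \<otimes> star A T"
  proof -
    have "(p \<oplus> q) \<ominus> (r \<oplus> s) = (p \<ominus> r) \<oplus> (q \<ominus> s)" if "p \<in> carrier A" "q \<in> carrier A" "r \<in> carrier A" "s \<in> carrier A" for p q r s
      using that by (simp add: diff_sm sm_add_right a_ac)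
    moreover have "T \<otimes> (?z \<ominus> b) \<otimes> star A T = T \<otimes> ?z \<otimes> star A T \<ominus> T \<otimes> b \<otimes> star A T"
      using uz c by (simp only: l_diff r_diff m_closed star_closed)
    ultimately show ?thesis using uz c by simp
  qed
  then have "cnorm A (?V \<otimes> (x \<oplus> S \<otimes> y \<otimes> star A S) \<otimes> star A ?V \<ominus> (a \<oplus> T \<otimes> b \<otimes> star A T))
     \<le> cnorm A (?u \<ominus> a) + cnorm A (T \<otimes> (?z \<ominus> b) \<otimes> star A T)"
    unfolding eq using norm_add[of "?u \<ominus> a" "T \<otimes> (?z \<ominus> b) \<otimes> star A T"] uz c by simp
  also have "cnorm A (T \<otimes> (?z \<ominus> b) \<otimes> star A T) \<le> (cnorm A T * cnorm A (?z \<ominus> b)) * cnorm A T"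
    using norm_mult[of "T \<otimes> (?z \<ominus> b)" "star A T"] mult_right_mono[OF norm_mult[of T "?z \<ominus> b"], of "cnorm A T"] uz c by simp
  also have "\<dots> \<le> (cnorm A T)\<^sup>2 * t"
    using mult_left_mono[OF less_imp_le[OF w(2)], of "(cnorm A T)\<^sup>2"] by (simp add: power2_eq_square algebra_simps)
  also have "\<dots> \<le> ((cnorm A T)\<^sup>2 + 1) * t" using t by simp
  also have "\<dots> = e / 2"
  proof -
    have "K * (e / (2 * K)) = e / 2" if "K \<noteq> 0" for K :: real using that by simp
    moreover have "(cnorm A T)\<^sup>2 + 1 \<noteq> 0" by (smt (verit) zero_le_power2)
    ultimately show ?thesis unfolding t_def by blast
  qed
  finally have "cnorm A (?V \<otimes> (x \<oplus> S \<otimes> y \<otimes> star A S) \<otimes> star A ?V \<ominus> (a \<oplus> T \<otimes> b \<otimes> star A T)) < e"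
    using v(2) by linarith
  then show "\<exists>v\<in>carrier A. cnorm A (v \<otimes> (x \<oplus> S \<otimes> y \<otimes> star A S) \<otimes> star A v \<ominus> (a \<oplus> T \<otimes> b \<otimes> star A T)) < e"
    using v w c by (intro bexI[of _ ?V]) auto
qed

end

context unital_cstar
begin

lemma cuntz_le_czle:
  assumes ab: "a \<in> carrier (M_inf A)" "b \<in> carrier (M_inf A)"
  shows "cuntz_le A a b \<longleftrightarrow> Mi.czle a b"
proof
  assume "cuntz_le A a b"
  then obtain v where v: "\<And>n. v n \<in> carrier (M_inf A)"
    "(\<lambda>n. cnorm (M_inf A) ((v n \<otimes>\<^bsub>M_inf A\<^esub> b \<otimes>\<^bsub>M_inf A\<^esub> star (M_inf A) (v n)) \<ominus>\<^bsub>M_inf A\<^esub> a)) \<longlonglongrightarrow> 0"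
    by (auto simp: cuntz_le_def)
  show "Mi.czle a b"
    unfolding Mi.czle_def
  proof (intro allI impI)
    fix e :: real assume "0 < e"
    then have "\<forall>\<^sub>F n in sequentially. cnorm (M_inf A) ((v n \<otimes>\<^bsub>M_inf A\<^esub> b \<otimes>\<^bsub>M_inf A\<^esub> star (M_inf A) (v n)) \<ominus>\<^bsub>M_inf A\<^esub> a) < e"
      using v(2) by (rule order_tendstoD(2)[rotated])
    from eventually_happens'[OF sequentially_bot this] v(1)
    show "\<exists>w\<in>carrier (M_inf A). cnorm (M_inf A) ((w \<otimes>\<^bsub>M_inf A\<^esub> b \<otimes>\<^bsub>M_inf A\<^esub> star (M_inf A) w) \<ominus>\<^bsub>M_inf A\<^esub> a) < e" by blast
  qed
next
  let ?d = "\<lambda>w. cnorm (M_inf A) ((w \<otimes>\<^bsub>M_inf A\<^esub> b \<otimes>\<^bsub>M_inf A\<^esub> star (M_inf A) w) \<ominus>\<^bsub>M_inf A\<^esub> a)"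
  assume "Mi.czle a b"
  then have "\<exists>w. w \<in> carrier (M_inf A) \<and> ?d w < 1 / real (Suc n)" for n
    unfolding Mi.czle_def by (metis of_nat_0_less_iff zero_less_Suc zero_less_divide_1_iff)
  then obtain v where v: "\<And>n. v n \<in> carrier (M_inf A)" "\<And>n. ?d (v n) < 1 / real (Suc n)" by metis
  have le: "norm (?d (v n)) \<le> 1 / real (Suc n)" for n
    using v(1)[of n] v(2)[of n] ab Mi.norm_ge_0[of "v n \<otimes>\<^bsub>M_inf A\<^esub> b \<otimes>\<^bsub>M_inf A\<^esub> star (M_inf A) (v n) \<ominus>\<^bsub>M_inf A\<^esub> a"] by simp
  have lim: "(\<lambda>n. 1 / real (Suc n)) \<longlonglongrightarrow> 0" using LIMSEQ_inverse_real_of_nat by (simp add: inverse_eq_divide)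
  have "(\<lambda>n. ?d (v n)) \<longlonglongrightarrow> 0" by (rule Lim_null_comparison[OF always_eventually[OF allI[OF le]] lim])
  then show "cuntz_le A a b" unfolding cuntz_le_def using v(1) by blast
qed

end

primrec block_power :: "'a star_alg \<Rightarrow> nat \<Rightarrow> nat \<Rightarrow> 'a inf_mat \<Rightarrow> 'a inf_mat" where
  "block_power A n 0 b = (\<lambda>i j. \<zero>\<^bsub>A\<^esub>)"
| "block_power A n (Suc k) b = block_diag A (k * n) (block_power A n k b) b"

section \<open>Block matrices by corner units and shifts\<close>

context unital_cstar
begin

abbreviation Mmult (infixl \<open>\<star>\<close> 70) where "x \<star> y \<equiv> x \<otimes>\<^bsub>M_inf A\<^esub> y"
abbreviation Mstar where "Mstar x \<equiv> star (M_inf A) x"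
abbreviation Mplus (infixl \<open>\<boxplus>\<close> 65) where "x \<boxplus> y \<equiv> x \<oplus>\<^bsub>M_inf A\<^esub> y"
abbreviation Mzero where "Mzero \<equiv> \<zero>\<^bsub>M_inf A\<^esub>"
abbreviation Mcarrier where "Mcarrier \<equiv> carrier (M_inf A)"
abbreviation czle_Mi (infix \<open>\<preceq>\<close> 50) where "a \<preceq> b \<equiv> Mi.czle a b"

text \<open>The unit of \<open>M_n n A\<close>, used in \<open>M_inf A\<close> as a projection that
  acts as a unit on matrices of size \<open>n\<close>.\<close>

definition E :: "nat \<Rightarrow> 'a inf_mat" where "E n = (\<lambda>i j. if i = j \<and> i < n then \<one> else \<zero>)"

text \<open>The partial isometry that moves the first \<open>N\<close> coordinates behind the first
  \<open>n\<close> ones.\<close>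

definition Sh :: "nat \<Rightarrow> nat \<Rightarrow> 'a inf_mat" where "Sh n N = (\<lambda>i j. if i = j + n \<and> j < N then \<one> else \<zero>)"

lemma E_mc: "E n \<in> mat_carrier n A" unfolding E_def by (rule mc_one)

lemma Sh_mc: "Sh n N \<in> mat_carrier (n + N) A" unfolding Sh_def by (rule mcI) auto

lemma E_Mi [simp]: "E n \<in> Mcarrier" and Sh_Mi [simp]: "Sh n N \<in> Mcarrier"
  using E_mc Sh_mc mc_Mi by blast+

text \<open>A matrix with at most one non-zero entry per row, equal to the unit, only selects rows;
  this covers \<open>E\<close>, \<open>Sh\<close>, its adjoint and matrix units.\<close>

lemma sel_mult:
  assumes x: "x \<in> Mcarrier" and y: "y \<in> Mcarrier" and xs: "\<And>i k. x i k = (if Q i \<and> k = f i then \<one> else \<zero>)"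
  shows "x \<star> y = (\<lambda>i j. if Q i then y (f i) j else \<zero>)"
proof (intro ext)
  fix i j
  obtain N where N: "x \<in> mat_carrier N A" "y \<in> mat_carrier N A" using common_size[OF x y] .
  have "mm N x y i j = (if Q i then y (f i) j else \<zero>)"
  proof (cases "Q i \<and> f i < N")
    case True
    have "mm N x y i j = x i (f i) \<otimes> y (f i) j"
      unfolding mm_def by (rule fs_single) (use True N in \<open>auto simp: xs\<close>)
    then show ?thesis using True N by (simp add: xs)
  next
    case False
    have "mm N x y i j = \<zero>" unfolding mm_def by (rule fs_zero) (use False N in \<open>auto simp: xs\<close>)
    moreover have "y (f i) j = \<zero>" if "Q i" using mcD(2)[OF N(2), of "f i" j] False that by auto
    ultimately show ?thesis by simp
  qed
  then show "(x \<star> y) i j = (if Q i then y (f i) j else \<zero>)" using mult_mm[OF N] by simp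
qed

lemma E_mult: "y \<in> Mcarrier \<Longrightarrow> E n \<star> y = (\<lambda>i j. if i < n then y i j else \<zero>)"
  by (rule sel_mult[OF E_Mi, where f = "\<lambda>i. i"]) (auto simp: E_def)

lemma Mstar_E [simp]: "Mstar (E n) = E n"
  by (auto simp: M_inf_simps E_def fun_eq_iff)

lemma E_unit [simp]: assumes "x \<in> mat_carrier n A" shows "E n \<star> x = x" "x \<star> E n = x"
proof -
  interpret N: unital_cstar "M_n n A" by (rule M_n_unital_cstar)
  show "E n \<star> x = x" "x \<star> E n = x" using N.l_one[of x] N.r_one[of x] assms by (simp_all add: E_def)
qed

lemma E_Sh: "E n \<star> Sh n N = Mzero"
  by (subst E_mult[OF Sh_Mi]) (auto simp: M_inf_simps(4) Sh_def fun_eq_iff)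

lemma Sh_mult: "y \<in> Mcarrier \<Longrightarrow> Sh n N \<star> y = (\<lambda>i j. if n \<le> i \<and> i - n < N then y (i - n) j else \<zero>)"
  by (rule sel_mult[OF Sh_Mi]) (auto simp: Sh_def)

lemma Sh_star_Sh: "Mstar (Sh n N) \<star> Sh n N = E N"
proof -
  have "Mstar (Sh n N) \<star> Sh n N = (\<lambda>i j. if i < N then Sh n N (i + n) j else \<zero>)"
    by (rule sel_mult[OF Mi.star_closed[OF Sh_Mi] Sh_Mi]) (auto simp: Sh_def M_inf_simps(6))
  then show ?thesis by (auto simp: Sh_def E_def fun_eq_iff)
qed

lemma Sh_conj:
  assumes b: "b \<in> mat_carrier N A"
  shows "Sh n N \<star> b \<star> Mstar (Sh n N) = (\<lambda>i j. if n \<le> i \<and> n \<le> j then b (i - n) (j - n) else \<zero>)"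
proof -
  have bc: "b \<in> Mcarrier" using b by blast
  have e: "Sh n N \<star> b = (\<lambda>i j. if n \<le> i then b (i - n) j else \<zero>)"
    using Sh_mult[OF bc] mcD(2)[OF b] by (auto simp: fun_eq_iff)
  have c: "Mstar (Sh n N \<star> b) \<in> Mcarrier" using bc by simp
  \<comment> \<open>Multiplication from the right is reduced to \<open>Sh_mult\<close> by passing to
    adjoints.\<close>
  have "Mstar (Sh n N \<star> Mstar (Sh n N \<star> b)) = Sh n N \<star> b \<star> Mstar (Sh n N)" using bc by simp
  moreover have "Mstar (Sh n N \<star> Mstar (Sh n N \<star> b)) = (\<lambda>i j. if n \<le> i \<and> n \<le> j then b (i - n) (j - n) else \<zero>)"
    unfolding Sh_mult[OF c] unfolding e using b mcD(3)[OF b] by (auto simp: M_inf_simps(6) fun_eq_iff)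
  ultimately show ?thesis by simp
qed

lemma block_diag_eq:
  assumes a: "a \<in> mat_carrier n A" and b: "b \<in> mat_carrier N A"
  shows "block_diag A n a b = a \<boxplus> Sh n N \<star> b \<star> Mstar (Sh n N)"
  unfolding Sh_conj[OF b] M_inf_simps(3) block_diag_def
  using a b mcD(2,3)[OF a] by (auto simp: fun_eq_iff)

lemma block_mc: "a \<in> mat_carrier n A \<Longrightarrow> b \<in> mat_carrier N A \<Longrightarrow> block_diag A n a b \<in> mat_carrier (n + N) A"
  unfolding block_diag_def by (rule mcI) (auto simp: mcD(2,3)[of _ n] mcD(2,3)[of _ N])

lemma block_closed: "a \<in> mat_carrier n A \<Longrightarrow> b \<in> Mcarrier \<Longrightarrow> block_diag A n a b \<in> Mcarrier"
  using block_mc mc_Mi unfolding M_inf_carrier by blast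

lemma block_assoc:
  "a \<in> mat_carrier n A \<Longrightarrow> b \<in> mat_carrier N A \<Longrightarrow>
    block_diag A (n + N) (block_diag A n a b) c = block_diag A n a (block_diag A N b c)"
  by (auto simp: block_diag_def fun_eq_iff mcD(2,3)[of _ n] mcD(2,3)[of _ N] diff_diff_left[symmetric] simp del: diff_diff_left)

lemma block_zero: "a \<in> mat_carrier n A \<Longrightarrow> block_diag A n a (\<lambda>i j. \<zero>) = a" "block_diag A 0 a b = b"
  by (auto simp: block_diag_def fun_eq_iff mcD(2,3)[of _ n])

text \<open>The free choice of \<open>c\<close> and \<open>d\<close> is the point: shifts give the
  commutativity of direct sums, scalars give the comparison with ordinary sums.\<close>

lemma block_orth:
  assumes a: "a \<in> mat_carrier n A" and b: "b \<in> mat_carrier N A" and c: "c \<in> Mcarrier" and d: "d \<in> Mcarrier"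
  shows "c \<star> a \<star> Mstar c \<boxplus> d \<star> b \<star> Mstar d \<preceq> block_diag A n a b"
proof (rule Mi.czle_exact)
  have ab: "a \<in> Mcarrier" "b \<in> Mcarrier" using a b by auto
  show "c \<star> E n \<boxplus> d \<star> Mstar (Sh n N) \<in> Mcarrier" using c d by simp
  show "c \<star> a \<star> Mstar c \<boxplus> d \<star> b \<star> Mstar d
    = (c \<star> E n \<boxplus> d \<star> Mstar (Sh n N)) \<star> block_diag A n a b \<star> Mstar (c \<star> E n \<boxplus> d \<star> Mstar (Sh n N))"
    unfolding block_diag_eq[OF a b]
    using Mi.orth_sum_conj[OF ab E_Mi Sh_Mi c d Mstar_E E_unit[OF a] E_Sh Sh_star_Sh E_Mi E_unit[OF b]] by simp
  show "block_diag A n a b \<in> Mcarrier" using block_mc[OF a b] by blast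
qed

text \<open>In the absence of a unit, \<open>E n\<close> for a size \<open>n\<close> containing the
  matrix takes its place.\<close>

lemma Mi_refl: "a \<in> Mcarrier \<Longrightarrow> a \<preceq> a"
proof -
  assume "a \<in> Mcarrier"
  then obtain n where "a \<in> mat_carrier n A" unfolding M_inf_carrier by blast
  then show ?thesis by (intro Mi.czle_exact[of "E n"]) auto
qed

lemma block_mono:
  assumes "x \<in> mat_carrier n A" "y \<in> Mcarrier" "a \<in> mat_carrier n' A" "b \<in> Mcarrier" "a \<preceq> x" "b \<preceq> y"
  shows "block_diag A n' a b \<preceq> block_diag A n x y"
proof -
  obtain N where y: "y \<in> mat_carrier N A" using assms unfolding M_inf_carrier by blast
  obtain N' where b: "b \<in> mat_carrier N' A" using assms unfolding M_inf_carrier by blast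
  have c: "x \<in> Mcarrier" "a \<in> Mcarrier" using assms by auto
  show ?thesis
    unfolding block_diag_eq[OF assms(1) y] block_diag_eq[OF assms(3) b]
    by (rule Mi.czle_sum[OF c(1) assms(2) E_Mi Sh_Mi c(2) assms(4) Sh_Mi Mstar_E E_unit[OF assms(1)] E_Sh Sh_star_Sh E_Mi E_unit[OF y] assms(5,6)])
qed

lemma block_comm:
  assumes a: "a \<in> mat_carrier n A" and b: "b \<in> mat_carrier N A"
  shows "block_diag A N b a \<preceq> block_diag A n a b"
proof -
  have ab: "a \<in> Mcarrier" "b \<in> Mcarrier" using a b by auto
  have "Sh N n \<star> a \<star> Mstar (Sh N n) \<boxplus> E N \<star> b \<star> Mstar (E N) \<preceq> block_diag A n a b"
    by (rule block_orth[OF a b]) auto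
  then show ?thesis using a b ab by (simp add: block_diag_eq[OF b a] Mi.a_comm)
qed

text \<open>This converts the sum in \<open>compress_le\<close>, whose second coefficient depends on
  \<open>\<parallel>a\<parallel>\<close>, into a direct sum in which the coefficients have
  disappeared.\<close>

lemma block_scaled_sum:
  assumes a: "a \<in> mat_carrier n A" and b: "b \<in> mat_carrier n A" and r: "0 \<le> r" "0 \<le> s"
  shows "complex_of_real r \<odot>\<^bsub>M_inf A\<^esub> a \<boxplus> complex_of_real s \<odot>\<^bsub>M_inf A\<^esub> b \<preceq> block_diag A n a b"
proof -
  let ?c = "complex_of_real (sqrt r) \<odot>\<^bsub>M_inf A\<^esub> E n" and ?d = "complex_of_real (sqrt s) \<odot>\<^bsub>M_inf A\<^esub> E n"
  have "?c \<star> a \<star> Mstar ?c \<boxplus> ?d \<star> b \<star> Mstar ?d \<preceq> block_diag A n a b"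
    by (rule block_orth[OF a b]) auto
  then show ?thesis using a b r mc_Mi[OF a] mc_Mi[OF b] by (simp flip: of_real_mult)
qed

lemma zero_le: "b \<in> Mcarrier \<Longrightarrow> Mzero \<preceq> b"
  by (rule Mi.czle_exact[of Mzero]) auto

lemma le_zero: assumes "a \<preceq> Mzero" "a \<in> Mcarrier" shows "a = Mzero"
proof -
  have "cnorm (M_inf A) a < e" if e: "0 < e" for e
  proof -
    obtain v where "v \<in> Mcarrier" "cnorm (M_inf A) (v \<star> Mzero \<star> Mstar v \<ominus>\<^bsub>M_inf A\<^esub> a) < e"
      using assms(1) e unfolding Mi.czle_def by blast
    then show ?thesis using assms(2) by (simp add: Mi.diff_sm Mi.norm_sm)
  qed
  then have "cnorm (M_inf A) a = 0" using Mi.norm_ge_0[OF assms(2)] by (metis less_irrefl order_le_less)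
  then show ?thesis using Mi.norm_eq_0[OF assms(2)] by simp
qed

lemma Mpos_Mi [intro]: "a \<in> positive (M_inf A) \<Longrightarrow> a \<in> Mcarrier"
  by (simp add: positive_def)

lemma Mpos_cases:
  assumes "a \<in> positive (M_inf A)" obtains n where "a \<in> mat_carrier n A" "a \<in> positive (M_n n A)"
  using assms positive_M_inf Mpos_Mi[OF assms] unfolding M_inf_carrier by blast

lemma Mpos_conj:
  assumes b: "b \<in> positive (M_inf A)" and x: "x \<in> Mcarrier" shows "x \<star> b \<star> Mstar x \<in> positive (M_inf A)"
proof -
  obtain N where N: "b \<in> mat_carrier N A" "x \<in> mat_carrier N A" using common_size[OF Mpos_Mi[OF b] x] .
  interpret N: unital_cstar "M_n N A" by (rule M_n_unital_cstar)
  have xs: "Mstar x \<in> mat_carrier N A" using N.star_closed[of x] N by simp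
  have "star (M_n N A) (Mstar x) \<otimes>\<^bsub>M_n N A\<^esub> (b \<otimes>\<^bsub>M_n N A\<^esub> Mstar x) \<in> positive (M_n N A)"
    using b N xs positive_M_inf[OF N(1)] by (intro N.conj_pos) auto
  then have "x \<star> (b \<star> Mstar x) \<in> positive (M_n N A)" using x by simp
  moreover have "x \<star> (b \<star> Mstar x) \<in> mat_carrier N A" using N.pos_closed[OF calculation] by simp
  ultimately have "x \<star> (b \<star> Mstar x) \<in> positive (M_inf A)" using positive_M_inf by blast
  then show ?thesis using x b by (simp add: Mi.m_assoc Mpos_Mi)
qed

lemma Mpos_add:
  assumes a: "a \<in> positive (M_inf A)" and b: "b \<in> positive (M_inf A)" shows "a \<boxplus> b \<in> positive (M_inf A)"
proof -
  obtain N where N: "a \<in> mat_carrier N A" "b \<in> mat_carrier N A" using common_size[OF Mpos_Mi[OF a] Mpos_Mi[OF b]] .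
  interpret N: unital_cstar "M_n N A" by (rule M_n_unital_cstar)
  have "a \<oplus>\<^bsub>M_n N A\<^esub> b \<in> positive (M_n N A)" using a b positive_M_inf N by (intro N.pos_add) auto
  then have "a \<boxplus> b \<in> positive (M_n N A)" by simp
  moreover have "a \<boxplus> b \<in> mat_carrier N A" using N.pos_closed[OF calculation] by simp
  ultimately show ?thesis using positive_M_inf by blast
qed

lemma Mpos_zero: "Mzero \<in> positive (M_inf A)"
proof -
  interpret N: unital_cstar "M_n 0 A" by (rule M_n_unital_cstar)
  show ?thesis using N.zero_pos positive_M_inf[OF mc_zero, of 0] by (simp add: M_inf_simps(4))
qed

lemma block_pos:
  assumes a: "a \<in> mat_carrier n A" "a \<in> positive (M_inf A)" and b: "b \<in> positive (M_inf A)"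
  shows "block_diag A n a b \<in> positive (M_inf A)"
proof -
  obtain N where N: "b \<in> mat_carrier N A" using b by (rule Mpos_cases)
  show ?thesis unfolding block_diag_eq[OF a(1) N] using a b by (intro Mpos_add Mpos_conj) auto
qed

lemma class_iff: "a \<in> positive (M_inf A) \<Longrightarrow> x \<in> cuntz_class A a \<longleftrightarrow> x \<in> positive (M_inf A) \<and> x \<preceq> a \<and> a \<preceq> x"
  unfolding cuntz_class_def cuntz_equiv_def using cuntz_le_czle[OF Mpos_Mi Mpos_Mi] by blast

lemma Mi_trans: "a \<preceq> b \<Longrightarrow> b \<preceq> c \<Longrightarrow> a \<in> Mcarrier \<Longrightarrow> b \<in> Mcarrier \<Longrightarrow> c \<in> Mcarrier \<Longrightarrow> a \<preceq> c"
  by (rule Mi.czle_trans)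

lemma class_self: "a \<in> positive (M_inf A) \<Longrightarrow> a \<in> cuntz_class A a"
  by (simp add: class_iff Mi_refl Mpos_Mi)

lemma class_eq:
  assumes "a \<in> positive (M_inf A)" "b \<in> positive (M_inf A)" "a \<preceq> b" "b \<preceq> a" shows "cuntz_class A a = cuntz_class A b"
proof -
  have "x \<preceq> b \<and> b \<preceq> x \<longleftrightarrow> x \<preceq> a \<and> a \<preceq> x" if "x \<in> positive (M_inf A)" for x
    using Mi_trans[of x a b] Mi_trans[of b a x] Mi_trans[of x b a] Mi_trans[of a b x] assms that
    by (auto intro: Mpos_Mi)
  then show ?thesis using class_iff[OF assms(1)] class_iff[OF assms(2)] by blast
qed

text \<open>The union in \<open>class_add\<close> runs over all representatives and block sizes; by
  \<open>block_mono\<close> they all contribute the same class.\<close>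

lemma class_add_block:
  assumes a: "a \<in> positive (M_inf A)" "a \<in> mat_carrier n A" and b: "b \<in> positive (M_inf A)"
  shows "class_add A (cuntz_class A a) (cuntz_class A b) = cuntz_class A (block_diag A n a b)"
proof -
  have "cuntz_class A (block_diag A n' a' b') = cuntz_class A (block_diag A n a b)"
    if "a' \<in> cuntz_class A a" "b' \<in> cuntz_class A b" "a' \<in> mat_carrier n' A" for a' b' n'
  proof -
    have p: "a' \<in> positive (M_inf A)" "a' \<preceq> a" "a \<preceq> a'" "b' \<in> positive (M_inf A)" "b' \<preceq> b" "b \<preceq> b'"
      using that class_iff[OF a(1)] class_iff[OF b] by blast+
    show ?thesis
      by (rule class_eq[OF block_pos[OF that(3) p(1,4)] block_pos[OF a(2,1) b]
            block_mono[OF a(2) Mpos_Mi[OF b] that(3) Mpos_Mi[OF p(4)] p(2,5)]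
            block_mono[OF that(3) Mpos_Mi[OF p(4)] a(2) Mpos_Mi[OF b] p(3,6)]])
  qed
  moreover have "block_diag A n a b \<in> class_add A (cuntz_class A a) (cuntz_class A b)"
    unfolding class_add_def using class_self[OF block_pos[OF a(2,1) b]] class_self[OF a(1)] class_self[OF b] a(2) by blast
  ultimately show ?thesis
    unfolding class_add_def using class_self[OF a(1)] class_self[OF b] a(2) by blast
qed

lemma class_le_iff:
  assumes a: "a \<in> positive (M_inf A)" and b: "b \<in> positive (M_inf A)"
  shows "class_le A (cuntz_class A a) (cuntz_class A b) \<longleftrightarrow> a \<preceq> b"
proof
  assume "class_le A (cuntz_class A a) (cuntz_class A b)"
  then obtain x y where xy: "x \<in> cuntz_class A a" "y \<in> cuntz_class A b" "cuntz_le A x y" by (auto simp: class_le_def)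
  then have p: "x \<in> positive (M_inf A)" "a \<preceq> x" "y \<in> positive (M_inf A)" "y \<preceq> b"
    using class_iff[OF a] class_iff[OF b] by blast+
  have "x \<preceq> y" using xy(3) cuntz_le_czle[OF Mpos_Mi[OF p(1)] Mpos_Mi[OF p(3)]] by blast
  note c = Mpos_Mi[OF a] Mpos_Mi[OF b] Mpos_Mi[OF p(1)] Mpos_Mi[OF p(3)]
  show "a \<preceq> b"
    using Mi_trans[OF p(2) \<open>x \<preceq> y\<close> c(1,3,4)] Mi_trans[OF _ p(4) c(1,4,2)] by blast
next
  assume "a \<preceq> b"
  then show "class_le A (cuntz_class A a) (cuntz_class A b)"
    unfolding class_le_def using cuntz_le_czle[OF Mpos_Mi[OF a] Mpos_Mi[OF b]] class_self[OF a] class_self[OF b] by blast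
qed

section \<open>The Cuntz semigroup as an ordered commutative monoid\<close>

definition Cl :: "'a inf_mat set set" where "Cl = cuntz_class A ` positive (M_inf A)"

lemma ClE:
  assumes "U \<in> Cl" obtains a n where "U = cuntz_class A a" "a \<in> positive (M_inf A)" "a \<in> mat_carrier n A"
  using assms unfolding Cl_def using Mpos_cases by blast

lemma ClI: "a \<in> positive (M_inf A) \<Longrightarrow> cuntz_class A a \<in> Cl"
  by (simp add: Cl_def)

lemma Cl_zero: "cuntz_class A Mzero \<in> Cl" using Mpos_zero by (rule ClI)

lemma Cl_add: assumes "U \<in> Cl" "V \<in> Cl" shows "class_add A U V \<in> Cl"
proof -
  obtain a n where a: "U = cuntz_class A a" "a \<in> positive (M_inf A)" "a \<in> mat_carrier n A" using assms(1) by (rule ClE)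
  obtain b m where b: "V = cuntz_class A b" "b \<in> positive (M_inf A)" "b \<in> mat_carrier m A" using assms(2) by (rule ClE)
  show ?thesis using a b class_add_block[OF a(2,3) b(2)] block_pos[OF a(3,2) b(2)] ClI by simp
qed

lemma Cl_add_comm: assumes "U \<in> Cl" "V \<in> Cl" shows "class_add A U V = class_add A V U"
proof -
  obtain a n where a: "U = cuntz_class A a" "a \<in> positive (M_inf A)" "a \<in> mat_carrier n A" using assms(1) by (rule ClE)
  obtain b m where b: "V = cuntz_class A b" "b \<in> positive (M_inf A)" "b \<in> mat_carrier m A" using assms(2) by (rule ClE)
  have "cuntz_class A (block_diag A n a b) = cuntz_class A (block_diag A m b a)"
    by (rule class_eq[OF block_pos[OF a(3,2) b(2)] block_pos[OF b(3,2) a(2)] block_comm[OF b(3) a(3)] block_comm[OF a(3) b(3)]])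
  then show ?thesis using a b class_add_block[OF a(2,3) b(2)] class_add_block[OF b(2,3) a(2)] by simp
qed

lemma Cl_add_assoc: assumes "U \<in> Cl" "V \<in> Cl" "W \<in> Cl" shows "class_add A (class_add A U V) W = class_add A U (class_add A V W)"
proof -
  obtain a n where a: "U = cuntz_class A a" "a \<in> positive (M_inf A)" "a \<in> mat_carrier n A" using assms(1) by (rule ClE)
  obtain b m where b: "V = cuntz_class A b" "b \<in> positive (M_inf A)" "b \<in> mat_carrier m A" using assms(2) by (rule ClE)
  obtain c l where c: "W = cuntz_class A c" "c \<in> positive (M_inf A)" "c \<in> mat_carrier l A" using assms(3) by (rule ClE)
  show ?thesis unfolding a(1) b(1) c(1) class_add_block[OF a(2,3) b(2)] class_add_block[OF b(2,3) c(2)]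
      class_add_block[OF block_pos[OF a(3,2) b(2)] block_mc[OF a(3) b(3)] c(2)]
      class_add_block[OF a(2,3) block_pos[OF b(3,2) c(2)]] block_assoc[OF a(3) b(3)] ..
qed

lemma Cl_add_zero: assumes "U \<in> Cl" shows "class_add A (cuntz_class A Mzero) U = U"
proof -
  obtain a n where a: "U = cuntz_class A a" "a \<in> positive (M_inf A)" "a \<in> mat_carrier n A" using assms(1) by (rule ClE)
  have "Mzero \<in> mat_carrier 0 A" using mc_zero by (simp add: M_inf_simps(4))
  then show ?thesis unfolding a(1) using class_add_block[OF Mpos_zero _ a(2)] block_zero(2) by simp
qed

lemma times_0 [simp]: "class_times A 0 U = cuntz_class A Mzero"
  and times_Suc [simp]: "class_times A (Suc k) U = class_add A (class_times A k U) U"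
  by (simp_all add: class_times_def)

lemma Cl_times: "U \<in> Cl \<Longrightarrow> class_times A k U \<in> Cl"
  by (induction k) (simp_all add: Cl_zero Cl_add)

lemma Cl_add_lcomm: "U \<in> Cl \<Longrightarrow> V \<in> Cl \<Longrightarrow> W \<in> Cl \<Longrightarrow> class_add A U (class_add A V W) = class_add A V (class_add A U W)"
  by (metis Cl_add_assoc Cl_add_comm)

lemma times_add: "U \<in> Cl \<Longrightarrow> class_times A (j + k) U = class_add A (class_times A j U) (class_times A k U)"
proof (induction k)
  case 0 then show ?case using Cl_add_comm[OF Cl_times[OF 0] Cl_zero] Cl_add_zero[OF Cl_times[OF 0]] by simp
next
  case (Suc k) then show ?case by (simp add: Cl_add_assoc Cl_times)
qed

lemma times_distrib:
  "U \<in> Cl \<Longrightarrow> V \<in> Cl \<Longrightarrow> class_times A k (class_add A U V) = class_add A (class_times A k U) (class_times A k V)"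
proof (induction k)
  case 0 then show ?case by (simp add: Cl_add_zero Cl_zero)
next
  case (Suc k) then show ?case by (simp add: Cl_add_assoc Cl_add_comm Cl_add_lcomm Cl_add Cl_times)
qed

lemma times_mult: "U \<in> Cl \<Longrightarrow> class_times A (j * k) U = class_times A j (class_times A k U)"
proof (induction j)
  case (Suc j)
  then show ?case using times_add[OF Suc(2), of k "j * k"] by (simp add: Cl_add_comm Cl_times)
qed simp

lemma Cl_le_trans: assumes "U \<in> Cl" "V \<in> Cl" "W \<in> Cl" "class_le A U V" "class_le A V W" shows "class_le A U W"
  using assms by (elim ClE) (use class_le_iff Mi_trans Mpos_Mi in metis)

lemma Cl_le_refl: "U \<in> Cl \<Longrightarrow> class_le A U U"
  by (elim ClE) (use class_le_iff Mi_refl Mpos_Mi in metis)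

lemma Cl_add_mono:
  assumes "U \<in> Cl" "V \<in> Cl" "U' \<in> Cl" "V' \<in> Cl" "class_le A U U'" "class_le A V V'"
  shows "class_le A (class_add A U V) (class_add A U' V')"
proof -
  obtain a n where a: "U = cuntz_class A a" "a \<in> positive (M_inf A)" "a \<in> mat_carrier n A" using assms(1) by (rule ClE)
  obtain b m where b: "V = cuntz_class A b" "b \<in> positive (M_inf A)" "b \<in> mat_carrier m A" using assms(2) by (rule ClE)
  obtain a' n' where a': "U' = cuntz_class A a'" "a' \<in> positive (M_inf A)" "a' \<in> mat_carrier n' A" using assms(3) by (rule ClE)
  obtain b' m' where b': "V' = cuntz_class A b'" "b' \<in> positive (M_inf A)" "b' \<in> mat_carrier m' A" using assms(4) by (rule ClE)
  have "block_diag A n a b \<preceq> block_diag A n' a' b'"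
    using assms(5,6) a b a' b' by (intro block_mono) (auto simp: class_le_iff)
  then show ?thesis using class_le_iff[OF block_pos[OF a(3,2) b(2)] block_pos[OF a'(3,2) b'(2)]]
    by (simp add: a(1) b(1) a'(1) b'(1) class_add_block[OF a(2,3) b(2)] class_add_block[OF a'(2,3) b'(2)])
qed

lemma Cl_times_mono: "U \<in> Cl \<Longrightarrow> V \<in> Cl \<Longrightarrow> class_le A U V \<Longrightarrow> class_le A (class_times A k U) (class_times A k V)"
  by (induction k) (simp_all add: Cl_le_refl Cl_zero Cl_add_mono Cl_times)

lemma Cl_le_add: assumes "U \<in> Cl" "V \<in> Cl" shows "class_le A V (class_add A U V)"
proof -
  have "class_le A (cuntz_class A Mzero) U"
    using assms(1) by (elim ClE) (use class_le_iff[OF Mpos_zero] zero_le Mpos_Mi in metis)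
  then have "class_le A (class_add A (cuntz_class A Mzero) V) (class_add A U V)"
    using assms Cl_zero by (intro Cl_add_mono Cl_le_refl)
  then show ?thesis using assms Cl_add_zero by simp
qed

lemma block_power_mc: "b \<in> mat_carrier n A \<Longrightarrow> block_power A n k b \<in> mat_carrier (k * n) A"
proof (induction k)
  case (Suc k)
  then show ?case using block_mc[of _ "k * n" b n] by (simp add: add.commute)
qed (simp add: mc_zero)

text \<open>An explicit representative of the multiple. Homomorphisms act on matrices and not on
  classes, so their effect on multiples is computed here.\<close>

lemma block_power_class:
  assumes b: "b \<in> mat_carrier n A" "b \<in> positive (M_inf A)"
  shows "block_power A n k b \<in> positive (M_inf A) \<and> class_times A k (cuntz_class A b) = cuntz_class A (block_power A n k b)"
proof (induction k)
  case 0 then show ?case using Mpos_zero by (simp add: M_inf_simps(4))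
next
  case (Suc k)
  then show ?case using block_pos[OF block_power_mc[OF b(1)] _ b(2), of k]
      class_add_block[OF _ block_power_mc[OF b(1)] b(2), of k] by simp
qed

end

section \<open>Homomorphisms\<close>

text \<open>The unit may be sent to a proper projection, as happens for a subalgebra whose unit
  \<open>p\<close> differs from that of the ambient algebra.\<close>

locale star_hom = S: unital_cstar S + T: unital_cstar T
  for S :: "'s star_alg" and T :: "'t star_alg" +
  fixes f :: "'s \<Rightarrow> 't"
  assumes f_closed [simp, intro]: "x \<in> carrier S \<Longrightarrow> f x \<in> carrier T"
    and f_add [simp]: "x \<in> carrier S \<Longrightarrow> y \<in> carrier S \<Longrightarrow> f (x \<oplus>\<^bsub>S\<^esub> y) = f x \<oplus>\<^bsub>T\<^esub> f y"
    and f_mult [simp]: "x \<in> carrier S \<Longrightarrow> y \<in> carrier S \<Longrightarrow> f (x \<otimes>\<^bsub>S\<^esub> y) = f x \<otimes>\<^bsub>T\<^esub> f y"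
    and f_sm [simp]: "x \<in> carrier S \<Longrightarrow> f (c \<odot>\<^bsub>S\<^esub> x) = c \<odot>\<^bsub>T\<^esub> f x"
    and f_star [simp]: "x \<in> carrier S \<Longrightarrow> f (star S x) = star T (f x)"
begin

lemma f_zero [simp]: "f \<zero>\<^bsub>S\<^esub> = \<zero>\<^bsub>T\<^esub>"
  using f_sm[of "\<zero>\<^bsub>S\<^esub>" 0] by simp

lemma f_diff [simp]: "x \<in> carrier S \<Longrightarrow> y \<in> carrier S \<Longrightarrow> f (x \<ominus>\<^bsub>S\<^esub> y) = f x \<ominus>\<^bsub>T\<^esub> f y"
  by (simp add: S.diff_sm T.diff_sm)

text \<open>Quasi-inverses are defined without a unit and are therefore preserved, whatever the
  image of the unit is.\<close>

lemma spec_subset: assumes x: "x \<in> carrier S" shows "spec T (f x) \<subseteq> spec S x"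
proof -
  have "quasi_invertible T (f y)" if "quasi_invertible S y" "y \<in> carrier S" for y
  proof -
    obtain u where u: "u \<in> carrier S" "y \<oplus>\<^bsub>S\<^esub> u = y \<otimes>\<^bsub>S\<^esub> u" "y \<oplus>\<^bsub>S\<^esub> u = u \<otimes>\<^bsub>S\<^esub> y"
      using \<open>quasi_invertible S y\<close> by (auto simp: quasi_invertible_def)
    then have "f (y \<oplus>\<^bsub>S\<^esub> u) = f (y \<otimes>\<^bsub>S\<^esub> u)" "f (y \<oplus>\<^bsub>S\<^esub> u) = f (u \<otimes>\<^bsub>S\<^esub> y)" by simp_all
    then show ?thesis unfolding quasi_invertible_def using u(1) that(2) by (intro bexI[of _ "f u"]) auto
  qed
  from this[of "inverse _ \<odot>\<^bsub>S\<^esub> x"] show ?thesis using x by (auto simp: spec_def)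
qed

text \<open>For the self-adjoint \<open>y = x\<^sup>* x\<close> the norm of the image is the modulus
  of a spectral value, which is then spectral for \<open>y\<close> or zero; the C*-identity returns
  to \<open>x\<close>.\<close>

lemma contractive: assumes x: "x \<in> carrier S" shows "cnorm T (f x) \<le> cnorm S x"
proof -
  define y where "y = star S x \<otimes>\<^bsub>S\<^esub> x"
  have y: "y \<in> carrier S" "y \<in> S.selfadj" using x S.selfadj_closed(5) by (auto simp: y_def)
  have fy: "f y \<in> T.selfadj" using y by (auto simp: S.selfadj_def T.selfadj_def simp flip: f_star)
  have "cnorm T (f y) \<le> cnorm S y"
  proof (cases "f y = \<zero>\<^bsub>T\<^esub>")
    case False
    then obtain z where z: "z \<in> T.sp (f y)" "cmod z = cnorm T (f y)"
      using T.norm_in_sp[OF fy] y by (metis T.norm_ge_0 abs_of_nonneg f_closed norm_minus_cancel norm_of_real)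
    then have "z \<in> insert 0 (S.sp y)" using spec_subset[OF y(1)] S.spec_eq[OF y(1)] T.spec_eq[of "f y"] y by auto
    then show ?thesis
    proof
      assume "z = 0" then show ?thesis using z(2) y by simp
    next
      assume "z \<in> S.sp y"
      then have "\<not> cnorm S y < cmod z" using S.unit_large[OF y(1), of z] by (auto simp: S.sp_def)
      then show ?thesis using z(2) by simp
    qed
  qed (use y in simp)
  then have "(cnorm T (f x))\<^sup>2 \<le> (cnorm S x)\<^sup>2" using x T.cstar_id[of "f x"] S.cstar_id[of x] by (simp add: y_def)
  then show ?thesis by (rule power2_le_imp_le) (use x in simp)
qed

lemma f_pos: assumes "x \<in> positive S" shows "f x \<in> positive T"
proof -
  obtain h where h: "h \<in> S.selfadj" "x = h \<otimes>\<^bsub>S\<^esub> h" using assms by (rule S.pos_sqrt)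
  then have "f h \<in> T.selfadj" by (auto simp: S.selfadj_def T.selfadj_def simp flip: f_star)
  then show ?thesis using T.square_pos h by auto
qed

definition F :: "'s inf_mat \<Rightarrow> 't inf_mat" where "F x = (\<lambda>i j. f (x i j))"

lemma F_mc: "x \<in> mat_carrier n S \<Longrightarrow> F x \<in> mat_carrier n T"
  unfolding F_def by (rule T.mcI) (auto simp: S.mcD(2,3)[of _ n])

lemma F_Mi: "x \<in> carrier (M_inf S) \<Longrightarrow> F x \<in> carrier (M_inf T)"
  unfolding S.M_inf_carrier T.M_inf_carrier using F_mc by blast

lemma f_fs: "(\<And>i. g i \<in> carrier S) \<Longrightarrow> f (S.fs n g) = T.fs n (\<lambda>i. f (g i))"
  by (induction n) (simp_all add: S.fs_Suc T.fs_Suc)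

lemma F_mult: assumes "x \<in> mat_carrier n S" "y \<in> mat_carrier n S"
  shows "F (x \<otimes>\<^bsub>M_inf S\<^esub> y) = F x \<otimes>\<^bsub>M_inf T\<^esub> F y"
  unfolding S.mult_mm[OF assms] T.mult_mm[OF assms[THEN F_mc]]
  using assms by (simp add: F_def S.mm_def T.mm_def f_fs)

lemma M_n_hom: "star_hom (M_n n S) (M_n n T) F"
proof -
  interpret Sn: unital_cstar "M_n n S" by (rule S.M_n_unital_cstar)
  interpret Tn: unital_cstar "M_n n T" by (rule T.M_n_unital_cstar)
  show ?thesis
  proof
    fix x y assume "x \<in> carrier (M_n n S)" "y \<in> carrier (M_n n S)"
    then have c: "x \<in> mat_carrier n S" "y \<in> mat_carrier n S" by simp_all
    show "F (x \<otimes>\<^bsub>M_n n S\<^esub> y) = F x \<otimes>\<^bsub>M_n n T\<^esub> F y" using F_mult[OF c] by simp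
    show "F (x \<oplus>\<^bsub>M_n n S\<^esub> y) = F x \<oplus>\<^bsub>M_n n T\<^esub> F y" using c by (simp add: F_def M_inf_simps)
  next
    fix x c assume "x \<in> carrier (M_n n S)"
    then have c: "x \<in> mat_carrier n S" by simp
    show "F x \<in> carrier (M_n n T)" using F_mc[OF c] by simp
    show "F (c \<odot>\<^bsub>M_n n S\<^esub> x) = c \<odot>\<^bsub>M_n n T\<^esub> F x" using c by (simp add: F_def M_inf_simps)
    show "F (star (M_n n S) x) = star (M_n n T) (F x)" using c by (simp add: F_def M_inf_simps)
  qed
qed

lemma F_czle:
  assumes a: "a \<in> carrier (M_inf S)" and b: "b \<in> carrier (M_inf S)" and le: "S.Mi.czle a b"
  shows "T.Mi.czle (F a) (F b)"
  unfolding T.Mi.czle_def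
proof (intro allI impI)
  fix e :: real assume "0 < e"
  then obtain v where v: "v \<in> carrier (M_inf S)"
    "cnorm (M_inf S) (v \<otimes>\<^bsub>M_inf S\<^esub> b \<otimes>\<^bsub>M_inf S\<^esub> star (M_inf S) v \<ominus>\<^bsub>M_inf S\<^esub> a) < e"
    using le unfolding S.Mi.czle_def by blast
  \<comment> \<open>Contractivity is available only between complete matrix algebras, so the three
    matrices are placed in a common size.\<close>
  obtain n where n: "a \<in> mat_carrier n S" "b \<in> mat_carrier n S" "v \<in> mat_carrier n S"
  proof -
    have "\<forall>\<^sub>F N in sequentially. a \<in> mat_carrier N S \<and> b \<in> mat_carrier N S \<and> v \<in> mat_carrier N S"
      using a b v(1) S.mc_event by (intro eventually_conj) (auto simp: S.M_inf_carrier)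
    from eventually_happens'[OF sequentially_bot this] show ?thesis using that by blast
  qed
  interpret Fn: star_hom "M_n n S" "M_n n T" F by (rule M_n_hom)
  let ?x = "v \<otimes>\<^bsub>M_n n S\<^esub> b \<otimes>\<^bsub>M_n n S\<^esub> star (M_n n S) v \<ominus>\<^bsub>M_n n S\<^esub> a"
  have c: "a \<in> carrier (M_n n S)" "b \<in> carrier (M_n n S)" "v \<in> carrier (M_n n S)" using n by simp_all
  have sm: "v \<otimes>\<^bsub>M_n n S\<^esub> b \<otimes>\<^bsub>M_n n S\<^esub> star (M_n n S) v \<in> carrier (M_n n S)"
    using c by (intro Fn.S.m_closed Fn.S.star_closed)
  have tm: "F v \<otimes>\<^bsub>M_n n T\<^esub> F b \<otimes>\<^bsub>M_n n T\<^esub> star (M_n n T) (F v) \<in> carrier (M_n n T)"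
    using c by (intro Fn.T.m_closed Fn.T.star_closed Fn.f_closed)
  have "F ?x = F v \<otimes>\<^bsub>M_n n T\<^esub> F b \<otimes>\<^bsub>M_n n T\<^esub> star (M_n n T) (F v) \<ominus>\<^bsub>M_n n T\<^esub> F a"
    using c sm by (simp only: Fn.f_diff Fn.f_mult Fn.f_star Fn.S.m_closed Fn.S.star_closed)
  moreover have "cnorm (M_n n T) (F ?x) \<le> cnorm (M_n n S) ?x" using c sm by (intro Fn.contractive Fn.S.diff_closed)
  moreover have "cnorm (M_n n S) ?x < e" using v(2) S.M_n_diff'[of _ n a] sm n(1) by simp
  ultimately have "cnorm (M_inf T) (F v \<otimes>\<^bsub>M_inf T\<^esub> F b \<otimes>\<^bsub>M_inf T\<^esub> star (M_inf T) (F v) \<ominus>\<^bsub>M_inf T\<^esub> F a) < e"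
    using T.M_n_diff'[of _ n "F a"] tm F_mc[OF n(1)] by simp
  then show "\<exists>v\<in>carrier (M_inf T). cnorm (M_inf T) (v \<otimes>\<^bsub>M_inf T\<^esub> F b \<otimes>\<^bsub>M_inf T\<^esub> star (M_inf T) v \<ominus>\<^bsub>M_inf T\<^esub> F a) < e"
    using F_Mi[OF v(1)] by blast
qed

lemma F_Mpos: assumes "a \<in> positive (M_inf S)" shows "F a \<in> positive (M_inf T)"
proof -
  obtain n where n: "a \<in> mat_carrier n S" "a \<in> positive (M_n n S)" using assms by (rule S.Mpos_cases)
  interpret Fn: star_hom "M_n n S" "M_n n T" F by (rule M_n_hom)
  show ?thesis using Fn.f_pos[OF n(2)] T.positive_M_inf[OF F_mc[OF n(1)]] by simp
qed

lemma F_block_power: "F (block_power S n k b) = block_power T n k (F b)"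
  by (induction k) (auto simp: F_def block_diag_def fun_eq_iff)

lemma F_class_le:
  assumes a: "a \<in> positive (M_inf S)" and b: "b \<in> positive (M_inf S)"
    and le: "class_le S (class_times S j (cuntz_class S a)) (class_times S k (cuntz_class S b))"
  shows "class_le T (class_times T j (cuntz_class T (F a))) (class_times T k (cuntz_class T (F b)))"
proof -
  obtain n where n: "a \<in> mat_carrier n S" using a by (rule S.Mpos_cases)
  obtain l where l: "b \<in> mat_carrier l S" using b by (rule S.Mpos_cases)
  note A1 = S.block_power_class[OF n a, of j] and A2 = S.block_power_class[OF l b, of k]
  note B1 = T.block_power_class[OF F_mc[OF n] F_Mpos[OF a], of j] and B2 = T.block_power_class[OF F_mc[OF l] F_Mpos[OF b], of k]
  have "S.Mi.czle (block_power S n j a) (block_power S l k b)" using le A1 A2 S.class_le_iff by simp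
  then have "T.Mi.czle (F (block_power S n j a)) (F (block_power S l k b))"
    using A1 A2 by (intro F_czle S.Mpos_Mi) auto
  then show ?thesis using B1 B2 T.class_le_iff by (simp add: F_block_power)
qed

end

section \<open>The operator inequality for compressions\<close>

context unital_cstar
begin

lemma times_1: "U \<in> Cl \<Longrightarrow> class_times A 1 U = U"
  using Cl_add_zero by simp

text \<open>\<open>2QaQ + 2RaR - a = (Q - R)a(Q - R)\<close> for \<open>R = 1 - Q\<close>.\<close>

lemma compress_le:
  assumes a: "a \<in> positive A" and Q: "Q \<in> carrier A" "star A Q = Q" "Q \<otimes> Q = Q"
    and c: "c \<in> selfadj" and n: "cnorm A (c \<ominus> Q \<otimes> a \<otimes> Q) \<le> r"
  shows "((2 \<odot> c \<oplus> complex_of_real (2 * cnorm A a) \<odot> (\<one> \<ominus> Q)) \<oplus> complex_of_real (2 * r) \<odot> \<one>) \<ominus> a \<in> positive A"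
proof -
  define R where "R = \<one> \<ominus> Q"
  have R: "R \<in> carrier A" "star A R = R" "R \<otimes> R = R"
    using Q by (auto simp: R_def l_diff r_diff) (simp add: diff_sm sm_add_right)
  have ac: "a \<in> carrier A" "a \<in> selfadj" "c \<in> carrier A" using a c pos_selfadj by auto
  define x where "x = Q \<otimes> a \<otimes> Q"
  define y where "y = R \<otimes> a \<otimes> R"
  have xy: "x \<in> carrier A" "y \<in> carrier A" using Q R ac by (auto simp: x_def y_def)
  have x: "x \<in> selfadj" using Q ac by (auto simp: x_def selfadj_def m_assoc)
  have p1: "(x \<oplus> x) \<oplus> (y \<oplus> y) \<ominus> a \<in> positive A"
  proof -
    define u v where "u = Q \<otimes> a \<otimes> R" and "v = R \<otimes> a \<otimes> Q"
    have uv: "u \<in> carrier A" "v \<in> carrier A" using Q R ac by (auto simp: u_def v_def)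
    have QR: "Q \<oplus> R = \<one>" using Q by (simp add: R_def diff_sm a_ac add_cancels)
    have "a = (Q \<oplus> R) \<otimes> a \<otimes> (Q \<oplus> R)" using ac QR by simp
    also have "\<dots> = (x \<oplus> u) \<oplus> (v \<oplus> y)" using Q R ac by (simp add: x_def y_def u_def v_def l_distr r_distr a_ac)
    finally have e1: "a = (x \<oplus> u) \<oplus> (v \<oplus> y)" .
    have "star A (Q \<ominus> R) \<otimes> (a \<otimes> (Q \<ominus> R)) \<in> positive A" using a Q R by (intro conj_pos) auto
    also have "star A (Q \<ominus> R) \<otimes> (a \<otimes> (Q \<ominus> R)) = (x \<ominus> u) \<oplus> (y \<ominus> v)"
      using Q R ac by (simp add: x_def y_def u_def v_def l_diff r_diff m_assoc) (simp add: diff_sm sm_add_right a_ac)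
    also have "(x \<ominus> u) \<oplus> (y \<ominus> v) = (x \<oplus> x) \<oplus> (y \<oplus> y) \<ominus> ((x \<oplus> u) \<oplus> (v \<oplus> y))"
      using xy uv by (simp add: diff_sm sm_add_right a_ac add_cancels)
    finally show ?thesis using e1 by simp
  qed
  have p2: "(c \<oplus> complex_of_real r \<odot> \<one>) \<ominus> x \<in> positive A" using n by (intro norm_diff_pos x c) (simp add: x_def)
  \<comment> \<open>The second corner is replaced by a multiple of \<open>R\<close>: nothing is
    known about \<open>RaR\<close> except its size.\<close>
  have p3: "complex_of_real (cnorm A a) \<odot> R \<ominus> y \<in> positive A"
  proof -
    have "star A R \<otimes> ((complex_of_real (cnorm A a) \<odot> \<one> \<ominus> a) \<otimes> R) \<in> positive A"
      using R ac by (intro conj_pos norm_bound_pos) auto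
    then show ?thesis using R ac by (simp add: y_def l_diff r_diff m_assoc)
  qed
  define k where "k = complex_of_real r \<odot> \<one>"
  define l where "l = complex_of_real (cnorm A a) \<odot> R"
  have kl: "k \<in> carrier A" "l \<in> carrier A" using R by (auto simp: k_def l_def)
  have two: "2 \<odot> w = w \<oplus> w" if "w \<in> carrier A" for w using sm_add_left[OF that, of 1 1] that by simp
  \<comment> \<open>Both corners occur twice in \<open>p1\<close>, so the bounds for them are added
    twice; this is the origin of the coefficients two.\<close>
  have "((c \<oplus> k) \<ominus> x) \<oplus> ((c \<oplus> k) \<ominus> x) \<oplus> ((l \<ominus> y) \<oplus> (l \<ominus> y)) \<oplus> ((x \<oplus> x) \<oplus> (y \<oplus> y) \<ominus> a) \<in> positive A"
    using p1 p2 p3 by (intro pos_add) (auto simp: k_def l_def)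
  also have "((c \<oplus> k) \<ominus> x) \<oplus> ((c \<oplus> k) \<ominus> x) \<oplus> ((l \<ominus> y) \<oplus> (l \<ominus> y)) \<oplus> ((x \<oplus> x) \<oplus> (y \<oplus> y) \<ominus> a)
    = ((c \<oplus> c) \<oplus> (l \<oplus> l)) \<oplus> (k \<oplus> k) \<ominus> a"
  proof -
    define x2 where "x2 = x \<oplus> x"
    define y2 where "y2 = y \<oplus> y"
    have c2: "x2 \<in> carrier A" "y2 \<in> carrier A" using xy by (auto simp: x2_def y2_def)
    have "((c \<oplus> k) \<ominus> x) \<oplus> ((c \<oplus> k) \<ominus> x) = ((c \<oplus> c) \<oplus> (k \<oplus> k)) \<ominus> x2"
      using xy kl ac by (simp add: x2_def diff_sm sm_add_right a_ac)
    moreover have "(l \<ominus> y) \<oplus> (l \<ominus> y) = (l \<oplus> l) \<ominus> y2"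
      using xy kl ac by (simp add: y2_def diff_sm sm_add_right a_ac)
    moreover have "(p \<ominus> x2) \<oplus> (q \<ominus> y2) \<oplus> ((x2 \<oplus> y2) \<ominus> a) = (p \<oplus> q) \<ominus> a" if "p \<in> carrier A" "q \<in> carrier A" for p q
    proof -
      have "(p \<ominus> x2) \<oplus> (q \<ominus> y2) = (p \<oplus> q) \<ominus> (x2 \<oplus> y2)" using that c2 by (simp add: diff_sm sm_add_right a_ac)
      moreover have "(p' \<ominus> z) \<oplus> (z \<ominus> a) = p' \<ominus> a" if "p' \<in> carrier A" "z \<in> carrier A" for p' z
        using that ac by (simp add: diff_sm a_assoc)
      ultimately show ?thesis using that c2 by simp
    qed
    ultimately show ?thesis using kl ac by (simp add: x2_def[symmetric] y2_def[symmetric]) (simp add: a_ac)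
  qed
  finally have "((c \<oplus> c) \<oplus> (l \<oplus> l)) \<oplus> (k \<oplus> k) \<ominus> a \<in> positive A" .
  moreover have "complex_of_real (2 * cnorm A a) \<odot> (\<one> \<ominus> Q) = l \<oplus> l"
    using R two[of l] kl by (simp add: l_def R_def[symmetric])
  moreover have "complex_of_real (2 * r) \<odot> \<one> = k \<oplus> k" using two[of k] kl by (simp add: k_def)
  ultimately show ?thesis using two[OF ac(3)] by simp
qed

end

section \<open>Divisibility of compressions\<close>

definition scalar_diag :: "'a star_alg \<Rightarrow> nat \<Rightarrow> 'a \<Rightarrow> 'a inf_mat" where
  "scalar_diag A n q = (\<lambda>i j. if i = j \<and> i < n then q else \<zero>\<^bsub>A\<^esub>)"

text \<open>The given isomorphism leads from \<open>B\<close> to \<open>C\<close>. Its inverse, read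
  as a homomorphism into \<open>A\<close>, transports Cuntz comparisons from the divisible algebra
  \<open>C\<close> to \<open>A\<close>.\<close>

lemma inverse_hom:
  assumes A: "unital_cstar A" and C: "unital_cstar C" and B: "cstar_subalgebra B A"
    and iso: "bij_betw \<phi> (carrier (unital_subalg A B p)) (carrier C)"
      "\<forall>x\<in>carrier (unital_subalg A B p). \<forall>y\<in>carrier (unital_subalg A B p).
        \<phi> (x \<oplus>\<^bsub>unital_subalg A B p\<^esub> y) = \<phi> x \<oplus>\<^bsub>C\<^esub> \<phi> y \<and> \<phi> (x \<otimes>\<^bsub>unital_subalg A B p\<^esub> y) = \<phi> x \<otimes>\<^bsub>C\<^esub> \<phi> y"
      "\<forall>x\<in>carrier (unital_subalg A B p). \<forall>c. \<phi> (c \<odot>\<^bsub>unital_subalg A B p\<^esub> x) = c \<odot>\<^bsub>C\<^esub> \<phi> x"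
      "\<forall>x\<in>carrier (unital_subalg A B p). \<phi> (star (unital_subalg A B p) x) = star C (\<phi> x)"
  shows "star_hom C A (inv_into B \<phi>)"
proof -
  interpret A: unital_cstar A by (rule A)
  interpret C: unital_cstar C by (rule C)
  have bij: "bij_betw \<phi> B (carrier C)"
    and h: "\<And>x y. x \<in> B \<Longrightarrow> y \<in> B \<Longrightarrow> \<phi> (x \<oplus>\<^bsub>A\<^esub> y) = \<phi> x \<oplus>\<^bsub>C\<^esub> \<phi> y"
      "\<And>x y. x \<in> B \<Longrightarrow> y \<in> B \<Longrightarrow> \<phi> (x \<otimes>\<^bsub>A\<^esub> y) = \<phi> x \<otimes>\<^bsub>C\<^esub> \<phi> y"
      "\<And>x c. x \<in> B \<Longrightarrow> \<phi> (c \<odot>\<^bsub>A\<^esub> x) = c \<odot>\<^bsub>C\<^esub> \<phi> x" "\<And>x. x \<in> B \<Longrightarrow> \<phi> (star A x) = star C (\<phi> x)"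
    using iso by (auto simp: unital_subalg_def)
  interpret sub: submodule B complex_ring A using B by (simp add: cstar_subalgebra_def)
  have cl: "x \<in> carrier A" if "x \<in> B" for x using sub.subset that by auto
  have ops: "x \<oplus>\<^bsub>A\<^esub> y \<in> B" "x \<otimes>\<^bsub>A\<^esub> y \<in> B" if "x \<in> B" "y \<in> B" for x y
    using that B sub.m_closed[of x y] by (auto simp: cstar_subalgebra_def)
  have ops1: "c \<odot>\<^bsub>A\<^esub> x \<in> B" "star A x \<in> B" if "x \<in> B" for x c
    using that B sub.smult_closed[of c x] by (auto simp: cstar_subalgebra_def)
  let ?g = "inv_into B \<phi>"
  have gB: "?g x \<in> B" if "x \<in> carrier C" for x using bij that by (metis bij_betw_imp_surj_on inv_into_into)
  have pg: "\<phi> (?g x) = x" if "x \<in> carrier C" for x using bij that by (metis bij_betw_inv_into_right)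
  have eq: "?g x = u" if "u \<in> B" "\<phi> u = x" for x u using bij that by (metis bij_betw_inv_into_left)
  show ?thesis
  proof
    fix x y assume "x \<in> carrier C" "y \<in> carrier C"
    then show "?g (x \<oplus>\<^bsub>C\<^esub> y) = ?g x \<oplus>\<^bsub>A\<^esub> ?g y" "?g (x \<otimes>\<^bsub>C\<^esub> y) = ?g x \<otimes>\<^bsub>A\<^esub> ?g y"
      using gB pg h ops by (auto intro!: eq)
  next
    fix x c assume "x \<in> carrier C"
    then show "?g x \<in> carrier A" "?g (c \<odot>\<^bsub>C\<^esub> x) = c \<odot>\<^bsub>A\<^esub> ?g x" "?g (star C x) = star A (?g x)"
      using gB pg h ops1 cl by (auto intro!: eq)
  qed
qed

section \<open>Diagonal projections and division of the compressed element\<close>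

context unital_cstar
begin

lemma scalar_diag_mc: "q \<in> carrier A \<Longrightarrow> scalar_diag A n q \<in> mat_carrier n A"
  unfolding scalar_diag_def by (rule mcI) auto

lemma scalar_diag_mult:
  assumes q: "q \<in> carrier A" and x: "x \<in> mat_carrier n A"
  shows "scalar_diag A n q \<star> x = (\<lambda>i j. q \<otimes> x i j)" "x \<star> scalar_diag A n q = (\<lambda>i j. x i j \<otimes> q)"
proof -
  note d = scalar_diag_mc[OF q, of n]
  have "mm n (scalar_diag A n q) x i j = q \<otimes> x i j" for i j
  proof (cases "i < n")
    case True
    have "mm n (scalar_diag A n q) x i j = scalar_diag A n q i i \<otimes> x i j"
      unfolding mm_def by (rule fs_single[OF True]) (use x d q in \<open>auto simp: scalar_diag_def\<close>)
    then show ?thesis using True by (simp add: scalar_diag_def)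
  qed (use q mcD(2)[OF mm_mc[OF d x]] mcD(2)[OF x] in simp)
  then show "scalar_diag A n q \<star> x = (\<lambda>i j. q \<otimes> x i j)" using mult_mm[OF d x] by (simp add: fun_eq_iff)
  have "mm n x (scalar_diag A n q) i j = x i j \<otimes> q" for i j
  proof (cases "j < n")
    case True
    have "mm n x (scalar_diag A n q) i j = x i j \<otimes> scalar_diag A n q j j"
      unfolding mm_def by (rule fs_single[OF True]) (use x d q in \<open>auto simp: scalar_diag_def\<close>)
    then show ?thesis using True by (simp add: scalar_diag_def)
  qed (use q mcD(3)[OF mm_mc[OF x d]] mcD(3)[OF x] in simp)
  then show "x \<star> scalar_diag A n q = (\<lambda>i j. x i j \<otimes> q)" using mult_mm[OF x d] by (simp add: fun_eq_iff)
qed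

lemma scalar_diag_projection:
  assumes q: "projection A q"
  shows "scalar_diag A n q \<in> mat_carrier n A" "Mstar (scalar_diag A n q) = scalar_diag A n q"
    "scalar_diag A n q \<star> scalar_diag A n q = scalar_diag A n q"
proof -
  have q: "q \<in> carrier A" "star A q = q" "q \<otimes> q = q" using q by (auto simp: projection_def)
  show d: "scalar_diag A n q \<in> mat_carrier n A" by (rule scalar_diag_mc[OF q(1)])
  show "Mstar (scalar_diag A n q) = scalar_diag A n q" using q by (auto simp: M_inf_simps(6) scalar_diag_def fun_eq_iff)
  show "scalar_diag A n q \<star> scalar_diag A n q = scalar_diag A n q"
    unfolding scalar_diag_mult(1)[OF q(1) d] using q by (auto simp: scalar_diag_def fun_eq_iff)
qed

lemma norm_projection_mult:
  assumes q: "star A q = q" "q \<otimes> q = q" "q \<in> carrier A" and x: "x \<in> carrier A"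
  shows "cnorm A (q \<otimes> x) \<le> cnorm A x"
proof -
  have "(cnorm A q)\<^sup>2 = cnorm A q" using cstar_id[OF q(3)] q by simp
  then have "cnorm A q = 0 \<or> cnorm A q = 1" by (simp add: power2_eq_square)
  then have "cnorm A q * cnorm A x \<le> 1 * cnorm A x" using x by (intro mult_right_mono) auto
  then show ?thesis using norm_mult[OF q(3) x] by simp
qed

text \<open>The algebra \<open>C\<close> is a copy of the subalgebra \<open>B\<close>, and \<open>a = h\<^sup>2\<close>. Since \<open>q h\<close> is close to some
  \<open>y\<close> with entries in \<open>B\<close>, the positive element \<open>y y\<^sup>*\<close> over \<open>B\<close> is close to \<open>q a q\<close>; divisibility is
  applied to a cut-down of \<open>y y\<^sup>*\<close>, which is Cuntz below \<open>q a q\<close> and hence below \<open>a\<close>.\<close>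

lemma divide_compression:
  assumes h: "h \<in> mat_carrier n A" "Mstar h = h" and \<eta>: "0 < \<eta>"
  shows "\<exists>\<delta>>0. \<forall>q B p (C :: 'u star_alg). projection A q \<longrightarrow> cstar_subalgebra B A \<longrightarrow> unital_cstar C \<longrightarrow>
    almost_divisible m C \<longrightarrow> star_isomorphic (unital_subalg A B p) C \<longrightarrow>
    (\<forall>i<n. \<forall>j<n. approx_in A \<delta> (q \<otimes> h i j) B) \<longrightarrow>
    (\<forall>k\<ge>1. \<exists>b\<in>positive (M_inf A). \<exists>c\<in>positive (M_inf A). c \<in> mat_carrier n A \<and>
      class_le A (class_times A k (cuntz_class A b)) (cuntz_class A (h \<star> h)) \<and>
      class_le A (cuntz_class A c) (class_times A ((k + 1) * (m + 1)) (cuntz_class A b)) \<and>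
      cnorm (M_inf A) (c \<ominus>\<^bsub>M_inf A\<^esub> scalar_diag A n q \<star> (h \<star> h) \<star> scalar_diag A n q) \<le> 3 * \<eta>)"
proof -
  interpret N: unital_cstar "M_n n A" by (rule M_n_unital_cstar)
  define H where "H = cnorm (M_inf A) h"
  have hN: "h \<in> carrier (M_n n A)" using h by simp
  have H0: "0 \<le> H" using N.norm_ge_0[OF hN] by (simp add: H_def)
  \<comment> \<open>The products are compared with error \<open>dH + (H + 1)d = d(2H + 1)\<close>,
    where \<open>d \<le> 1\<close> was used to bound the norm of \<open>y\<close> by
    \<open>H + 1\<close>.\<close>
  define d where "d = min 1 (\<eta> / (2 * (2 * H + 1)))"
  have d: "0 < d" "d \<le> 1" "d * (2 * H + 1) \<le> \<eta> / 2"
  proof -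
    show "0 < d" using \<eta> H0 by (simp add: d_def)
    show "d \<le> 1" by (simp add: d_def)
    have "d * (2 * H + 1) \<le> (\<eta> / (2 * (2 * H + 1))) * (2 * H + 1)" using H0 by (intro mult_right_mono) (auto simp: d_def)
    also have "\<dots> = \<eta> / 2" using H0 by (simp add: field_simps)
    finally show "d * (2 * H + 1) \<le> \<eta> / 2" .
  qed
  \<comment> \<open>A matrix is bounded by the sum of the norms of its \<open>n\<^sup>2\<close>
    entries; the added one covers \<open>n = 0\<close>. The value depends on \<open>h\<close> and
    \<open>\<eta>\<close> only, so it can be fixed before \<open>q\<close> and \<open>B\<close> are
    chosen.\<close>
  define \<delta> where "\<delta> = d / (real n * real n + 1)"
  have \<delta>: "0 < \<delta>" using d by (simp add: \<delta>_def add_nonneg_pos)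
  have "\<exists>b\<in>positive (M_inf A). \<exists>c\<in>positive (M_inf A). c \<in> mat_carrier n A \<and>
      class_le A (class_times A k (cuntz_class A b)) (cuntz_class A (h \<star> h)) \<and>
      class_le A (cuntz_class A c) (class_times A ((k + 1) * (m + 1)) (cuntz_class A b)) \<and>
      cnorm (M_inf A) (c \<ominus>\<^bsub>M_inf A\<^esub> scalar_diag A n q \<star> (h \<star> h) \<star> scalar_diag A n q) \<le> 3 * \<eta>"
    if q: "projection A q" and B: "cstar_subalgebra B A" and C: "unital_cstar C" and dv: "almost_divisible m C"
      and iso: "star_isomorphic (unital_subalg A B p) C" and ap: "\<forall>i<n. \<forall>j<n. approx_in A \<delta> (q \<otimes> h i j) B" and k: "1 \<le> k"
    for q B p k and C :: "'u star_alg"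
  proof -
    interpret C: unital_cstar C by (rule C)
    interpret Cn: unital_cstar "M_n n C" by (rule C.M_n_unital_cstar)
    obtain \<phi> where \<phi>: "bij_betw \<phi> (carrier (unital_subalg A B p)) (carrier C)"
      "\<forall>x\<in>carrier (unital_subalg A B p). \<forall>y\<in>carrier (unital_subalg A B p).
        \<phi> (x \<oplus>\<^bsub>unital_subalg A B p\<^esub> y) = \<phi> x \<oplus>\<^bsub>C\<^esub> \<phi> y \<and> \<phi> (x \<otimes>\<^bsub>unital_subalg A B p\<^esub> y) = \<phi> x \<otimes>\<^bsub>C\<^esub> \<phi> y"
      "\<forall>x\<in>carrier (unital_subalg A B p). \<forall>c. \<phi> (c \<odot>\<^bsub>unital_subalg A B p\<^esub> x) = c \<odot>\<^bsub>C\<^esub> \<phi> x"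
      "\<forall>x\<in>carrier (unital_subalg A B p). \<phi> (star (unital_subalg A B p) x) = star C (\<phi> x)"
      using iso unfolding star_isomorphic_def by blast
    interpret G: star_hom C A "inv_into B \<phi>" by (rule inverse_hom[OF unital_cstar_axioms C B \<phi>])
    interpret Gn: star_hom "M_n n C" "M_n n A" G.F by (rule G.M_n_hom)
    have bij: "bij_betw \<phi> B (carrier C)" using \<phi>(1) by (simp add: unital_subalg_def)
    have "\<forall>i j. \<exists>u. i < n \<and> j < n \<longrightarrow> u \<in> B \<and> cnorm A (q \<otimes> h i j \<ominus> u) < \<delta>"
      using ap unfolding approx_in_def by blast
    then obtain y0 where y0: "\<And>i j. i < n \<Longrightarrow> j < n \<Longrightarrow> y0 i j \<in> B \<and> cnorm A (q \<otimes> h i j \<ominus> y0 i j) < \<delta>"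
      by metis
    \<comment> \<open>The approximating entries are moved to \<open>C\<close>, where divisibility is
      assumed, and \<open>G.F\<close> brings them back to \<open>A\<close>.\<close>
    define z where "z = (\<lambda>i j. if i < n \<and> j < n then \<phi> (y0 i j) else \<zero>\<^bsub>C\<^esub>)"
    have z: "z \<in> mat_carrier n C" unfolding z_def by (rule C.mcI) (use y0 bij_betwE[OF bij] in auto)
    define y where "y = G.F z"
    have y: "y \<in> mat_carrier n A" unfolding y_def by (rule G.F_mc[OF z])
    have yy0: "y i j = y0 i j" if "i < n" "j < n" for i j
      using y0[OF that] that bij_betw_inv_into_left[OF bij] by (simp add: y_def z_def G.F_def)
    let ?Q = "scalar_diag A n q"
    note Q = scalar_diag_projection[OF q, of n]
    have qc: "q \<in> carrier A" using q by (simp add: projection_def)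
    define a where "a = h \<star> h"
    have a: "a \<in> mat_carrier n A" using N.m_closed[OF hN hN] by (simp add: a_def)
    have hs: "h \<in> N.selfadj" using h by (simp add: N.selfadj_def)
    have apos: "a \<in> positive (M_n n A)" using N.square_pos[OF hs] by (simp add: a_def)
    define x where "x = ?Q \<star> h"
    have x: "x \<in> mat_carrier n A" using N.m_closed[of ?Q h] Q hN by (simp add: x_def)
    have xN: "x \<in> carrier (M_n n A)" "y \<in> carrier (M_n n A)" "?Q \<in> carrier (M_n n A)" "a \<in> carrier (M_n n A)" using x y Q a by simp_all
    define D where "D = cnorm (M_n n A) (x \<ominus>\<^bsub>M_n n A\<^esub> y)"
    have D: "D \<le> d" "0 \<le> D"
    proof -
      have "x \<ominus>\<^bsub>M_n n A\<^esub> y \<in> mat_carrier n A" using N.diff_closed xN by simp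
      from mat_norm_le_sum[OF this] have "D \<le> (\<Sum>i<n. \<Sum>j<n. cnorm A (x i j \<ominus> y i j))"
        using M_n_diff[OF x y] by (simp add: D_def M_inf_simps(7))
      also have "\<dots> \<le> (\<Sum>i<n. \<Sum>j<n. \<delta>)"
        using y0 yy0 scalar_diag_mult(1)[OF qc h(1)] by (intro sum_mono) (auto simp: x_def less_imp_le)
      also have "\<dots> = (real n * real n) * \<delta>" by simp
      also have "\<dots> \<le> (real n * real n + 1) * \<delta>" using \<delta> by simp
      also have "\<dots> = d" using \<delta> unfolding \<delta>_def by (simp add: add_nonneg_eq_0_iff)
      finally show "D \<le> d" .
      show "0 \<le> D" unfolding D_def by (rule N.norm_ge_0[OF N.diff_closed[OF xN(1,2)]])
    qed
    have nx: "cnorm (M_n n A) x \<le> H"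
      using N.norm_projection_mult[of ?Q h] Q hN by (simp add: x_def H_def)
    have ny: "cnorm (M_n n A) y \<le> H + 1"
      using N.norm_le_diff[OF xN(2,1)] N.norm_diff_commute[OF xN(2,1)] nx D d(2) by (simp add: D_def)
    define b1 where "b1 = y \<star> Mstar y"
    have b1: "b1 \<in> positive (M_n n A)" "b1 \<in> carrier (M_n n A)" using N.star_pos'[OF xN(2)] by (auto simp: b1_def dest: N.pos_closed)
    have QaQ: "?Q \<star> a \<star> ?Q = x \<star> Mstar x"
      using h Q mc_Mi[OF Q(1)] mc_Mi[OF h(1)] by (simp add: x_def a_def Mi.m_assoc)
    define c1 where "c1 = ?Q \<star> a \<star> ?Q"
    have c1: "c1 \<in> positive (M_n n A)" "c1 \<in> carrier (M_n n A)" using N.star_pos'[OF xN(1)] by (auto simp: c1_def QaQ dest: N.pos_closed)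
    have close: "cnorm (M_n n A) (c1 \<ominus>\<^bsub>M_n n A\<^esub> b1) \<le> \<eta> / 2"
    proof -
      have "cnorm (M_n n A) (x \<otimes>\<^bsub>M_n n A\<^esub> star (M_n n A) x \<ominus>\<^bsub>M_n n A\<^esub> y \<otimes>\<^bsub>M_n n A\<^esub> star (M_n n A) y)
        \<le> cnorm (M_n n A) (x \<ominus>\<^bsub>M_n n A\<^esub> y) * cnorm (M_n n A) (star (M_n n A) x)
          + cnorm (M_n n A) y * cnorm (M_n n A) (star (M_n n A) x \<ominus>\<^bsub>M_n n A\<^esub> star (M_n n A) y)"
        using xN by (intro N.norm_mult_diff N.star_closed)
      also have "\<dots> = D * cnorm (M_n n A) x + cnorm (M_n n A) y * D"
        unfolding N.star_diff[OF xN(1,2), symmetric] using N.norm_star[OF xN(1)] N.norm_star[of "x \<ominus>\<^bsub>M_n n A\<^esub> y"] xN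
        by (simp only: D_def N.diff_closed)
      also have "\<dots> \<le> d * H + (H + 1) * d" using D nx ny d H0 N.norm_ge_0[OF xN(1)] N.norm_ge_0[OF xN(2)]
        by (intro add_mono mult_mono) auto
      also have "\<dots> = d * (2 * H + 1)" by (simp add: algebra_simps)
      finally show ?thesis using d(3) by (simp add: c1_def b1_def QaQ)
    qed
    define a1 where "a1 = z \<otimes>\<^bsub>M_n n C\<^esub> star (M_n n C) z"
    have zN: "z \<in> carrier (M_n n C)" using z by simp
    have a1: "a1 \<in> positive (M_n n C)" "a1 \<in> carrier (M_n n C)" using Cn.star_pos'[OF zN] by (auto simp: a1_def dest: Cn.pos_closed)
    have Fa1: "G.F a1 = b1" using zN by (simp add: a1_def b1_def y_def del: C.M_n_sel M_n_sel(1))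
    \<comment> \<open>Two cut-downs with different tasks. The first makes \<open>a2\<close> Cuntz
      below \<open>c1\<close>, which is only close to \<open>b1\<close>; the second is the loss
      inherent in divisibility, here applied to \<open>a2\<close>.\<close>
    define a2 where "a2 = Cn.cutoff a1 \<eta>"
    note a2 = Cn.cutoff_props[OF a1(1) \<eta>, folded a2_def]
    have a2c: "a2 \<in> mat_carrier n C" "a2 \<in> carrier (M_n n C)" using Cn.pos_closed[OF a2(1)] by simp_all
    define a3 where "a3 = Cn.cutoff a2 \<eta>"
    note a3 = Cn.cutoff_props[OF a2(1) \<eta>, folded a3_def]
    have a3c: "a3 \<in> mat_carrier n C" "a3 \<in> carrier (M_n n C)" using Cn.pos_closed[OF a3(1)] by simp_all
    have p2: "a2 \<in> positive (M_inf C)" and p3: "a3 \<in> positive (M_inf C)"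
      using a2(1) a3(1) C.positive_M_inf[OF a2c(1)] C.positive_M_inf[OF a3c(1)] by auto
    have cut: "cutdown (M_inf C) a2 \<eta> = a3" using C.cutdown_M_inf[OF a2c(1) p2 \<eta>] by (simp add: a3_def)
    obtain b where b: "b \<in> positive (M_inf C)"
      "class_le C (class_times C k (cuntz_class C b)) (cuntz_class C a2)"
      "class_le C (cuntz_class C a3) (class_times C ((k + 1) * (m + 1)) (cuntz_class C b))"
      using dv p2 k \<eta> cut unfolding almost_divisible_def by metis
    have le_a2: "G.F a2 \<preceq> c1"
      unfolding Mi.czle_def
    proof (intro allI impI)
      fix e :: real assume e: "0 < e"
      \<comment> \<open>The parameter \<open>\<eta>/2\<close> is below the cut \<open>\<eta>\<close>
        and equals the known distance of \<open>b1\<close> and \<open>c1\<close>, as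
        \<open>cut_le_approx\<close> demands.\<close>
      obtain g where g: "g \<in> Cn.selfadj" "a2 = g \<otimes>\<^bsub>M_n n C\<^esub> (a1 \<otimes>\<^bsub>M_n n C\<^esub> g) \<ominus>\<^bsub>M_n n C\<^esub> complex_of_real (\<eta>/2) \<odot>\<^bsub>M_n n C\<^esub> (g \<otimes>\<^bsub>M_n n C\<^esub> g)"
        using Cn.cutoff_form[OF a1(1), of "\<eta>/2" \<eta>] \<eta> by (auto simp: a2_def)
      have gc: "g \<in> carrier (M_n n C)" using g(1) by auto
      have Fg: "G.F g \<in> N.selfadj"
      proof -
        have "star (M_n n A) (G.F g) = G.F (star (M_n n C) g)" by (rule Gn.f_star[OF gc, symmetric])
        also have "star (M_n n C) g = g" using g(1) by (rule Cn.selfadjD)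
        finally show ?thesis unfolding N.selfadj_def using Gn.f_closed[OF gc] by blast
      qed
      have "G.F a2 = G.F g \<otimes>\<^bsub>M_n n A\<^esub> (b1 \<otimes>\<^bsub>M_n n A\<^esub> G.F g) \<ominus>\<^bsub>M_n n A\<^esub> complex_of_real (\<eta>/2) \<odot>\<^bsub>M_n n A\<^esub> (G.F g \<otimes>\<^bsub>M_n n A\<^esub> G.F g)"
        unfolding g(2) Fa1[symmetric] using gc a1(2)
        by (simp only: Gn.f_diff Gn.f_mult Gn.f_sm Cn.m_closed Cn.sm_closed)
      moreover have "(c1 \<oplus>\<^bsub>M_n n A\<^esub> complex_of_real (\<eta>/2) \<odot>\<^bsub>M_n n A\<^esub> \<one>\<^bsub>M_n n A\<^esub>) \<ominus>\<^bsub>M_n n A\<^esub> b1 \<in> positive (M_n n A)"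
        by (intro N.norm_diff_pos N.pos_selfadj b1 c1 close)
      ultimately obtain v where v: "v \<in> carrier (M_n n A)"
        "cnorm (M_n n A) (v \<otimes>\<^bsub>M_n n A\<^esub> c1 \<otimes>\<^bsub>M_n n A\<^esub> star (M_n n A) v \<ominus>\<^bsub>M_n n A\<^esub> G.F a2) < e"
        using N.cut_le_approx[OF Gn.f_pos[OF a2(1)] Fg N.pos_selfadj[OF b1(1)] c1(1) _ _ e] by blast
      have vc: "v \<otimes>\<^bsub>M_n n A\<^esub> c1 \<otimes>\<^bsub>M_n n A\<^esub> star (M_n n A) v \<in> carrier (M_n n A)"
        using v(1) c1(2) by (intro N.m_closed N.star_closed)
      have "cnorm (M_inf A) (v \<star> c1 \<star> Mstar v \<ominus>\<^bsub>M_inf A\<^esub> G.F a2) < e"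
        using v(2) M_n_diff'[of _ n "G.F a2"] vc G.F_mc[OF a2c(1)] by simp
      then show "\<exists>v\<in>Mcarrier. cnorm (M_inf A) (v \<star> c1 \<star> Mstar v \<ominus>\<^bsub>M_inf A\<^esub> G.F a2) < e" using v(1) by auto
    qed
    have aM: "a \<in> positive (M_inf A)" using apos positive_M_inf[OF a] by simp
    have c1M: "c1 \<in> Mcarrier" using c1(2) mc_Mi[of c1 n] by simp
    have c1a: "c1 \<preceq> a" by (rule Mi.czle_exact[of ?Q]) (use Q mc_Mi[OF Q(1)] Mpos_Mi[OF aM] in \<open>auto simp: c1_def\<close>)
    have "G.F a2 \<preceq> a" by (rule Mi_trans[OF le_a2 c1a Mpos_Mi[OF G.F_Mpos[OF p2]] c1M Mpos_Mi[OF aM]])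
    then have "class_le A (cuntz_class A (G.F a2)) (cuntz_class A a)" using class_le_iff[OF G.F_Mpos[OF p2] aM] by simp
    \<comment> \<open>The multiple by one appears because \<open>F_class_le\<close> is stated for
      multiples on both sides.\<close>
    moreover have "class_le A (class_times A k (cuntz_class A (G.F b))) (class_times A 1 (cuntz_class A (G.F a2)))"
      by (rule G.F_class_le[OF b(1) p2]) (use b(2) C.times_1[OF C.ClI[OF p2]] in simp)
    ultimately have r1: "class_le A (class_times A k (cuntz_class A (G.F b))) (cuntz_class A a)"
      using Cl_le_trans[OF Cl_times[OF ClI[OF G.F_Mpos[OF b(1)]]] ClI[OF G.F_Mpos[OF p2]] ClI[OF aM]] times_1[OF ClI[OF G.F_Mpos[OF p2]]] by simp
    have "class_le A (class_times A 1 (cuntz_class A (G.F a3))) (class_times A ((k + 1) * (m + 1)) (cuntz_class A (G.F b)))"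
      by (rule G.F_class_le[OF p3 b(1)]) (use b(3) C.times_1[OF C.ClI[OF p3]] in simp)
    then have r2: "class_le A (cuntz_class A (G.F a3)) (class_times A ((k + 1) * (m + 1)) (cuntz_class A (G.F b)))"
      using times_1[OF ClI[OF G.F_Mpos[OF p3]]] by simp
    \<comment> \<open>Each cut-down contributes \<open>\<eta>\<close>, since homomorphisms are
      contractive, and \<open>b1\<close> differs from \<open>c1\<close> by at most
      \<open>\<eta>/2\<close>.\<close>
    have "cnorm (M_n n A) (G.F a3 \<ominus>\<^bsub>M_n n A\<^esub> c1) \<le> 3 * \<eta>"
    proof -
      have F3: "G.F a3 \<in> carrier (M_n n A)" and F2: "G.F a2 \<in> carrier (M_n n A)" using a2c a3c by (intro Gn.f_closed; simp)+
      have "cnorm (M_n n A) (G.F a3 \<ominus>\<^bsub>M_n n A\<^esub> G.F a2) \<le> \<eta>"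
        using Gn.contractive[OF Cn.diff_closed[OF a3c(2) a2c(2)]] Gn.f_diff[OF a3c(2) a2c(2)] a3(2) by simp
      moreover have "cnorm (M_n n A) (G.F a2 \<ominus>\<^bsub>M_n n A\<^esub> b1) \<le> \<eta>"
        using Gn.contractive[OF Cn.diff_closed[OF a2c(2) a1(2)]] Gn.f_diff[OF a2c(2) a1(2)] a2(2) Fa1 by simp
      ultimately show ?thesis
        using N.norm_diff_triangle[OF F3 F2 c1(2)] N.norm_diff_triangle[OF F2 b1(2) c1(2)] N.norm_diff_commute[OF b1(2) c1(2)] close \<eta>
        by linarith
    qed
    then have r3: "cnorm (M_inf A) (G.F a3 \<ominus>\<^bsub>M_inf A\<^esub> c1) \<le> 3 * \<eta>"
      using M_n_diff'[OF G.F_mc[OF a3c(1)], of c1] c1(2) by simp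
    show ?thesis
      by (rule bexI[OF _ G.F_Mpos[OF b(1)]], rule bexI[OF _ G.F_Mpos[OF p3]])
        (use r1 r2 r3 G.F_mc[OF a3c(1)] in \<open>simp add: a_def c1_def\<close>)
  qed
  then show ?thesis using \<delta> by blast
qed

section \<open>Weak divisibility\<close>

text \<open>With \<open>a = h\<^sup>2\<close> each diagonal entry is the inner product of a column
  of \<open>h\<close> with itself, so a vanishing diagonal would make \<open>h\<close> vanish. The
  entry gives an element of \<open>A\<close> that \<open>TAA\<close> can work with.\<close>

lemma diag_entry:
  assumes a: "a \<in> positive (M_inf A)" and 0: "a \<noteq> Mzero"
  obtains i where "a i i \<in> positive A" "a i i \<noteq> \<zero>" "corner A (a i i) \<preceq> a"
proof -
  obtain n where n: "a \<in> mat_carrier n A" "a \<in> positive (M_n n A)" using a by (rule Mpos_cases)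
  interpret N: unital_cstar "M_n n A" by (rule M_n_unital_cstar)
  obtain h where h: "h \<in> N.selfadj" "a = h \<otimes>\<^bsub>M_n n A\<^esub> h" using n(2) by (rule N.pos_sqrt)
  have hm: "h \<in> mat_carrier n A" using h(1) by (auto simp: N.selfadj_def)
  have hs: "star A (h i j) = h j i" for i j
    using h(1) by (auto simp: N.selfadj_def M_inf_simps(6) fun_eq_iff)
  have ah: "a i i = cinner n (\<lambda>k. h k i) (\<lambda>k. h k i)" for i
    using h(2) mult_mm[OF hm hm] by (simp add: mm_def cinner_def hs)
  have "\<exists>i. a i i \<noteq> \<zero>"
  proof (rule ccontr)
    assume "\<not> (\<exists>i. a i i \<noteq> \<zero>)"
    then have a0: "a i i = \<zero>" for i by blast
    have "col_norm A (\<lambda>k. h k i) = sqrt (cnorm A (a i i))" for i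
      unfolding ah by (rule col_norm_cinner[OF mc_row_col[OF hm]])
    then have z: "col_norm A (\<lambda>k. h k i) = 0" for i by (simp add: a0)
    have "h = Mzero" using col_norm_eq_0[OF mc_row_col[OF hm] z] by (simp add: M_inf_simps(4) fun_eq_iff)
    then have "a = Mzero" using h(2) by simp
    then show False using 0 by simp
  qed
  then obtain i where i: "a i i \<noteq> \<zero>" by blast
  \<comment> \<open>The matrix unit in row \<open>0\<close> and column \<open>i\<close>: conjugation
    by it moves the diagonal entry \<open>i\<close> into the corner.\<close>
  define e where "e = (\<lambda>(l::nat) (k::nat). if l = 0 \<and> k = i then \<one> else \<zero>)"
  have "e \<in> mat_carrier (Suc i) A" unfolding e_def by (rule mcI) auto
  then have e: "e \<in> Mcarrier" by (rule mc_Mi)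
  have aM: "a \<in> Mcarrier" using a by (rule Mpos_Mi)
  have sel: "e \<star> x = (\<lambda>l k. if l = 0 then x i k else \<zero>)" if "x \<in> Mcarrier" for x
    by (rule sel_mult[OF e that, where f = "\<lambda>_. i"]) (auto simp: e_def)
  have "Mstar (e \<star> Mstar (e \<star> a)) = e \<star> a \<star> Mstar e" using e aM by simp
  moreover have "Mstar (e \<star> Mstar (e \<star> a)) = corner A (a i i)"
    unfolding sel[OF Mi.star_closed[OF Mi.m_closed[OF e aM]]] unfolding sel[OF aM]
    using n(1) by (auto simp: M_inf_simps(6) corner_def fun_eq_iff)
  ultimately have "corner A (a i i) \<preceq> a" using Mi.czle_exact[OF e _ aM, of "corner A (a i i)"] by simp
  moreover have "a i i \<in> positive A" unfolding ah by (rule cinner_pos[OF mc_row_col[OF hm]])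
  ultimately show ?thesis using i that by blast
qed

section \<open>Elements of the algebra as corner matrices\<close>

lemma corner_mc: "x \<in> carrier A \<Longrightarrow> corner A x \<in> mat_carrier (Suc 0) A"
  unfolding corner_def by (rule mcI) auto

lemma corner_pos: assumes "x \<in> positive A" shows "corner A x \<in> positive (M_inf A)"
proof -
  obtain h where h: "h \<in> selfadj" "x = h \<otimes> h" using assms by (rule pos_sqrt)
  have hc: "h \<in> carrier A" "star A h = h" using h by auto
  interpret N: unital_cstar "M_n (Suc 0) A" by (rule M_n_unital_cstar)
  have c: "corner A h \<in> mat_carrier (Suc 0) A" by (rule corner_mc[OF hc(1)])
  have "corner A h \<in> N.selfadj" using c hc by (auto simp: N.selfadj_def M_inf_simps(6) corner_def fun_eq_iff)
  from N.square_pos[OF this] have "corner A h \<star> corner A h \<in> positive (M_n (Suc 0) A)" by simp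
  moreover have "corner A h \<star> corner A h = corner A x"
    unfolding mult_mm[OF c c] using hc h(2) by (auto simp: mm_def corner_def fun_eq_iff fs_Suc)
  ultimately show ?thesis using positive_M_inf[OF corner_mc] assms pos_closed by simp
qed

text \<open>Identifies the diagonal matrix with entries \<open>1 - q\<close> as \<open>n\<close>
  copies of \<open>1 - q\<close> in the Cuntz semigroup.\<close>

lemma block_power_corner: "block_power A (Suc 0) n (corner A x) = scalar_diag A n x"
  by (induction n) (auto simp: scalar_diag_def block_diag_def corner_def fun_eq_iff)

lemma projection_pos: "projection A q \<Longrightarrow> q \<in> positive A"
  using square_pos[of q] by (simp add: projection_def selfadj_def)

lemma projection_compl: "projection A q \<Longrightarrow> projection A (\<one> \<ominus> q)"
  by (auto simp: projection_def l_diff r_diff) (simp add: diff_sm sm_add_right)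

lemma TAA_weakly_divisible:
  fixes \<Omega> :: "'u star_alg set"
  assumes \<Omega>: "\<And>C. C \<in> \<Omega> \<Longrightarrow> unital_cstar C" "\<And>C. C \<in> \<Omega> \<Longrightarrow> almost_divisible m C"
    and T: "A \<in> TAA \<Omega>"
  shows "weakly_almost_divisible 2 m A"
  unfolding weakly_almost_divisible_def
proof (intro ballI allI impI)
  fix a and k :: nat and \<epsilon> :: real
  assume a: "a \<in> positive (M_inf A)" and k: "1 \<le> k" and \<epsilon>: "0 < \<epsilon>"
  obtain n where n: "a \<in> mat_carrier n A" "a \<in> positive (M_n n A)" using a by (rule Mpos_cases)
  interpret N: unital_cstar "M_n n A" by (rule M_n_unital_cstar)
  define a\<epsilon> where "a\<epsilon> = cutdown (M_inf A) a \<epsilon>"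
  have a\<epsilon>: "a\<epsilon> = N.cutoff a \<epsilon>" using cutdown_M_inf[OF n(1) a \<epsilon>] by (simp add: a\<epsilon>_def)
  have a\<epsilon>N: "a\<epsilon> \<in> positive (M_n n A)" using N.cutoff_props(1)[OF n(2) \<epsilon>] by (simp add: a\<epsilon>)
  have a\<epsilon>m: "a\<epsilon> \<in> mat_carrier n A" using N.pos_closed[OF a\<epsilon>N] by simp
  have a\<epsilon>M: "a\<epsilon> \<in> positive (M_inf A)" using positive_M_inf[OF a\<epsilon>m] a\<epsilon>N by simp
  define Z where "Z = cuntz_class A a"
  have Z: "Z \<in> Cl" unfolding Z_def by (rule ClI[OF a])
  define M where "M = (k + 1) * (m + 1)"
  show "\<exists>b\<in>positive (M_inf A). class_le A (class_times A k (cuntz_class A b)) (class_times A 2 (cuntz_class A a)) \<and>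
    class_le A (cuntz_class A (cutdown (M_inf A) a \<epsilon>)) (class_times A ((k + 1) * (m + 1)) (cuntz_class A b))"
    unfolding a\<epsilon>_def[symmetric] Z_def[symmetric] M_def[symmetric]
  \<comment> \<open>For \<open>a = 0\<close> there is no non-zero diagonal entry to start from, and
    the witness is zero.\<close>
  proof (cases "a = Mzero")
    case True
    have "N.cutoff a \<epsilon> = Mzero"
    proof -
      have "N.spr a \<subseteq> {0}" using N.spr_bound[of a] n True by fastforce
      then have "cnorm (M_n n A) (N.cf a (\<lambda>t. max 0 (t - \<epsilon>))) \<le> 0"
        using \<epsilon> n(2) by (intro N.cf_norm_le N.pos_selfadj continuous_intros) auto
      then have "cnorm (M_n n A) a\<epsilon> = 0" using N.norm_ge_0[OF N.pos_closed[OF a\<epsilon>N]] by (simp add: a\<epsilon> N.cutoff_def)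
      then show ?thesis using N.norm_eq_0[OF N.pos_closed[OF a\<epsilon>N]] by (simp add: a\<epsilon>)
    qed
    then have z: "a\<epsilon> = Mzero" by (simp add: a\<epsilon>)
    have t0: "class_times A j (cuntz_class A Mzero) = cuntz_class A Mzero" for j
      by (induction j) (use Cl_add_zero[OF Cl_zero] in auto)
    show "\<exists>b\<in>positive (M_inf A). class_le A (class_times A k (cuntz_class A b)) (class_times A 2 Z) \<and>
      class_le A (cuntz_class A a\<epsilon>) (class_times A M (cuntz_class A b))"
      by (rule bexI[OF _ Mpos_zero]) (simp add: z Z_def True t0 Cl_le_refl[OF Cl_zero] del: times_Suc)
  next
    case False
    obtain h where h: "h \<in> N.selfadj" "a = h \<otimes>\<^bsub>M_n n A\<^esub> h" using n(2) by (rule N.pos_sqrt)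
    have hm: "h \<in> mat_carrier n A" "Mstar h = h" "h \<star> h = a" using h by (auto simp: N.selfadj_def)
    define Fh where "Fh = (\<lambda>(i, j). h i j) ` ({..<n} \<times> {..<n})"
    have Fh: "finite Fh" "Fh \<subseteq> carrier A" using hm by (auto simp: Fh_def)
    \<comment> \<open>The common core of the two applications: \<open>s\<close> is the element that
      \<open>1 - q\<close> has to lie below, \<open>l\<close> the divisor, \<open>\<eta>\<close> the
      accuracy of the compression and \<open>\<mu>\<close> the loss of norm.\<close>
    have step: "\<exists>q b c. projection A q \<and> b \<in> positive (M_inf A) \<and> c \<in> positive (M_inf A) \<and> c \<in> mat_carrier n A \<and>
        cuntz_le A (corner A (\<one> \<ominus> q)) (corner A s) \<and> cnorm A (q \<otimes> s \<otimes> q) \<ge> cnorm A s - \<mu> \<and>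
        class_le A (class_times A l (cuntz_class A b)) Z \<and>
        class_le A (cuntz_class A c) (class_times A ((l + 1) * (m + 1)) (cuntz_class A b)) \<and>
        cnorm (M_inf A) (c \<ominus>\<^bsub>M_inf A\<^esub> scalar_diag A n q \<star> a \<star> scalar_diag A n q) \<le> 3 * \<eta>"
      if s: "s \<in> positive A" "s \<noteq> \<zero>" and \<eta>: "0 < \<eta>" and \<mu>: "0 < \<mu>" and l: "1 \<le> l" for s \<eta> \<mu> and l :: nat
    proof -
      obtain \<delta> where \<delta>: "0 < \<delta>" and L: "\<And>q B p (C :: 'u star_alg). projection A q \<Longrightarrow> cstar_subalgebra B A \<Longrightarrow> unital_cstar C \<Longrightarrow>
          almost_divisible m C \<Longrightarrow> star_isomorphic (unital_subalg A B p) C \<Longrightarrow>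
          (\<forall>i<n. \<forall>j<n. approx_in A \<delta> (q \<otimes> h i j) B) \<Longrightarrow>
          (\<forall>k\<ge>1. \<exists>b\<in>positive (M_inf A). \<exists>c\<in>positive (M_inf A). c \<in> mat_carrier n A \<and>
            class_le A (class_times A k (cuntz_class A b)) (cuntz_class A (h \<star> h)) \<and>
            class_le A (cuntz_class A c) (class_times A ((k + 1) * (m + 1)) (cuntz_class A b)) \<and>
            cnorm (M_inf A) (c \<ominus>\<^bsub>M_inf A\<^esub> scalar_diag A n q \<star> (h \<star> h) \<star> scalar_diag A n q) \<le> 3 * \<eta>)"
        using divide_compression[OF hm(1,2) \<eta>, where m = m and 'u = 'u] by metis
      \<comment> \<open>\<open>TAA\<close> has a single tolerance for approximation and norm, so the
        smaller of the two is passed.\<close>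
      define \<nu> where "\<nu> = min \<delta> \<mu>"
      have \<nu>: "0 < \<nu>" "\<nu> \<le> \<delta>" "\<nu> \<le> \<mu>" using \<delta> \<mu> by (auto simp: \<nu>_def)
      obtain p B q where t: "cstar_subalgebra B A" "in_class \<Omega> (unital_subalg A B p)" "projection A q"
        "\<forall>x\<in>Fh. approx_in A \<nu> (q \<otimes> x) B \<and> approx_in A \<nu> (x \<otimes> q) B"
        "cuntz_le A (corner A (\<one> \<ominus> q)) (corner A s)" "cnorm A (q \<otimes> s \<otimes> q) \<ge> cnorm A s - \<nu>"
      proof -
        have "\<forall>\<epsilon>>0. \<forall>F. finite F \<longrightarrow> F \<subseteq> carrier A \<longrightarrow> (\<forall>a\<in>positive A. a \<noteq> \<zero> \<longrightarrow>
          (\<exists>p B q. projection A p \<and> cstar_subalgebra B A \<and> is_unit_of A B p \<and>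
           in_class \<Omega> (unital_subalg A B p) \<and> projection A q \<and> q \<in> B \<and>
           (\<forall>x\<in>F. approx_in A \<epsilon> (q \<otimes> x) B \<and> approx_in A \<epsilon> (x \<otimes> q) B) \<and>
           cuntz_le A (corner A (\<one> \<ominus> q)) (corner A a) \<and>
           cnorm A (q \<otimes> a \<otimes> q) \<ge> cnorm A a - \<epsilon>))"
          using T by (simp add: TAA_def)
        from this[rule_format, OF \<nu>(1) Fh s] show ?thesis using that by blast
      qed
      obtain C where C: "C \<in> \<Omega>" "star_isomorphic (unital_subalg A B p) C" using t(2) by (auto simp: in_class_def)
      have "\<forall>i<n. \<forall>j<n. approx_in A \<delta> (q \<otimes> h i j) B"
      proof (intro allI impI)
        fix i j assume "i < n" "j < n"
        then have "h i j \<in> Fh" by (force simp: Fh_def)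
        then show "approx_in A \<delta> (q \<otimes> h i j) B" using t(4) \<nu>(2) unfolding approx_in_def by (meson less_le_trans)
      qed
      from L[OF t(3,1) \<Omega>(1)[OF C(1)] \<Omega>(2)[OF C(1)] C(2) this] l
      obtain b c where "b \<in> positive (M_inf A)" "c \<in> positive (M_inf A)" "c \<in> mat_carrier n A"
        "class_le A (class_times A l (cuntz_class A b)) Z"
        "class_le A (cuntz_class A c) (class_times A ((l + 1) * (m + 1)) (cuntz_class A b))"
        "cnorm (M_inf A) (c \<ominus>\<^bsub>M_inf A\<^esub> scalar_diag A n q \<star> a \<star> scalar_diag A n q) \<le> 3 * \<eta>"
        unfolding hm(3) Z_def by blast
      moreover have "cnorm A (q \<otimes> s \<otimes> q) \<ge> cnorm A s - \<mu>" using t(6) \<nu>(3) by linarith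
      ultimately show ?thesis using t(3,5) by blast
    qed
    obtain i where i: "a i i \<in> positive A" "a i i \<noteq> \<zero>" using diag_entry[OF a False] by blast
    have ic: "a i i \<in> carrier A" using i by blast
    \<comment> \<open>A non-zero entry forces \<open>n\<close> to be positive, which makes
      \<open>kn\<close> an admissible divisor.\<close>
    have in': "i < n" using i(2) mcD(2)[OF n(1), of i i] by (meson not_less)
    have kn: "1 \<le> k * n" using k in' by simp
    define \<mu> where "\<mu> = cnorm A (a i i)"
    have \<mu>: "0 < \<mu>" using norm_eq_0[OF ic] norm_ge_0[OF ic] i(2) by (simp add: \<mu>_def)
    \<comment> \<open>The accuracy is \<open>3\<mu>/12 = \<mu>/4\<close>, while the compressed entry
      keeps norm at least \<open>\<mu>/2\<close>. The gap excludes \<open>c1 = 0\<close>.\<close>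
    obtain q1 b1 c1 where 1: "projection A q1" "b1 \<in> positive (M_inf A)" "c1 \<in> positive (M_inf A)" "c1 \<in> mat_carrier n A"
      "cnorm A (q1 \<otimes> a i i \<otimes> q1) \<ge> cnorm A (a i i) - \<mu> / 2"
      "class_le A (class_times A (k * n) (cuntz_class A b1)) Z"
      "class_le A (cuntz_class A c1) (class_times A ((k * n + 1) * (m + 1)) (cuntz_class A b1))"
      "cnorm (M_inf A) (c1 \<ominus>\<^bsub>M_inf A\<^esub> scalar_diag A n q1 \<star> a \<star> scalar_diag A n q1) \<le> 3 * (\<mu> / 12)"
      using step[OF i, of "\<mu>/12" "\<mu>/2" "k * n"] \<mu> kn by auto
    have "c1 \<noteq> Mzero"
    proof
      assume z: "c1 = Mzero"
      let ?Q = "scalar_diag A n q1"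
      have q1c: "q1 \<in> carrier A" using 1(1) by (simp add: projection_def)
      have Qm: "?Q \<in> mat_carrier n A" by (rule scalar_diag_mc[OF q1c])
      have Qa: "?Q \<star> a \<in> mat_carrier n A" using N.m_closed[of ?Q a] Qm n(1) by simp
      have QaQ: "?Q \<star> a \<star> ?Q \<in> mat_carrier n A" using N.m_closed[of "?Q \<star> a" ?Q] Qa Qm by simp
      have "(?Q \<star> a \<star> ?Q) i i = q1 \<otimes> a i i \<otimes> q1"
        unfolding scalar_diag_mult(2)[OF q1c Qa] unfolding scalar_diag_mult(1)[OF q1c n(1)] ..
      then have "cnorm A (q1 \<otimes> a i i \<otimes> q1) \<le> cnorm (M_inf A) (?Q \<star> a \<star> ?Q)"
        using entry_le_mat_norm[OF QaQ, of i i] by (simp add: M_inf_simps(7))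
      also have "\<dots> = cnorm (M_inf A) (c1 \<ominus>\<^bsub>M_inf A\<^esub> ?Q \<star> a \<star> ?Q)"
        using mc_Mi[OF QaQ] Mi.norm_diff_commute[of Mzero "?Q \<star> a \<star> ?Q"] unfolding z by (simp add: Mi.diff_sm)
      finally show False using 1(5,8) \<mu> unfolding \<mu>_def by linarith
    qed
    \<comment> \<open>As \<open>c1\<close> lies below a multiple of \<open>b1\<close>, it would
      vanish together with \<open>b1\<close>.\<close>
    moreover have "c1 = Mzero" if z: "b1 = Mzero"
    proof -
      have t0: "class_times A j (cuntz_class A Mzero) = cuntz_class A Mzero" for j
        by (induction j) (use Cl_add_zero[OF Cl_zero] in auto)
      have "c1 \<preceq> Mzero" using 1(7) class_le_iff[OF 1(3) Mpos_zero] unfolding z t0 by simp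
      then show ?thesis by (rule le_zero) (use 1(3) in blast)
    qed
    ultimately have "b1 \<noteq> Mzero" by blast
    \<comment> \<open>A positive element of \<open>A\<close> itself is needed for comparison with
      \<open>1 - q\<close>, so \<open>b1\<close> is replaced by one of its diagonal entries.\<close>
    then obtain j where j: "b1 j j \<in> positive A" "b1 j j \<noteq> \<zero>" "corner A (b1 j j) \<preceq> b1" by (rule diag_entry[OF 1(2)])
    define s where "s = b1 j j"
    define V where "V = cuntz_class A (corner A s)"
    have sM: "corner A s \<in> positive (M_inf A)" unfolding s_def by (rule corner_pos[OF j(1)])
    have V: "V \<in> Cl" unfolding V_def by (rule ClI[OF sM])
    have "class_le A V (cuntz_class A b1)" using class_le_iff[OF sM 1(2)] j(3) by (simp add: V_def s_def)
    then have "class_le A (class_times A (k * n) V) (class_times A (k * n) (cuntz_class A b1))"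
      by (rule Cl_times_mono[OF V ClI[OF 1(2)]])
    then have kV: "class_le A (class_times A (k * n) V) Z"
      using Cl_le_trans[OF Cl_times[OF V] Cl_times[OF ClI[OF 1(2)]] Z _ 1(6)] by blast
    \<comment> \<open>The accuracy \<open>3\<epsilon>/12 = \<epsilon>/4\<close> is doubled by
      \<open>compress_le\<close>; the resulting \<open>\<epsilon>/2\<close> is below
      \<open>\<epsilon>\<close>, as \<open>cutoff_form\<close> requires.\<close>
    obtain q b2 c2 where 2: "projection A q" "b2 \<in> positive (M_inf A)" "c2 \<in> positive (M_inf A)" "c2 \<in> mat_carrier n A"
      "cuntz_le A (corner A (\<one> \<ominus> q)) (corner A s)"
      "class_le A (class_times A k (cuntz_class A b2)) Z"
      "class_le A (cuntz_class A c2) (class_times A M (cuntz_class A b2))"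
      "cnorm (M_inf A) (c2 \<ominus>\<^bsub>M_inf A\<^esub> scalar_diag A n q \<star> a \<star> scalar_diag A n q) \<le> 3 * (\<epsilon> / 12)"
      using step[OF j(1,2), of "\<epsilon>/12" 1 k] \<epsilon> k unfolding M_def s_def by auto
    define U where "U = cuntz_class A b2"
    have U: "U \<in> Cl" unfolding U_def by (rule ClI[OF 2(2)])
    define R where "R = scalar_diag A n (\<one> \<ominus> q)"
    have qc: "q \<in> carrier A" "\<one> \<ominus> q \<in> carrier A" using 2(1) by (auto simp: projection_def)
    have Rm: "R \<in> mat_carrier n A" unfolding R_def by (rule scalar_diag_mc[OF qc(2)])
    define W where "W = cuntz_class A (corner A (\<one> \<ominus> q))"
    have WM: "corner A (\<one> \<ominus> q) \<in> positive (M_inf A)" by (rule corner_pos[OF projection_pos[OF projection_compl[OF 2(1)]]])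
    have W: "W \<in> Cl" unfolding W_def by (rule ClI[OF WM])
    have RM: "R \<in> positive (M_inf A)" and nW: "class_times A n W = cuntz_class A R"
      using block_power_class[OF corner_mc[OF qc(2)] WM, of n] unfolding block_power_corner R_def W_def by auto
    have WV: "class_le A W V"
      using 2(5) class_le_iff[OF WM sM] cuntz_le_czle[OF Mpos_Mi[OF WM] Mpos_Mi[OF sM]] by (simp add: W_def V_def)
    have cut: "a\<epsilon> \<preceq> block_diag A n c2 R"
    proof -
      let ?Q = "scalar_diag A n q"
      note Q = scalar_diag_projection[OF 2(1), of n]
      have cN: "c2 \<in> positive (M_n n A)" "R \<in> positive (M_n n A)"
        using 2(3) RM positive_M_inf[OF 2(4)] positive_M_inf[OF Rm] by auto
      have QN: "?Q \<in> carrier (M_n n A)" "star (M_n n A) ?Q = ?Q" "?Q \<otimes>\<^bsub>M_n n A\<^esub> ?Q = ?Q" using Q by simp_all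
      have one_R: "\<one>\<^bsub>M_n n A\<^esub> \<ominus>\<^bsub>M_n n A\<^esub> ?Q = R"
      proof -
        have "\<one>\<^bsub>M_n n A\<^esub> \<in> mat_carrier n A" using N.one_closed by simp
        from M_n_diff[OF this Q(1)] show ?thesis
          unfolding R_def by (auto simp: scalar_diag_def fun_eq_iff)
      qed
      have QaQ: "?Q \<otimes>\<^bsub>M_n n A\<^esub> a \<otimes>\<^bsub>M_n n A\<^esub> ?Q \<in> carrier (M_n n A)"
        using QN(1) n(1) by (intro N.m_closed) simp_all
      have n3: "cnorm (M_n n A) (c2 \<ominus>\<^bsub>M_n n A\<^esub> ?Q \<otimes>\<^bsub>M_n n A\<^esub> a \<otimes>\<^bsub>M_n n A\<^esub> ?Q) \<le> \<epsilon> / 4"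
        using 2(8) M_n_diff'[OF 2(4), of "?Q \<star> a \<star> ?Q"] QaQ by simp
      \<comment> \<open>The right-hand side of \<open>compress_le\<close>, so that
        \<open>a \<le> d + \<epsilon>/2\<close>. Being a combination of \<open>c2\<close> and
        \<open>R\<close> with nonnegative coefficients, \<open>d\<close> is Cuntz below their direct
        sum.\<close>
      define d where "d = 2 \<odot>\<^bsub>M_n n A\<^esub> c2 \<oplus>\<^bsub>M_n n A\<^esub> complex_of_real (2 * cnorm (M_n n A) a) \<odot>\<^bsub>M_n n A\<^esub> R"
      have pos: "(d \<oplus>\<^bsub>M_n n A\<^esub> complex_of_real (2 * (\<epsilon> / 4)) \<odot>\<^bsub>M_n n A\<^esub> \<one>\<^bsub>M_n n A\<^esub>) \<ominus>\<^bsub>M_n n A\<^esub> a \<in> positive (M_n n A)"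
        unfolding d_def one_R[symmetric] by (rule N.compress_le[OF n(2) QN N.pos_selfadj[OF cN(1)] n3])
      have an: "0 \<le> cnorm (M_n n A) a" using n(1) by (intro N.norm_ge_0) simp
      have d: "d \<in> positive (M_n n A)"
        unfolding d_def using N.pos_add[OF N.pos_scale[OF cN(1), of 2] N.pos_scale[OF cN(2), of "2 * cnorm (M_n n A) a"]] an by simp
      obtain g where g: "g \<in> N.selfadj" "a\<epsilon> = g \<otimes>\<^bsub>M_n n A\<^esub> (a \<otimes>\<^bsub>M_n n A\<^esub> g) \<ominus>\<^bsub>M_n n A\<^esub> complex_of_real (2 * (\<epsilon> / 4)) \<odot>\<^bsub>M_n n A\<^esub> (g \<otimes>\<^bsub>M_n n A\<^esub> g)"
        using N.cutoff_form[OF n(2), of "2 * (\<epsilon> / 4)" \<epsilon>] \<epsilon> unfolding a\<epsilon> by auto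
      have dm: "d \<in> mat_carrier n A" using N.pos_closed[OF d] by simp
      have "a\<epsilon> \<preceq> d"
        unfolding Mi.czle_def
      proof (intro allI impI)
        fix e :: real assume e: "0 < e"
        obtain v where v: "v \<in> carrier (M_n n A)"
          "cnorm (M_n n A) (v \<otimes>\<^bsub>M_n n A\<^esub> d \<otimes>\<^bsub>M_n n A\<^esub> star (M_n n A) v \<ominus>\<^bsub>M_n n A\<^esub> a\<epsilon>) < e"
          using N.cut_le_approx[OF a\<epsilon>N g(1) N.pos_selfadj[OF n(2)] d g(2) pos e] by blast
        have vc: "v \<otimes>\<^bsub>M_n n A\<^esub> d \<otimes>\<^bsub>M_n n A\<^esub> star (M_n n A) v \<in> carrier (M_n n A)"
          using v(1) N.pos_closed[OF d] by (intro N.m_closed N.star_closed)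
        have "cnorm (M_inf A) (v \<star> d \<star> Mstar v \<ominus>\<^bsub>M_inf A\<^esub> a\<epsilon>) < e"
          using v(2) M_n_diff'[of _ n a\<epsilon>] vc a\<epsilon>m by simp
        then show "\<exists>v\<in>Mcarrier. cnorm (M_inf A) (v \<star> d \<star> Mstar v \<ominus>\<^bsub>M_inf A\<^esub> a\<epsilon>) < e" using v(1) by auto
      qed
      moreover have "d \<preceq> block_diag A n c2 R"
        using block_scaled_sum[OF 2(4) Rm, of 2 "2 * cnorm (M_n n A) a"] an by (simp add: d_def)
      ultimately show ?thesis
        by (rule Mi_trans) (use a\<epsilon>m dm block_closed[OF 2(4) mc_Mi[OF Rm]] in auto)
    qed
    have nV: "class_times A n V \<in> Cl" by (rule Cl_times[OF V])
    \<comment> \<open>The witness represents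
      \<open>\<langle>b2\<rangle> + n\<langle>s\<rangle>\<close>. The \<open>k\<close>-fold
      multiples of the two summands each fit under one copy of
      \<open>\<langle>a\<rangle>\<close>.\<close>
    obtain b where b: "class_add A U (class_times A n V) = cuntz_class A b" "b \<in> positive (M_inf A)"
      using Cl_add[OF U nV] by (rule ClE)
    have Z2: "class_times A 2 Z = class_add A Z Z" using Cl_add_zero[OF Z] by (simp add: numeral_2_eq_2)
    have "class_times A k (cuntz_class A b) = class_add A (class_times A k U) (class_times A (k * n) V)"
      unfolding b(1)[symmetric] times_distrib[OF U nV] times_mult[OF V] ..
    then have r1: "class_le A (class_times A k (cuntz_class A b)) (class_times A 2 Z)"
      unfolding Z2 using Cl_add_mono[OF Cl_times[OF U] Cl_times[OF V] Z Z _ kV] 2(6) by (simp add: U_def)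
    \<comment> \<open>The multiplier is positive, so \<open>M\<close> copies of
      \<open>n\<langle>s\<rangle>\<close> contain the one copy that dominates the remainder.\<close>
    obtain M' where M': "M = Suc M'" by (cases M) (auto simp: M_def)
    have "class_le A (cuntz_class A a\<epsilon>) (cuntz_class A (block_diag A n c2 R))"
      using class_le_iff[OF a\<epsilon>M block_pos[OF 2(4,3) RM]] cut by simp
    then have s1: "class_le A (cuntz_class A a\<epsilon>) (class_add A (cuntz_class A c2) (class_times A n W))"
      unfolding nW class_add_block[OF 2(3,4) RM] .
    have "class_le A (class_times A n V) (class_times A M (class_times A n V))"
      unfolding M' times_Suc by (rule Cl_le_add[OF Cl_times[OF nV] nV])
    then have "class_le A (class_times A n W) (class_times A M (class_times A n V))"
      using Cl_le_trans[OF Cl_times[OF W] nV Cl_times[OF nV] Cl_times_mono[OF W V WV]] by blast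
    then have "class_le A (class_add A (cuntz_class A c2) (class_times A n W)) (class_add A (class_times A M U) (class_times A M (class_times A n V)))"
      using Cl_add_mono[OF ClI[OF 2(3)] Cl_times[OF W] Cl_times[OF U] Cl_times[OF nV]] 2(7) by (simp add: U_def)
    then have s2: "class_le A (class_add A (cuntz_class A c2) (class_times A n W)) (class_times A M (cuntz_class A b))"
      unfolding b(1)[symmetric] times_distrib[OF U nV] .
    have r2: "class_le A (cuntz_class A a\<epsilon>) (class_times A M (cuntz_class A b))"
      by (rule Cl_le_trans[OF ClI[OF a\<epsilon>M] Cl_add[OF ClI[OF 2(3)] Cl_times[OF W]] Cl_times[OF ClI[OF b(2)]] s1 s2])
    show "\<exists>b\<in>positive (M_inf A). class_le A (class_times A k (cuntz_class A b)) (class_times A 2 Z) \<and>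
      class_le A (cuntz_class A a\<epsilon>) (class_times A M (cuntz_class A b))"
      using r1 r2 b(2) by blast
  qed
qed

end

theorem theorem3p11:
  fixes m :: nat and \<Omega> :: "'u star_alg set" and A :: "'a star_alg"
  assumes "1 \<le> m"
    and "\<And>C. C \<in> \<Omega> \<Longrightarrow> unital_cstar_algebra C"
    and "\<And>C. C \<in> \<Omega> \<Longrightarrow> almost_divisible m C"
    and "unital_cstar_algebra A" and "simple_alg A" and "stably_finite A"
    and "A \<in> TAA \<Omega>"
    and "\<And>n D e. 1 \<le> n \<Longrightarrow> hereditary_subalgebra D (M_n n A) \<Longrightarrow> is_unit_of (M_n n A) D e \<Longrightarrow>
           unital_subalg (M_n n A) D e \<in> TAA \<Omega>"
  shows "weakly_almost_divisible 2 m A"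
  using unital_cstar.TAA_weakly_divisible[OF unital_cstar_algebra.is_unital_cstar[OF assms(4)]]
    unital_cstar_algebra.is_unital_cstar assms(2,3,7) by blast

end
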